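(* Let $\Psi=\{\psi_m\}_{m=1}^M\subset L^2(K)$ be such that for each $m\in\{1,2,\dots,M\}$ we have $|\widehat{\psi}_m|=\chi_{W_m}$ (the characteristic function of $W_m$), where $W_1,\dots,W_M$ are measurable subsets of $K$ and $W=\bigcup_{m=1}^M W_m$ is a disjoint union. Then $\Psi$ is a multiwavelet in $L^2(K)$ if and only if the following hold: (i) $\{\mathfrak p^{j}W: j\in\mathbb Z\}$ is a measurable partition of $K$; and (ii) for each $m\in\{1,2,\dots,M\}$, the system $\{W_m+u(k): k\in\mathbb N_0\}$ is a measurable partition of $K$.
   Context: Local field setup. $K$ is a local field of positive characteristic, i.e. a locally compact, non-discrete, totally disconnected field of characteristic $p>0$, with absolute value $|\cdot|$. $\mathcal O=\{x\in K:|x|\le 1\}$ is the ring of integers, $\mathfrak P=\{x\in K:|x|<1\}$ its maximal ideal, $\mathfrak p$ a fixed prime element ($\mathfrak P=\mathfrak p\mathcal O$), $\mathcal O^*=\mathcal O\setminus\mathfrak P$, and $\mathcal O/\mathfrak P\cong GF(q)$ with $q=p^c$; $|\mathfrak p|=q^{-1}$. $dx$ is the Haar measure on $(K,+)$ with $|\mathcal O|=1$, where $|E|$ denotes the Haar measure of a measurable set $E$. $\mathbb N_0=\mathbb N\cup\{0\}$. The elements $u(n)$, $n\in\mathbb N_0$: fix $\{1=\epsilon_0,\epsilon_1,\dots,\epsilon_{c-1}\}\subset\mathcal O^*$ whose images in $\mathcal O/\mathfrak P$ form a basis of $GF(q)$ over $GF(p)$. For $0\le n<q$ write $n=\sum_{k=0}^{c-1}a_kp^k$,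 $0\le a_k<p$, and set $u(n)=\big(\sum_{k=0}^{c-1}a_k\epsilon_k\big)\mathfrak p^{-1}$. For general $n=\sum_{k=0}^s b_kq^k$, $0\le b_k<q$, set $u(n)=\sum_{k=0}^s u(b_k)\mathfrak p^{-k}$. The set $\{u(n)\}_{n\in\mathbb N_0}$ is a complete list of distinct coset representatives of $\mathcal O$ in $(K,+)$. Character and Fourier transform: $\chi$ is a fixed character of $(K,+)$, trivial on $\mathcal O$ and nontrivial on $\mathfrak P^{-1}=\mathfrak p^{-1}\mathcal O$; $\chi_y(x)=\chi(yx)$; the setup is such that $\chi_{u(k)}(u(l))=1$ for all $k,l\in\mathbb N_0$. $\widehat f(\xi)=\int_K f(x)\overline{\chi_\xi(x)}\,dx$ for $f\in L^1(K)$, extended to $L^2(K)$. Operators on $L^2(K)$: $D^jf(x)=q^{j/2}f(\mathfrak p^{-j}x)$ for $j\in\mathbb Z$, and $T^kf(x)=f(x-u(k))$ for $k\in\mathbb N_0$. Definitions. A finite set $\Psi=\{\psi_1,\dots,\psi_M\}\subset L^2(K)$ is a multiwavelet (orthonormal multiwavelet of order $M$) if the system $\{D^jT^k\psi_m:1\le m\le M,\ j\in\mathbb Z,\ k\in\mathbb N_0\}$ is an orthonormal basis for $L^2(K)$. A countable indexed system of measurable sets is a measurable partition of a measurable set $E$ if sets with different indices intersect in a null set and the union equals $E$ up to a null set. *)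

theory Defs
  imports "HOL-Analysis.Analysis"
begin

text \<open>
  The metric of a local field is taken to be the one given by its absolute value, so that
  the absolute value of x is its distance to 0.
\<close>

definition absv :: "'a::{zero, metric_space} \<Rightarrow> real" where
  "absv x = dist x 0"

locale local_field_pos_char =
  fixes K :: "'a::{field, metric_space} itself"
  assumes dist_eq_absv_diff: "dist x y = absv (x - y :: 'a)"
    and absv_mult: "absv (x * y :: 'a) = absv x * absv y"
    and absv_ultrametric: "absv (x + y :: 'a) \<le> max (absv x) (absv y)"
    and locally_compact: "locally compact (UNIV :: 'a set)"
    and nondiscrete: "\<not> open {0 :: 'a}"
    and totally_disconnected: "connected (S :: 'a set) \<Longrightarrow> x \<in> S \<Longrightarrow> y \<in> S \<Longrightarrow> x = y"
    and positive_char: "CHAR('a) > 0"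

definition integer_ring :: "'a::{field, metric_space} set" where
  "integer_ring = {x. absv x \<le> 1}"

definition max_ideal :: "'a::{field, metric_space} set" where
  "max_ideal = {x. absv x < 1}"

text \<open>
  Parameters used throughout: a prime element \<open>\<pi>\<close>, the degree \<open>c\<close> of the residue field over its
  prime field, and lifts \<open>\<epsilon> 0, \<dots>, \<epsilon> (c - 1)\<close> of a basis of the residue field.
\<close>

definition residue_card :: "'a::{field, metric_space} itself \<Rightarrow> nat \<Rightarrow> nat" where
  "residue_card _ c = CHAR('a) ^ c"

definition u_digit :: "'a::{field, metric_space} \<Rightarrow> nat \<Rightarrow> (nat \<Rightarrow> 'a) \<Rightarrow> nat \<Rightarrow> 'a" where
  "u_digit \<pi> c \<epsilon> n =
     (\<Sum>k<c. of_nat ((n div CHAR('a) ^ k) mod CHAR('a)) * \<epsilon> k) * inverse \<pi>"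

text \<open>
  The digit of index \<open>k\<close> of \<open>n\<close> in base \<open>q\<close> vanishes for \<open>k > n\<close>, and the zero digit
  contributes 0, so the sum may be extended up to \<open>n\<close>.
\<close>

definition u :: "'a::{field, metric_space} \<Rightarrow> nat \<Rightarrow> (nat \<Rightarrow> 'a) \<Rightarrow> nat \<Rightarrow> 'a" where
  "u \<pi> c \<epsilon> n =
     (let q = residue_card TYPE('a) c
      in \<Sum>k\<le>n. u_digit \<pi> c \<epsilon> ((n div q ^ k) mod q) * inverse \<pi> ^ k)"

text \<open>
  The two conditions \<open>eps_independent\<close> and \<open>eps_spanning\<close> say that the residues of the \<open>\<epsilon> i\<close> form
  a basis of the residue field over the prime field, whose scalars are written as integers
  modulo the characteristic. The measure \<open>haar\<close> is the Haar measure on Borel sets; Haar measurable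
  sets and functions are those of \<open>completion haar\<close>.
\<close>

locale local_field_setup = local_field_pos_char "TYPE('a::{field, metric_space})" +
  fixes \<pi> :: "'a::{field, metric_space}" and c :: nat and \<epsilon> :: "nat \<Rightarrow> 'a"
    and haar :: "'a measure" and chi :: "'a \<Rightarrow> complex"
  assumes prime_element: "max_ideal = (\<lambda>x. \<pi> * x) ` integer_ring"
    and absv_prime: "absv \<pi> = 1 / real (residue_card TYPE('a) c)"
    and degree_pos: "c > 0"
    and eps_0: "\<epsilon> 0 = 1"
    and eps_unit: "i < c \<Longrightarrow> \<epsilon> i \<in> integer_ring - max_ideal"
    and eps_independent:
      "(\<Sum>i<c. of_int (a i) * \<epsilon> i) \<in> max_ideal \<Longrightarrow> i < c \<Longrightarrow> int CHAR('a) dvd a i"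
    and eps_spanning:
      "x \<in> integer_ring \<Longrightarrow> \<exists>a :: nat \<Rightarrow> int. x - (\<Sum>i<c. of_int (a i) * \<epsilon> i) \<in> max_ideal"
    and sets_haar: "sets haar = sets borel"
    and haar_translate: "E \<in> sets borel \<Longrightarrow> emeasure haar ((\<lambda>x. x + y) ` E) = emeasure haar E"
    and haar_integer_ring: "emeasure haar integer_ring = 1"
    and chi_continuous: "continuous_on UNIV chi"
    and chi_norm: "cmod (chi x) = 1"
    and chi_add: "chi (x + y) = chi x * chi y"
    and chi_trivial: "x \<in> integer_ring \<Longrightarrow> chi x = 1"
    and chi_nontrivial: "\<exists>x\<in>(\<lambda>x. inverse \<pi> * x) ` integer_ring. chi x \<noteq> 1"
    and chi_u: "chi (u \<pi> c \<epsilon> k * u \<pi> c \<epsilon> l) = 1"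

definition L2 :: "'a measure \<Rightarrow> ('a \<Rightarrow> complex) set" where
  "L2 \<mu> = {f \<in> borel_measurable \<mu>. integrable \<mu> (\<lambda>x. (cmod (f x))\<^sup>2)}"

definition L2_norm :: "'a measure \<Rightarrow> ('a \<Rightarrow> complex) \<Rightarrow> real" where
  "L2_norm \<mu> f = sqrt (\<integral>x. (cmod (f x))\<^sup>2 \<partial>\<mu>)"

definition L2_inner :: "'a measure \<Rightarrow> ('a \<Rightarrow> complex) \<Rightarrow> ('a \<Rightarrow> complex) \<Rightarrow> complex" where
  "L2_inner \<mu> f g = (\<integral>x. f x * cnj (g x) \<partial>\<mu>)"

definition L2_tendsto :: "'a measure \<Rightarrow> (nat \<Rightarrow> 'a \<Rightarrow> complex) \<Rightarrow> ('a \<Rightarrow> complex) \<Rightarrow> bool" where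
  "L2_tendsto \<mu> F f \<longleftrightarrow> (\<forall>n. F n \<in> L2 \<mu>) \<and> f \<in> L2 \<mu> \<and>
     (\<lambda>n. L2_norm \<mu> (\<lambda>x. F n x - f x)) \<longlonglongrightarrow> 0"

text \<open>
  An orthonormal basis of \<open>L2\<close> indexed by \<open>I\<close>: an orthonormal family whose finite linear
  combinations are dense. Functions represent their classes modulo null sets.
\<close>

definition L2_orthonormal_basis :: "'a measure \<Rightarrow> 'i set \<Rightarrow> ('i \<Rightarrow> 'a \<Rightarrow> complex) \<Rightarrow> bool" where
  "L2_orthonormal_basis \<mu> I e \<longleftrightarrow>
     (\<forall>i\<in>I. e i \<in> L2 \<mu>) \<and>
     (\<forall>i\<in>I. \<forall>j\<in>I. L2_inner \<mu> (e i) (e j) = (if i = j then 1 else 0)) \<and>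
     (\<forall>f\<in>L2 \<mu>. \<forall>r>0. \<exists>J a. finite J \<and> J \<subseteq> I \<and>
        L2_norm \<mu> (\<lambda>x. f x - (\<Sum>i\<in>J. a i * e i x)) < r)"

definition fourier_L1 ::
    "'a measure \<Rightarrow> ('a \<Rightarrow> complex) \<Rightarrow> ('a::{field, metric_space} \<Rightarrow> complex) \<Rightarrow> 'a \<Rightarrow> complex" where
  "fourier_L1 \<mu> chi f \<xi> = (\<integral>x. f x * cnj (chi (\<xi> * x)) \<partial>\<mu>)"

text \<open>
  The extension by continuity of the Fourier transform from the intersection of \<open>L1\<close> and \<open>L2\<close>
  to \<open>L2\<close>; it is determined up to a null set.
\<close>

definition fourier_L2 ::
    "'a measure \<Rightarrow> ('a \<Rightarrow> complex) \<Rightarrow> ('a::{field, metric_space} \<Rightarrow> complex) \<Rightarrow> 'a \<Rightarrow> complex" where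
  "fourier_L2 \<mu> chi f = (SOME g. g \<in> L2 \<mu> \<and>
     (\<forall>F. (\<forall>n. integrable \<mu> (F n)) \<and> L2_tendsto \<mu> F f \<longrightarrow>
        L2_tendsto \<mu> (\<lambda>n. fourier_L1 \<mu> chi (F n)) g))"

definition dilation ::
    "'a::{field, metric_space} \<Rightarrow> nat \<Rightarrow> int \<Rightarrow> ('a \<Rightarrow> complex) \<Rightarrow> 'a \<Rightarrow> complex" where
  "dilation \<pi> c j f x =
     complex_of_real (real (residue_card TYPE('a) c) powr (real_of_int j / 2)) *
     f (\<pi> powi (- j) * x)"

definition translation ::
    "'a::{field, metric_space} \<Rightarrow> nat \<Rightarrow> (nat \<Rightarrow> 'a) \<Rightarrow> nat \<Rightarrow> ('a \<Rightarrow> complex) \<Rightarrow> 'a \<Rightarrow> complex" where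
  "translation \<pi> c \<epsilon> k f x = f (x - u \<pi> c \<epsilon> k)"

definition multiwavelet ::
    "'a measure \<Rightarrow> 'a::{field, metric_space} \<Rightarrow> nat \<Rightarrow> (nat \<Rightarrow> 'a) \<Rightarrow>
     nat \<Rightarrow> (nat \<Rightarrow> 'a \<Rightarrow> complex) \<Rightarrow> bool" where
  "multiwavelet \<mu> \<pi> c \<epsilon> M \<psi> \<longleftrightarrow>
     L2_orthonormal_basis \<mu> ({1..M} \<times> UNIV \<times> UNIV)
       (\<lambda>(m, j, k). dilation \<pi> c j (translation \<pi> c \<epsilon> k (\<psi> m)))"

definition measurable_partition :: "'a measure \<Rightarrow> 'i set \<Rightarrow> ('i \<Rightarrow> 'a set) \<Rightarrow> 'a set \<Rightarrow> bool" where
  "measurable_partition \<mu> I A E \<longleftrightarrow>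
     countable I \<and> (\<forall>i\<in>I. A i \<in> sets \<mu>) \<and>
     (\<forall>i\<in>I. \<forall>j\<in>I. i \<noteq> j \<longrightarrow> A i \<inter> A j \<in> null_sets \<mu>) \<and>
     sym_diff (\<Union>i\<in>I. A i) E \<in> null_sets \<mu>"

end

theory Submission
  imports Defs
begin

text \<open>
The Fourier transform is unitary on \<open>L2\<close> and turns \<open>D^j T^k \<psi>\<close> into
\<open>q^(-j/2) * cnj (chi (u k * \<pi>^j * \<xi>)) * g (\<pi>^j * \<xi>)\<close>, where \<open>g\<close> is the transform of \<open>\<psi>\<close>
(\<open>fourier_pair_wavelet\<close>). The question is therefore when these functions form an orthonormal
basis, under the assumption that \<open>g\<close> is almost everywhere unimodular on \<open>W\<close>
and zero off \<open>W\<close> (\<open>dual_system_basis_iff\<close>).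

For one generator and one scale this is Fourier analysis on the compact group of integers \<open>O\<close>.
The representatives \<open>u k\<close> form a group, and \<open>chi (u k * u l) = 1\<close>, so each \<open>chi (u k * \<xi>)\<close> is
periodic under translation by all \<open>u l\<close>. The inner products of the functions
\<open>cnj (chi (u k * \<xi>)) * g \<xi>\<close> are the integrals of \<open>chi (u r * \<xi>)\<close> over \<open>W\<close>. If the translates
of \<open>W\<close> partition the field, these integrals agree with those over \<open>O\<close>, hence the functions are
orthonormal (\<open>tile_integral_chi\<close>); conversely, the integrals determine the number of translates of
\<open>W\<close> that cover a point (\<open>tile_if_integral_chi\<close>). When \<open>W\<close> tiles, the functions are also complete
in \<open>L2 W\<close> (\<open>tile_total\<close>). Completeness and the converse rest on one uniqueness statement: an
integrable function whose integrals against all \<open>chi (u k * \<xi>)\<close> vanish has integral zero over every periodic set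
(\<open>set_integral_periodic_eq_0\<close>).

Dilation by \<open>\<pi>^j\<close> carries the closed span of one generator at scale zero onto the functions
living on \<open>\<pi>^(-j) W\<close>. These spaces are orthogonal and exhaust \<open>L2\<close> exactly when the dilates of
the union of the \<open>W m\<close> are disjoint and cover the field, up to null sets.

For Plancherel, the field is cut into the cosets of \<open>O\<close>. On the product of the cosets of
\<open>u k\<close> and \<open>u l\<close> the kernel factors as \<open>chi (\<xi> * x) = chi (u k * x) * chi (u l * \<xi>)\<close>
(\<open>kernel_factor\<close>), so the Fourier transform sends the orthonormal basis of functions
\<open>chi (u k * x)\<close> cut off to the coset of \<open>u l\<close> to the orthonormal basis of functions
\<open>cnj (chi (u l * \<xi>))\<close> cut off to the coset of \<open>u k\<close>. It thus preserves coefficients with respect to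
these two bases, and a map with this property is unitary (\<open>fourier_pair_L2\<close>).
\<close>

section \<open>Square-integrable functions\<close>

lemma L2_measurable: "f \<in> L2 \<mu> \<Longrightarrow> f \<in> borel_measurable \<mu>"
  by (simp add: L2_def)

lemma L2_integrable_sq: "f \<in> L2 \<mu> \<Longrightarrow> integrable \<mu> (\<lambda>x. (cmod (f x))\<^sup>2)"
  by (simp add: L2_def)

lemma borel_measurable_cnj [measurable]:
  "f \<in> borel_measurable M \<Longrightarrow> (\<lambda>x. cnj (f x)) \<in> borel_measurable M"
  by (rule borel_measurable_continuous_on) (auto intro: continuous_intros)

lemma cmod_add_sq_le: "(cmod (a + b))\<^sup>2 \<le> 2 * (cmod a)\<^sup>2 + 2 * (cmod b)\<^sup>2"
proof -
  have "(cmod (a + b))\<^sup>2 \<le> (cmod a + cmod b)\<^sup>2"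
    by (intro power_mono norm_triangle_ineq) auto
  also have "\<dots> \<le> 2 * (cmod a)\<^sup>2 + 2 * (cmod b)\<^sup>2"
    using sum_squares_bound[of "cmod a" "cmod b"] by (simp add: power2_sum)
  finally show ?thesis .
qed

lemma L2_bound:
  assumes "g \<in> L2 \<mu>" "f \<in> borel_measurable \<mu>" "AE x in \<mu>. cmod (f x) \<le> cmod (g x)"
  shows "f \<in> L2 \<mu>"
proof -
  have "integrable \<mu> (\<lambda>x. (cmod (f x))\<^sup>2)"
    by (rule Bochner_Integration.integrable_bound[OF L2_integrable_sq[OF assms(1)]])
       (use assms in \<open>auto intro: power_mono\<close>)
  then show ?thesis using assms(2) by (simp add: L2_def)
qed

lemma L2_add:
  assumes "f \<in> L2 \<mu>" "g \<in> L2 \<mu>"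
  shows "(\<lambda>x. f x + g x) \<in> L2 \<mu>"
proof -
  note [measurable] = L2_measurable[OF assms(1)] L2_measurable[OF assms(2)]
  have "integrable \<mu> (\<lambda>x. (cmod (f x + g x))\<^sup>2)"
    by (rule Bochner_Integration.integrable_bound
          [of _ "\<lambda>x. 2 * (cmod (f x))\<^sup>2 + 2 * (cmod (g x))\<^sup>2"])
       (use assms cmod_add_sq_le in \<open>auto simp: L2_integrable_sq\<close>)
  then show ?thesis by (simp add: L2_def)
qed

lemma L2_scale: "f \<in> L2 \<mu> \<Longrightarrow> (\<lambda>x. a * f x) \<in> L2 \<mu>"
  by (auto simp: L2_def norm_mult power_mult_distrib)

lemma L2_diff:
  assumes "f \<in> L2 \<mu>" "g \<in> L2 \<mu>"
  shows "(\<lambda>x. f x - g x) \<in> L2 \<mu>"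
  using L2_add[OF assms(1) L2_scale[OF assms(2), of "-1"]] by simp

lemma L2_zero: "(\<lambda>x. 0) \<in> L2 \<mu>"
  by (simp add: L2_def)

lemma L2_sum: "(\<And>i. i \<in> J \<Longrightarrow> e i \<in> L2 \<mu>) \<Longrightarrow> (\<lambda>x. \<Sum>i\<in>J. a i * e i x) \<in> L2 \<mu>"
  by (induction J rule: infinite_finite_induct) (auto intro!: L2_zero L2_add L2_scale)

lemma indicator_L2:
  assumes "A \<in> sets \<mu>" "emeasure \<mu> A < \<infinity>"
  shows "(\<lambda>x. of_real (indicat_real A x)) \<in> L2 \<mu>"
proof -
  have "(\<lambda>x. (cmod (of_real (indicat_real A x)))\<^sup>2) = indicat_real A"
    by (auto simp: indicator_def)
  then show ?thesis using assms by (simp add: L2_def integrable_indicator_iff)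
qed

lemma L2_mult_integrable:
  assumes "f \<in> L2 \<mu>" "g \<in> L2 \<mu>"
  shows "integrable \<mu> (\<lambda>x. f x * cnj (g x))"
proof (rule Bochner_Integration.integrable_bound)
  show "integrable \<mu> (\<lambda>x. (cmod (f x))\<^sup>2 + (cmod (g x))\<^sup>2)"
    using assms by (simp add: L2_integrable_sq)
  show "(\<lambda>x. f x * cnj (g x)) \<in> borel_measurable \<mu>"
    using assms[THEN L2_measurable] by (intro borel_measurable_times borel_measurable_cnj)
  have "cmod a * cmod b \<le> (cmod a)\<^sup>2 + (cmod b)\<^sup>2" for a b :: complex
  proof -
    have "2 * (cmod a * cmod b) \<le> (cmod a)\<^sup>2 + (cmod b)\<^sup>2"
      using sum_squares_bound[of "cmod a" "cmod b"] by simp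
    then show ?thesis
      using mult_nonneg_nonneg[OF norm_ge_zero[of a] norm_ge_zero[of b]] by linarith
  qed
  then show "AE x in \<mu>. norm (f x * cnj (g x)) \<le> norm ((cmod (f x))\<^sup>2 + (cmod (g x))\<^sup>2)"
    by (simp add: norm_mult)
qed

lemma L2_inner_add_left:
  assumes "f \<in> L2 \<mu>" "g \<in> L2 \<mu>" "h \<in> L2 \<mu>"
  shows "L2_inner \<mu> (\<lambda>x. f x + g x) h = L2_inner \<mu> f h + L2_inner \<mu> g h"
  using assms by (simp add: L2_inner_def distrib_right L2_mult_integrable)

lemma L2_inner_diff_left:
  assumes "f \<in> L2 \<mu>" "g \<in> L2 \<mu>" "h \<in> L2 \<mu>"
  shows "L2_inner \<mu> (\<lambda>x. f x - g x) h = L2_inner \<mu> f h - L2_inner \<mu> g h"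
  using assms by (simp add: L2_inner_def left_diff_distrib L2_mult_integrable)

lemma L2_inner_scale_left: "L2_inner \<mu> (\<lambda>x. a * f x) h = a * L2_inner \<mu> f h"
  by (simp add: L2_inner_def mult.assoc)

lemma L2_inner_commute: "L2_inner \<mu> g f = cnj (L2_inner \<mu> f g)"
  unfolding L2_inner_def Bochner_Integration.integral_cnj[symmetric] complex_cnj_mult complex_cnj_cnj
  by (simp only: mult.commute)

lemma L2_inner_sum_left:
  assumes "\<And>i. i \<in> J \<Longrightarrow> e i \<in> L2 \<mu>" "h \<in> L2 \<mu>"
  shows "L2_inner \<mu> (\<lambda>x. \<Sum>i\<in>J. a i * e i x) h = (\<Sum>i\<in>J. a i * L2_inner \<mu> (e i) h)"
  using assms(1)
proof (induction J rule: infinite_finite_induct)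
  case (insert i J)
  then have "L2_inner \<mu> (\<lambda>x. a i * e i x + (\<Sum>i\<in>J. a i * e i x)) h =
      L2_inner \<mu> (\<lambda>x. a i * e i x) h + L2_inner \<mu> (\<lambda>x. \<Sum>i\<in>J. a i * e i x) h"
    by (intro L2_inner_add_left L2_scale L2_sum assms(2)) auto
  with insert show ?case by (simp add: L2_inner_scale_left)
qed (simp_all add: L2_inner_def)

lemma L2_inner_self: "L2_inner \<mu> f f = of_real ((L2_norm \<mu> f)\<^sup>2)"
proof -
  have "L2_inner \<mu> f f = (\<integral>x. complex_of_real ((cmod (f x))\<^sup>2) \<partial>\<mu>)"
    unfolding L2_inner_def by (simp add: complex_mult_cnj cmod_def)
  then show ?thesis
    unfolding L2_norm_def integral_complex_of_real by (simp add: Bochner_Integration.integral_nonneg)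
qed

lemma L2_norm_nonneg: "L2_norm \<mu> f \<ge> 0"
  by (simp add: L2_norm_def)

lemma L2_norm_zero_iff:
  assumes "f \<in> L2 \<mu>"
  shows "L2_norm \<mu> f = 0 \<longleftrightarrow> (AE x in \<mu>. f x = 0)"
  using integral_nonneg_eq_0_iff_AE[OF L2_integrable_sq[OF assms]] by (simp add: L2_norm_def)

lemma L2_inner_cong:
  assumes "AE x in \<mu>. f x = f' x" "AE x in \<mu>. g x = g' x"
    "f \<in> borel_measurable \<mu>" "f' \<in> borel_measurable \<mu>"
    "g \<in> borel_measurable \<mu>" "g' \<in> borel_measurable \<mu>"
  shows "L2_inner \<mu> f g = L2_inner \<mu> f' g'"
  unfolding L2_inner_def by (rule integral_cong_AE) (use assms in \<open>auto intro!: borel_measurable_times borel_measurable_cnj\<close>)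

lemma L2_norm_diff_sq:
  assumes "f \<in> L2 \<mu>" "g \<in> L2 \<mu>"
  shows "(L2_norm \<mu> (\<lambda>x. f x - g x))\<^sup>2 =
    (L2_norm \<mu> f)\<^sup>2 - 2 * Re (L2_inner \<mu> f g) + (L2_norm \<mu> g)\<^sup>2"
proof -
  let ?d = "\<lambda>x. f x - g x"
  have d: "?d \<in> L2 \<mu>" using L2_diff assms .
  have "L2_inner \<mu> ?d ?d = L2_inner \<mu> f ?d - L2_inner \<mu> g ?d"
    using assms d by (rule L2_inner_diff_left)
  also have "L2_inner \<mu> f ?d = cnj (L2_inner \<mu> f f - L2_inner \<mu> g f)"
    using L2_inner_diff_left[OF assms assms(1)] L2_inner_commute[of \<mu> f ?d] by simp
  also have "L2_inner \<mu> g ?d = cnj (L2_inner \<mu> f g - L2_inner \<mu> g g)"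
    using L2_inner_diff_left[OF assms assms(2)] L2_inner_commute[of \<mu> g ?d] by simp
  finally have "Re (L2_inner \<mu> ?d ?d) =
     Re (L2_inner \<mu> f f) - 2 * Re (L2_inner \<mu> f g) + Re (L2_inner \<mu> g g)"
    using L2_inner_commute[of \<mu> g f] by simp
  then show ?thesis by (simp only: L2_inner_self Re_complex_of_real)
qed

lemma L2_norm_scale: "L2_norm \<mu> (\<lambda>x. a * f x) = cmod a * L2_norm \<mu> f"
  by (simp add: L2_norm_def norm_mult power_mult_distrib real_sqrt_mult)

lemma L2_Cauchy_Schwarz:
  assumes "f \<in> L2 \<mu>" "g \<in> L2 \<mu>"
  shows "cmod (L2_inner \<mu> f g) \<le> L2_norm \<mu> f * L2_norm \<mu> g"
proof (cases "L2_norm \<mu> g = 0")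
  case True
  then have "AE x in \<mu>. g x = 0" using L2_norm_zero_iff assms by blast
  then have "L2_inner \<mu> f g = L2_inner \<mu> f (\<lambda>x. 0)"
    using assms[THEN L2_measurable] by (intro L2_inner_cong) auto
  then show ?thesis using True by (simp add: L2_inner_def)
next
  case False
  define N where "N = (L2_norm \<mu> g)\<^sup>2"
  have N: "N > 0" using False by (simp add: N_def)
  define z where "z = L2_inner \<mu> f g"
  have "0 \<le> (L2_norm \<mu> (\<lambda>x. f x - (z / N) * g x))\<^sup>2" by simp
  also have "\<dots> = (L2_norm \<mu> f)\<^sup>2 - 2 * Re (L2_inner \<mu> f (\<lambda>x. (z / N) * g x))
      + (L2_norm \<mu> (\<lambda>x. (z / N) * g x))\<^sup>2"
    by (intro L2_norm_diff_sq L2_scale assms)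
  also have "(L2_norm \<mu> (\<lambda>x. (z / N) * g x))\<^sup>2 = (cmod z)\<^sup>2 / N"
    unfolding L2_norm_scale using N
    by (simp add: norm_divide power_mult_distrib power_divide N_def[symmetric])
      (simp add: power2_eq_square)
  also have "L2_inner \<mu> f (\<lambda>x. (z / N) * g x) = cnj (z / N) * z"
    using L2_inner_scale_left[of \<mu> "z / N" g f] L2_inner_commute[of \<mu> f "\<lambda>x. (z / N) * g x"]
      L2_inner_commute[of \<mu> f g] by (simp add: z_def)
  also have "Re (cnj (z / N) * z) = (cmod z)\<^sup>2 / N"
    by (simp add: cmod_def power2_eq_square add_divide_distrib)
  finally have "(cmod z)\<^sup>2 / N \<le> (L2_norm \<mu> f)\<^sup>2" by simp
  then have "(cmod z)\<^sup>2 \<le> (L2_norm \<mu> f * L2_norm \<mu> g)\<^sup>2"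
    using N by (simp add: pos_divide_le_eq power_mult_distrib N_def)
  then show ?thesis
    unfolding z_def by (rule power2_le_imp_le) (simp add: L2_norm_nonneg)
qed

lemma L2_norm_minus_commute: "L2_norm \<mu> (\<lambda>x. f x - g x) = L2_norm \<mu> (\<lambda>x. g x - f x)"
  by (simp add: L2_norm_def norm_minus_commute)

lemma L2_tendsto_inner:
  assumes "L2_tendsto \<mu> F f" "g \<in> L2 \<mu>"
  shows "(\<lambda>n. L2_inner \<mu> (F n) g) \<longlonglongrightarrow> L2_inner \<mu> f g"
proof -
  have F: "F n \<in> L2 \<mu>" and f: "f \<in> L2 \<mu>" for n using assms by (auto simp: L2_tendsto_def)
  have "(\<lambda>n. L2_inner \<mu> (F n) g - L2_inner \<mu> f g) \<longlonglongrightarrow> 0"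
  proof (rule Lim_null_comparison)
    show "(\<lambda>n. L2_norm \<mu> (\<lambda>x. F n x - f x) * L2_norm \<mu> g) \<longlonglongrightarrow> 0"
      using assms by (auto simp: L2_tendsto_def intro: tendsto_mult_left_zero)
    show "\<forall>\<^sub>F n in sequentially. norm (L2_inner \<mu> (F n) g - L2_inner \<mu> f g)
        \<le> L2_norm \<mu> (\<lambda>x. F n x - f x) * L2_norm \<mu> g"
      using L2_Cauchy_Schwarz[OF L2_diff[OF F f] assms(2)] L2_inner_diff_left[OF F f assms(2)]
      by simp
  qed
  then show ?thesis by (simp add: LIM_zero_iff)
qed

lemma L2_norm_cong_AE:
  assumes "f \<in> borel_measurable \<mu>" "g \<in> borel_measurable \<mu>" "AE x in \<mu>. f x = g x"
  shows "L2_norm \<mu> f = L2_norm \<mu> g"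
proof -
  have "(\<integral>x. (cmod (f x))\<^sup>2 \<partial>\<mu>) = (\<integral>x. (cmod (g x))\<^sup>2 \<partial>\<mu>)"
    by (rule integral_cong_AE) (use assms in auto)
  then show ?thesis by (simp add: L2_norm_def)
qed

lemma nn_integral_L2:
  assumes "f \<in> L2 \<mu>"
  shows "(\<integral>\<^sup>+x. ennreal ((cmod (f x))\<^sup>2) \<partial>\<mu>) = ennreal ((L2_norm \<mu> f)\<^sup>2)"
  using nn_integral_eq_integral[OF L2_integrable_sq[OF assms]]
  by (simp add: L2_norm_def Bochner_Integration.integral_nonneg)

text \<open>
Along a subsequence whose consecutive differences \<open>d i\<close> have norm at most \<open>2^(-i)\<close>, the function
\<open>\<Sum>i. 2^i * (cmod (d i x))\<^sup>2\<close> has finite integral. So \<open>cmod (d i x)\<close> decays geometrically for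
almost every \<open>x\<close> and the subsequence converges there; Fatou's lemma bounds the distance to the
limit.
\<close>

lemma L2_complete:
  assumes s: "\<And>n. s n \<in> L2 \<mu>"
    and cauchy: "\<And>e. e > 0 \<Longrightarrow> \<exists>N. \<forall>m\<ge>N. \<forall>n\<ge>N. L2_norm \<mu> (\<lambda>x. s m x - s n x) < e"
  obtains g where "L2_tendsto \<mu> s g"
proof -
  note [measurable] = L2_measurable[OF s]
  have "\<forall>i. \<exists>N. \<forall>m\<ge>N. \<forall>n\<ge>N. L2_norm \<mu> (\<lambda>x. s m x - s n x) < (1/2)^i"
    using cauchy by simp
  then obtain N where N: "\<And>i m n. m \<ge> N i \<Longrightarrow> n \<ge> N i \<Longrightarrow> L2_norm \<mu> (\<lambda>x. s m x - s n x) < (1/2)^i"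
    by metis
  \<comment> \<open>The summand \<open>i\<close> ensures \<open>r i \<ge> i\<close>, so that a Cauchy estimate beyond \<open>M\<close> also applies to \<open>s (r n)\<close> for \<open>n \<ge> M\<close>.\<close>
  define r where "r i = i + (\<Sum>j\<le>i. N j)" for i
  have rN: "r i \<ge> N i" for i
    unfolding r_def using member_le_sum[of i "{..i}" N] by simp
  have rS: "r (Suc i) \<ge> N i" for i using rN[of i] by (simp add: r_def)
  define d where "d i x = s (r (Suc i)) x - s (r i) x" for i x
  have dL2: "d i \<in> L2 \<mu>" for i unfolding d_def by (intro L2_diff s)
  note [measurable] = L2_measurable[OF dL2]
  have dn: "(L2_norm \<mu> (d i))\<^sup>2 \<le> (1/4)^i" for i
  proof -
    have "L2_norm \<mu> (d i) < (1/2)^i" unfolding d_def by (intro N rN rS)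
    then have "(L2_norm \<mu> (d i))\<^sup>2 \<le> ((1/2)^i)\<^sup>2"
      by (intro power_mono L2_norm_nonneg) simp
    also have "\<dots> = (1/4)^i" by (simp add: power2_eq_square flip: power_mult_distrib)
    finally show ?thesis .
  qed
  have "(\<integral>\<^sup>+x. (\<Sum>i. ennreal (2^i * (cmod (d i x))\<^sup>2)) \<partial>\<mu>) =
      (\<Sum>i. \<integral>\<^sup>+x. ennreal (2^i * (cmod (d i x))\<^sup>2) \<partial>\<mu>)"
    by (rule nn_integral_suminf) simp
  also have "\<dots> \<le> (\<Sum>i. ennreal ((1/2)^i))"
  proof (rule suminf_le)
    fix i
    have "(\<integral>\<^sup>+x. ennreal (2^i * (cmod (d i x))\<^sup>2) \<partial>\<mu>) = ennreal (2^i * (L2_norm \<mu> (d i))\<^sup>2)"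
      by (simp add: ennreal_mult nn_integral_cmult nn_integral_L2[OF dL2])
    also have "\<dots> \<le> ennreal (2^i * (1/4)^i)"
      using dn by (intro ennreal_leI mult_left_mono) auto
    also have "(2::real)^i * (1/4)^i = (1/2)^i" by (simp flip: power_mult_distrib)
    finally show "(\<integral>\<^sup>+x. ennreal (2^i * (cmod (d i x))\<^sup>2) \<partial>\<mu>) \<le> ennreal ((1/2)^i)" .
  qed auto
  also have "\<dots> < \<infinity>"
    by (subst suminf_ennreal2) (auto intro: summable_geometric)
  finally have "AE x in \<mu>. (\<Sum>i. ennreal (2^i * (cmod (d i x))\<^sup>2)) \<noteq> \<infinity>"
    by (intro nn_integral_PInf_AE) auto
  then have conv: "AE x in \<mu>. convergent (\<lambda>n. s (r n) x)"
  proof eventually_elim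
    case (elim x)
    define S where "S = (\<Sum>i. ennreal (2^i * (cmod (d i x))\<^sup>2))"
    from elim have "S \<noteq> \<infinity>" by (simp only: S_def not_False_eq_True)
    then obtain C where "S = ennreal C" "C \<ge> 0" by (cases S) auto
    then have C: "(\<Sum>i. ennreal (2^i * (cmod (d i x))\<^sup>2)) = ennreal C" "C \<ge> 0"
      by (simp_all only: S_def)
    have bd: "norm (d i x) \<le> sqrt C * (sqrt (1/2))^i" for i
    proof -
      have "ennreal (2^i * (cmod (d i x))\<^sup>2) \<le> ennreal C"
        unfolding C(1)[symmetric]
        by (rule sum_le_suminf[of _ "{i}", simplified]) auto
      then have "2^i * (cmod (d i x))\<^sup>2 \<le> C" using C(2) by (simp add: ennreal_le_iff)
      then have "(cmod (d i x))\<^sup>2 \<le> C * (1/2)^i"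
        by (simp add: field_simps)
      then have "sqrt ((cmod (d i x))\<^sup>2) \<le> sqrt (C * (1/2)^i)" by (rule real_sqrt_le_mono)
      then show ?thesis by (simp add: real_sqrt_mult real_sqrt_power)
    qed
    have "summable (\<lambda>i. d i x)"
    proof (rule summable_comparison_test')
      show "summable (\<lambda>i. sqrt C * (sqrt (1/2))^i)"
        by (intro summable_mult summable_geometric) (simp add: real_sqrt_divide)
    qed (use bd in auto)
    then have "convergent (\<lambda>n. \<Sum>i<n. d i x)" by (simp add: summable_iff_convergent)
    then have "convergent (\<lambda>n. s (r 0) x + (\<Sum>i<n. d i x))"
      by (intro convergent_add convergent_const)
    moreover have "s (r 0) x + (\<Sum>i<n. d i x) = s (r n) x" for n
      using sum_lessThan_telescope[of "\<lambda>n. s (r n) x" n] by (simp add: d_def)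
    ultimately show ?case by simp
  qed
  define g where "g x = lim (\<lambda>n. s (r n) x)" for x
  have [measurable]: "g \<in> borel_measurable \<mu>"
    unfolding g_def by (rule borel_measurable_lim_metric) simp
  have close: "s m \<in> L2 \<mu> \<and> (\<lambda>x. s m x - g x) \<in> L2 \<mu> \<and> L2_norm \<mu> (\<lambda>x. s m x - g x) \<le> e"
    if "e > 0" and M: "\<And>m n. m \<ge> M \<Longrightarrow> n \<ge> M \<Longrightarrow> L2_norm \<mu> (\<lambda>x. s m x - s n x) < e"
      and "m \<ge> M" for e m M
  proof -
    have "(\<integral>\<^sup>+x. ennreal ((cmod (s m x - g x))\<^sup>2) \<partial>\<mu>) =
        (\<integral>\<^sup>+x. liminf (\<lambda>n. ennreal ((cmod (s m x - s (r n) x))\<^sup>2)) \<partial>\<mu>)"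
    proof (rule nn_integral_cong_AE, use conv in eventually_elim)
      case (elim x)
      then have "(\<lambda>n. s (r n) x) \<longlonglongrightarrow> g x" by (simp add: g_def convergent_LIMSEQ_iff)
      then have "(\<lambda>n. ennreal ((cmod (s m x - s (r n) x))\<^sup>2)) \<longlonglongrightarrow> ennreal ((cmod (s m x - g x))\<^sup>2)"
        by (intro tendsto_intros)
      then show ?case by (rule lim_imp_Liminf[symmetric, rotated]) simp
    qed
    also have "\<dots> \<le> liminf (\<lambda>n. \<integral>\<^sup>+x. ennreal ((cmod (s m x - s (r n) x))\<^sup>2) \<partial>\<mu>)"
      by (rule nn_integral_liminf) simp
    also have "\<dots> \<le> ennreal (e\<^sup>2)"
    proof (rule Liminf_le)
      show "\<forall>\<^sub>F n in sequentially.
          (\<integral>\<^sup>+x. ennreal ((cmod (s m x - s (r n) x))\<^sup>2) \<partial>\<mu>) \<le> ennreal (e\<^sup>2)"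
        unfolding eventually_sequentially
      proof (intro exI[of _ M] allI impI)
        fix n assume "n \<ge> M"
        then have "r n \<ge> M" by (simp add: r_def)
        then have "L2_norm \<mu> (\<lambda>x. s m x - s (r n) x) < e" using M \<open>m \<ge> M\<close> by blast
        then have "(L2_norm \<mu> (\<lambda>x. s m x - s (r n) x))\<^sup>2 \<le> e\<^sup>2"
          by (intro power_mono L2_norm_nonneg) simp
        then show "(\<integral>\<^sup>+x. ennreal ((cmod (s m x - s (r n) x))\<^sup>2) \<partial>\<mu>) \<le> ennreal (e\<^sup>2)"
          by (subst nn_integral_L2[OF L2_diff[OF s s]]) (rule ennreal_leI)
      qed
    qed simp
    finally have *: "(\<integral>\<^sup>+x. ennreal ((cmod (s m x - g x))\<^sup>2) \<partial>\<mu>) \<le> ennreal (e\<^sup>2)" .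
    then have "integrable \<mu> (\<lambda>x. (cmod (s m x - g x))\<^sup>2)"
      by (intro integrableI_bounded) (auto simp: le_less_trans)
    then have L2: "(\<lambda>x. s m x - g x) \<in> L2 \<mu>" by (simp add: L2_def)
    then have "(L2_norm \<mu> (\<lambda>x. s m x - g x))\<^sup>2 \<le> e\<^sup>2"
      using * unfolding nn_integral_L2[OF L2] by simp
    then show ?thesis using L2 s \<open>e > 0\<close> by (auto intro: power2_le_imp_le)
  qed
  obtain M where "\<And>m n. m \<ge> M \<Longrightarrow> n \<ge> M \<Longrightarrow> L2_norm \<mu> (\<lambda>x. s m x - s n x) < 1"
    using cauchy[of 1] by auto
  from close[OF _ this order_refl] have "(\<lambda>x. s M x - g x) \<in> L2 \<mu>" by simp
  from L2_diff[OF s this, of M] have "g \<in> L2 \<mu>" by simp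
  moreover have "(\<lambda>n. L2_norm \<mu> (\<lambda>x. s n x - g x)) \<longlonglongrightarrow> 0"
  proof (rule LIMSEQ_I)
    fix e :: real assume "e > 0"
    obtain M where "\<And>m n. m \<ge> M \<Longrightarrow> n \<ge> M \<Longrightarrow> L2_norm \<mu> (\<lambda>x. s m x - s n x) < e / 2"
      using cauchy[of "e / 2"] \<open>e > 0\<close> by auto
    from close[OF _ this] have "L2_norm \<mu> (\<lambda>x. s m x - g x) \<le> e / 2" if "m \<ge> M" for m
      using \<open>e > 0\<close> that by simp
    then show "\<exists>no. \<forall>n\<ge>no. norm (L2_norm \<mu> (\<lambda>x. s n x - g x) - 0) < e"
      using \<open>e > 0\<close> by (intro exI[of _ M]) (auto simp: L2_norm_nonneg intro: le_less_trans[of _ "e / 2"])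
  qed
  ultimately show thesis using s by (intro that[of g]) (simp add: L2_tendsto_def)
qed

lemma L2_cong_AE:
  assumes "f \<in> L2 \<mu>" "g \<in> borel_measurable \<mu>" "AE x in \<mu>. f x = g x"
  shows "g \<in> L2 \<mu>"
  by (rule L2_bound[OF assms(1,2)]) (use assms(3) in eventually_elim, simp)

lemma L2_tendsto_map:
  assumes "L2_tendsto \<mu> F f"
    and T: "\<And>f. f \<in> L2 \<mu> \<Longrightarrow> T f \<in> L2 \<mu>"
    and N: "\<And>f. f \<in> L2 \<mu> \<Longrightarrow> L2_norm \<mu> (T f) = r * L2_norm \<mu> f"
    and D: "\<And>f g. T (\<lambda>x. f x - g x) = (\<lambda>x. T f x - T g x)"
  shows "L2_tendsto \<mu> (\<lambda>n. T (F n)) (T f)"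
proof -
  have F: "F n \<in> L2 \<mu>" and f: "f \<in> L2 \<mu>" for n using assms(1) by (auto simp: L2_tendsto_def)
  have "L2_norm \<mu> (\<lambda>x. T (F n) x - T f x) = r * L2_norm \<mu> (\<lambda>x. F n x - f x)" for n
    unfolding D[symmetric] by (rule N[OF L2_diff[OF F f]])
  then show ?thesis
    using assms(1) T[OF F] T[OF f] by (simp add: L2_tendsto_def tendsto_mult_right_zero)
qed

section \<open>Orthonormal bases and functions with matching coefficients\<close>

definition L2_orthonormal :: "'a measure \<Rightarrow> 'i set \<Rightarrow> ('i \<Rightarrow> 'a \<Rightarrow> complex) \<Rightarrow> bool" where
  "L2_orthonormal \<mu> I e \<longleftrightarrow> (\<forall>i\<in>I. e i \<in> L2 \<mu>) \<and>
     (\<forall>i\<in>I. \<forall>j\<in>I. L2_inner \<mu> (e i) (e j) = (if i = j then 1 else 0))"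

text \<open>
Totality, unlike density of the span, can be read off from a uniqueness theorem for coefficients.
Completeness of \<open>L2\<close> makes the two equivalent for orthonormal families
(\<open>L2_orthonormal_basis_iff\<close>).
\<close>

definition L2_total :: "'a measure \<Rightarrow> 'i set \<Rightarrow> ('i \<Rightarrow> 'a \<Rightarrow> complex) \<Rightarrow> bool" where
  "L2_total \<mu> I e \<longleftrightarrow> (\<forall>f\<in>L2 \<mu>. (\<forall>i\<in>I. L2_inner \<mu> f (e i) = 0) \<longrightarrow> (AE x in \<mu>. f x = 0))"

lemma orthonormal_L2: "L2_orthonormal \<mu> I e \<Longrightarrow> i \<in> I \<Longrightarrow> e i \<in> L2 \<mu>"
  by (simp add: L2_orthonormal_def)

lemma orthonormal_inner_sum:
  assumes "L2_orthonormal \<mu> I e" "finite J" "J \<subseteq> I" "i \<in> I"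
  shows "L2_inner \<mu> (\<lambda>x. \<Sum>j\<in>J. a j * e j x) (e i) = (if i \<in> J then a i else 0)"
proof -
  have "L2_inner \<mu> (\<lambda>x. \<Sum>j\<in>J. a j * e j x) (e i) = (\<Sum>j\<in>J. a j * L2_inner \<mu> (e j) (e i))"
    using assms by (intro L2_inner_sum_left) (auto simp: L2_orthonormal_def)
  also have "\<dots> = (\<Sum>j\<in>J. if j = i then a i else 0)"
    using assms by (intro sum.cong) (auto simp: L2_orthonormal_def)
  finally show ?thesis using assms(2) by simp
qed

lemma orthonormal_sum_L2:
  assumes "L2_orthonormal \<mu> I e" "J \<subseteq> I"
  shows "(\<lambda>x. \<Sum>i\<in>J. a i * e i x) \<in> L2 \<mu>"
  using assms by (intro L2_sum) (auto simp: L2_orthonormal_def)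

lemma orthonormal_norm_sum:
  assumes "L2_orthonormal \<mu> I e" "finite J" "J \<subseteq> I"
  shows "(L2_norm \<mu> (\<lambda>x. \<Sum>i\<in>J. a i * e i x))\<^sup>2 = (\<Sum>i\<in>J. (cmod (a i))\<^sup>2)"
proof -
  let ?s = "\<lambda>x. \<Sum>i\<in>J. a i * e i x"
  have "L2_inner \<mu> ?s ?s = (\<Sum>i\<in>J. a i * L2_inner \<mu> (e i) ?s)"
    using assms by (intro L2_inner_sum_left orthonormal_sum_L2) (auto simp: L2_orthonormal_def)
  also have "\<dots> = (\<Sum>i\<in>J. a i * cnj (a i))"
    using assms L2_inner_commute[of \<mu> _ ?s]
    by (intro sum.cong) (auto simp: orthonormal_inner_sum subset_iff)
  also have "\<dots> = of_real (\<Sum>i\<in>J. (cmod (a i))\<^sup>2)"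
    by (simp only: complex_norm_square of_real_sum)
  finally show ?thesis unfolding L2_inner_self of_real_eq_iff .
qed

lemma Bessel:
  assumes "L2_orthonormal \<mu> I e" "finite J" "J \<subseteq> I" "f \<in> L2 \<mu>"
  shows "(\<Sum>i\<in>J. (cmod (L2_inner \<mu> f (e i)))\<^sup>2) \<le> (L2_norm \<mu> f)\<^sup>2"
proof -
  define a where "a i = L2_inner \<mu> f (e i)" for i
  let ?s = "\<lambda>x. \<Sum>i\<in>J. a i * e i x"
  have s: "?s \<in> L2 \<mu>" using assms orthonormal_sum_L2 by blast
  have "L2_inner \<mu> ?s f = (\<Sum>i\<in>J. a i * L2_inner \<mu> (e i) f)"
    using assms by (intro L2_inner_sum_left) (auto simp: L2_orthonormal_def)
  also have "\<dots> = (\<Sum>i\<in>J. a i * cnj (a i))"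
    by (intro sum.cong refl) (simp add: a_def flip: L2_inner_commute)
  also have "\<dots> = of_real (\<Sum>i\<in>J. (cmod (a i))\<^sup>2)"
    by (simp only: complex_norm_square of_real_sum)
  finally have "L2_inner \<mu> f ?s = of_real (\<Sum>i\<in>J. (cmod (a i))\<^sup>2)"
    using L2_inner_commute[of \<mu> f ?s] by simp
  then have "(L2_norm \<mu> (\<lambda>x. f x - ?s x))\<^sup>2 = (L2_norm \<mu> f)\<^sup>2 - (\<Sum>i\<in>J. (cmod (a i))\<^sup>2)"
    unfolding L2_norm_diff_sq[OF assms(4) s] orthonormal_norm_sum[OF assms(1-3)] by simp
  then show ?thesis unfolding a_def[symmetric]
    using zero_le_power2[of "L2_norm \<mu> (\<lambda>x. f x - ?s x)"] by linarith
qed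

text \<open>
An increasing sequence of finite sets that exhausts a countable index set, along which infinite
orthogonal expansions are summed.
\<close>

definition initial_part :: "'i::countable set \<Rightarrow> nat \<Rightarrow> 'i set" where
  "initial_part I n = {i\<in>I. to_nat i < n}"

lemma finite_initial_part: "finite (initial_part I n)"
proof -
  have "finite (to_nat ` initial_part I n)"
    by (rule finite_subset[of _ "{..<n}"]) (auto simp: initial_part_def)
  then show ?thesis by (rule finite_imageD) (simp add: inj_on_def)
qed

lemma initial_part_subset: "initial_part I n \<subseteq> I" and initial_part_mono: "m \<le> n \<Longrightarrow> initial_part I m \<subseteq> initial_part I n"
  by (auto simp: initial_part_def)

lemma Riesz_Fischer:
  fixes I :: "'i::countable set"
  assumes e: "L2_orthonormal \<mu> I e"
    and C: "\<And>J. finite J \<Longrightarrow> J \<subseteq> I \<Longrightarrow> (\<Sum>i\<in>J. (cmod (a i))\<^sup>2) \<le> C"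
  obtains g where "L2_tendsto \<mu> (\<lambda>n x. \<Sum>i\<in>initial_part I n. a i * e i x) g"
    "\<And>i. i \<in> I \<Longrightarrow> L2_inner \<mu> g (e i) = a i"
proof -
  let ?s = "\<lambda>n x. \<Sum>i\<in>initial_part I n. a i * e i x"
  define t where "t n = (\<Sum>i\<in>initial_part I n. (cmod (a i))\<^sup>2)" for n
  have inc: "incseq t"
    unfolding t_def by (intro incseq_SucI sum_mono2 finite_initial_part initial_part_mono) auto
  have "t n \<le> C" for n
    unfolding t_def by (rule C[OF finite_initial_part initial_part_subset])
  then have "convergent t"
    using incseq_convergent[OF inc] by (metis convergentI)
  then have ct: "Cauchy t" by (rule convergent_Cauchy)
  have sL2: "?s n \<in> L2 \<mu>" for n using e initial_part_subset by (rule orthonormal_sum_L2)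
  have le: "(L2_norm \<mu> (\<lambda>x. ?s n x - ?s m x))\<^sup>2 = t n - t m" if "m \<le> n" for m n
  proof -
    have *: "(\<lambda>x. ?s n x - ?s m x) = (\<lambda>x. \<Sum>i\<in>initial_part I n - initial_part I m. a i * e i x)"
      using that by (subst sum_diff) (auto simp: finite_initial_part initial_part_mono)
    have "initial_part I n - initial_part I m \<subseteq> I" using initial_part_subset by blast
    then show ?thesis
      using that unfolding *
      by (subst orthonormal_norm_sum[OF e]) (simp_all add: finite_initial_part t_def sum_diff initial_part_mono)
  qed
  have eq: "(L2_norm \<mu> (\<lambda>x. ?s n x - ?s m x))\<^sup>2 = \<bar>t n - t m\<bar>" for m n
  proof (cases "m \<le> n")
    case True
    then show ?thesis using le[OF True] incseqD[OF inc True] by simp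
  next
    case False
    then have "n \<le> m" by simp
    then show ?thesis
      using le[of n m] incseqD[OF inc, of n m] by (subst L2_norm_minus_commute) simp
  qed
  have "\<exists>N. \<forall>m\<ge>N. \<forall>n\<ge>N. L2_norm \<mu> (\<lambda>x. ?s m x - ?s n x) < r" if "r > 0" for r
  proof -
    obtain N where N: "\<And>m n. m \<ge> N \<Longrightarrow> n \<ge> N \<Longrightarrow> \<bar>t m - t n\<bar> < r\<^sup>2"
      using CauchyD[OF ct, of "r\<^sup>2"] \<open>r > 0\<close> by auto
    show ?thesis
    proof (intro exI[of _ N] allI impI)
      fix m n assume "N \<le> m" "N \<le> n"
      then have "(L2_norm \<mu> (\<lambda>x. ?s m x - ?s n x))\<^sup>2 < r\<^sup>2" using N eq by simp
      then show "L2_norm \<mu> (\<lambda>x. ?s m x - ?s n x) < r"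
        by (rule power2_less_imp_less) (use that in simp)
    qed
  qed
  from L2_complete[OF sL2 this] obtain g where g: "L2_tendsto \<mu> ?s g" .
  show thesis
  proof (rule that[OF g])
    fix i assume i: "i \<in> I"
    have "\<forall>\<^sub>F n in sequentially. L2_inner \<mu> (?s n) (e i) = a i"
      using eventually_gt_at_top[of "to_nat i"]
    proof eventually_elim
      case (elim n)
      then have "i \<in> initial_part I n" using i by (simp add: initial_part_def)
      then show ?case using orthonormal_inner_sum[OF e finite_initial_part initial_part_subset i] by simp
    qed
    then have "(\<lambda>n. L2_inner \<mu> (?s n) (e i)) \<longlonglongrightarrow> a i" by (rule tendsto_eventually)
    then show "L2_inner \<mu> g (e i) = a i"
      using L2_tendsto_inner[OF g orthonormal_L2[OF e i]] by (rule LIMSEQ_unique[rotated])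
  qed
qed

lemma L2_tendsto_cong:
  assumes "L2_tendsto \<mu> F f" "g \<in> L2 \<mu>" "AE x in \<mu>. f x = g x"
  shows "L2_tendsto \<mu> F g"
proof -
  have F: "F n \<in> L2 \<mu>" and f: "f \<in> L2 \<mu>" for n using assms by (auto simp: L2_tendsto_def)
  have "L2_norm \<mu> (\<lambda>x. F n x - g x) = L2_norm \<mu> (\<lambda>x. F n x - f x)" for n
    using L2_diff[OF F f, THEN L2_measurable] L2_diff[OF F assms(2), THEN L2_measurable] assms(3)
    by (intro L2_norm_cong_AE) auto
  then show ?thesis using assms by (simp add: L2_tendsto_def)
qed

lemma orthonormal_expansion:
  fixes I :: "'i::countable set"
  assumes "L2_orthonormal \<mu> I e" "L2_total \<mu> I e" "f \<in> L2 \<mu>"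
  shows "L2_tendsto \<mu> (\<lambda>n x. \<Sum>i\<in>initial_part I n. L2_inner \<mu> f (e i) * e i x) f"
proof -
  obtain g where g: "L2_tendsto \<mu> (\<lambda>n x. \<Sum>i\<in>initial_part I n. L2_inner \<mu> f (e i) * e i x) g"
    "\<And>i. i \<in> I \<Longrightarrow> L2_inner \<mu> g (e i) = L2_inner \<mu> f (e i)"
    using Riesz_Fischer[OF assms(1) Bessel[OF assms(1) _ _ assms(3)]] by blast
  have gL2: "g \<in> L2 \<mu>" using g by (simp add: L2_tendsto_def)
  have "AE x in \<mu>. g x - f x = 0"
    using assms(2) g(2) L2_inner_diff_left[OF gL2 assms(3) orthonormal_L2[OF assms(1)]]
      L2_diff[OF gL2 assms(3)] unfolding L2_total_def by fastforce
  then show ?thesis using L2_tendsto_cong[OF g(1) assms(3)] by simp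
qed

text \<open>
If the span is dense, a function orthogonal to the family is arbitrarily close to functions
orthogonal to it, hence zero. Conversely the expansion with the coefficients of \<open>f\<close> converges by
\<open>Riesz_Fischer\<close>, and totality identifies its limit with \<open>f\<close>.
\<close>

lemma L2_orthonormal_basis_iff:
  fixes I :: "'i::countable set"
  shows "L2_orthonormal_basis \<mu> I e \<longleftrightarrow> L2_orthonormal \<mu> I e \<and> L2_total \<mu> I e"
proof (intro iffI conjI)
  assume b: "L2_orthonormal_basis \<mu> I e"
  then show o: "L2_orthonormal \<mu> I e" by (simp add: L2_orthonormal_basis_def L2_orthonormal_def)
  show "L2_total \<mu> I e" unfolding L2_total_def
  proof (intro ballI impI)
    fix f assume f: "f \<in> L2 \<mu>" and z: "\<forall>i\<in>I. L2_inner \<mu> f (e i) = 0"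
    have "(L2_norm \<mu> f)\<^sup>2 < r\<^sup>2" if r: "r > 0" for r
    proof -
      obtain J a where J: "finite J" "J \<subseteq> I" "L2_norm \<mu> (\<lambda>x. f x - (\<Sum>i\<in>J. a i * e i x)) < r"
        using b f r unfolding L2_orthonormal_basis_def by blast
      let ?s = "\<lambda>x. \<Sum>i\<in>J. a i * e i x"
      have s: "?s \<in> L2 \<mu>" using o J orthonormal_sum_L2 by blast
      have "L2_inner \<mu> ?s f = (\<Sum>i\<in>J. a i * L2_inner \<mu> (e i) f)"
        using o J f by (intro L2_inner_sum_left) (auto simp: L2_orthonormal_def)
      also have "\<dots> = 0"
        using z J(2) L2_inner_commute[of \<mu> _ f] by (intro sum.neutral) auto
      finally have "L2_inner \<mu> f ?s = 0" using L2_inner_commute[of \<mu> f ?s] by simp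
      then have "(L2_norm \<mu> f)\<^sup>2 \<le> (L2_norm \<mu> (\<lambda>x. f x - ?s x))\<^sup>2"
        unfolding L2_norm_diff_sq[OF f s] by simp
      also have "\<dots> < r\<^sup>2" using J(3) by (intro power_strict_mono L2_norm_nonneg) auto
      finally show ?thesis .
    qed
    then have "L2_norm \<mu> f = 0"
      using L2_norm_nonneg[of \<mu> f] by (metis less_le order_less_irrefl)
    then show "AE x in \<mu>. f x = 0" using L2_norm_zero_iff[OF f] by simp
  qed
next
  assume "L2_orthonormal \<mu> I e \<and> L2_total \<mu> I e"
  then have o: "L2_orthonormal \<mu> I e" and t: "L2_total \<mu> I e" by auto
  have "\<exists>J a. finite J \<and> J \<subseteq> I \<and> L2_norm \<mu> (\<lambda>x. f x - (\<Sum>i\<in>J. a i * e i x)) < r"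
    if f: "f \<in> L2 \<mu>" and r: "r > 0" for f r
  proof -
    have "(\<lambda>n. L2_norm \<mu> (\<lambda>x. (\<Sum>i\<in>initial_part I n. L2_inner \<mu> f (e i) * e i x) - f x)) \<longlonglongrightarrow> 0"
      using orthonormal_expansion[OF o t f] by (simp add: L2_tendsto_def)
    from order_tendstoD(2)[OF this r] obtain n where
      "L2_norm \<mu> (\<lambda>x. (\<Sum>i\<in>initial_part I n. L2_inner \<mu> f (e i) * e i x) - f x) < r"
      by (auto simp: eventually_sequentially)
    then show ?thesis
      using finite_initial_part[of I n] initial_part_subset[of I n] L2_norm_minus_commute by metis
  qed
  then show "L2_orthonormal_basis \<mu> I e"
    using o by (simp add: L2_orthonormal_basis_def L2_orthonormal_def)
qed

text \<open>
For orthonormal bases \<open>E\<close> and \<open>E'\<close> this is the graph of the unitary map that sends \<open>E i\<close> to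
\<open>E' i\<close>. It is a relation because \<open>g\<close> is determined by \<open>f\<close> only up to a null set.
\<close>

definition same_coeffs ::
    "'a measure \<Rightarrow> ('i \<Rightarrow> 'a \<Rightarrow> complex) \<Rightarrow> ('i \<Rightarrow> 'a \<Rightarrow> complex) \<Rightarrow>
     ('a \<Rightarrow> complex) \<Rightarrow> ('a \<Rightarrow> complex) \<Rightarrow> bool" where
  "same_coeffs \<mu> E E' f g \<longleftrightarrow> f \<in> L2 \<mu> \<and> g \<in> L2 \<mu> \<and>
     (\<forall>i. L2_inner \<mu> f (E i) = L2_inner \<mu> g (E' i))"

lemma same_coeffs_sym: "same_coeffs \<mu> E E' f g \<longleftrightarrow> same_coeffs \<mu> E' E g f"
  by (auto simp: same_coeffs_def)

lemma same_coeffs_exists: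
  fixes E :: "'i::countable \<Rightarrow> 'a \<Rightarrow> complex"
  assumes E: "L2_orthonormal \<mu> UNIV E" and E': "L2_orthonormal \<mu> UNIV E'" and f: "f \<in> L2 \<mu>"
  obtains g where "same_coeffs \<mu> E E' f g"
proof -
  obtain g where "L2_tendsto \<mu> (\<lambda>n x. \<Sum>i\<in>initial_part UNIV n. L2_inner \<mu> f (E i) * E' i x) g"
    "\<And>i. i \<in> UNIV \<Longrightarrow> L2_inner \<mu> g (E' i) = L2_inner \<mu> f (E i)"
    using Riesz_Fischer[OF E' Bessel[OF E _ _ f]] by blast
  then show thesis using f by (intro that[of g]) (simp add: same_coeffs_def L2_tendsto_def)
qed

lemma same_coeffs_diff:
  assumes E: "L2_orthonormal \<mu> UNIV E" and E': "L2_orthonormal \<mu> UNIV E'"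
    and "same_coeffs \<mu> E E' f g" "same_coeffs \<mu> E E' f' g'"
  shows "same_coeffs \<mu> E E' (\<lambda>x. f x - f' x) (\<lambda>x. g x - g' x)"
  using assms unfolding same_coeffs_def L2_orthonormal_def
  by (auto simp: L2_diff L2_inner_diff_left)

lemma same_coeffs_sum:
  assumes E: "L2_orthonormal \<mu> UNIV E" and E': "L2_orthonormal \<mu> UNIV E'"
    and "\<And>i. i \<in> J \<Longrightarrow> same_coeffs \<mu> E E' (e i) (e' i)"
  shows "same_coeffs \<mu> E E' (\<lambda>x. \<Sum>i\<in>J. a i * e i x) (\<lambda>x. \<Sum>i\<in>J. a i * e' i x)"
  using assms unfolding same_coeffs_def L2_orthonormal_def
  by (auto intro!: L2_sum sum.cong simp: L2_inner_sum_left)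

lemma same_coeffs_inner:
  fixes E :: "'i::countable \<Rightarrow> 'a \<Rightarrow> complex"
  assumes E: "L2_orthonormal \<mu> UNIV E" "L2_total \<mu> UNIV E" and E': "L2_orthonormal \<mu> UNIV E'" "L2_total \<mu> UNIV E'"
    and fg: "same_coeffs \<mu> E E' f g" "same_coeffs \<mu> E E' f' g'"
  shows "L2_inner \<mu> f f' = L2_inner \<mu> g g'"
proof -
  have L2: "f \<in> L2 \<mu>" "f' \<in> L2 \<mu>" "g \<in> L2 \<mu>" "g' \<in> L2 \<mu>"
    using fg by (auto simp: same_coeffs_def)
  have parseval: "(\<lambda>n. \<Sum>i\<in>initial_part UNIV n. L2_inner \<mu> h (e i) * cnj (L2_inner \<mu> h' (e i)))
      \<longlonglongrightarrow> L2_inner \<mu> h h'"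
    if "L2_orthonormal \<mu> UNIV e" "L2_total \<mu> UNIV e" "h \<in> L2 \<mu>" "h' \<in> L2 \<mu>" for e :: "'i \<Rightarrow> 'a \<Rightarrow> complex" and h h'
  proof -
    have "L2_inner \<mu> (\<lambda>x. \<Sum>i\<in>initial_part UNIV n. L2_inner \<mu> h (e i) * e i x) h' =
      (\<Sum>i\<in>initial_part UNIV n. L2_inner \<mu> h (e i) * cnj (L2_inner \<mu> h' (e i)))" for n
      using that by (subst L2_inner_sum_left) (auto simp: L2_orthonormal_def simp flip: L2_inner_commute)
    then show ?thesis
      using L2_tendsto_inner[OF orthonormal_expansion[OF that(1-3)] that(4)] by simp
  qed
  show ?thesis
    using parseval[OF E L2(1,2)] parseval[OF E' L2(3,4)] fg
    by (intro LIMSEQ_unique) (auto simp: same_coeffs_def)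
qed

lemma same_coeffs_norm:
  fixes E :: "'i::countable \<Rightarrow> 'a \<Rightarrow> complex"
  assumes E: "L2_orthonormal \<mu> UNIV E" "L2_total \<mu> UNIV E" and E': "L2_orthonormal \<mu> UNIV E'" "L2_total \<mu> UNIV E'"
    and fg: "same_coeffs \<mu> E E' f g"
  shows "L2_norm \<mu> f = L2_norm \<mu> g"
  using same_coeffs_inner[OF E E' fg fg] L2_norm_nonneg[of \<mu> f] L2_norm_nonneg[of \<mu> g]
  unfolding L2_inner_self of_real_eq_iff by (simp add: power2_eq_iff_nonneg)

text \<open>
A unitary map carries orthonormal bases to orthonormal bases; by \<open>same_coeffs_sym\<close> the converse is
the same statement.
\<close>

lemma same_coeffs_basis:
  fixes E :: "'i::countable \<Rightarrow> 'a \<Rightarrow> complex"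
  assumes E: "L2_orthonormal \<mu> UNIV E" "L2_total \<mu> UNIV E" and E': "L2_orthonormal \<mu> UNIV E'" "L2_total \<mu> UNIV E'"
    and e: "\<And>i. i \<in> I \<Longrightarrow> same_coeffs \<mu> E E' (e i) (e' i)"
    and basis: "L2_orthonormal_basis \<mu> I e"
  shows "L2_orthonormal_basis \<mu> I e'"
  unfolding L2_orthonormal_basis_def
proof (intro conjI ballI allI impI)
  fix i j assume ij: "i \<in> I" "j \<in> I"
  show "L2_inner \<mu> (e' i) (e' j) = (if i = j then 1 else 0)"
    using basis same_coeffs_inner[OF E E' e[OF ij(1)] e[OF ij(2)]] ij
    by (simp add: L2_orthonormal_basis_def)
next
  fix g and r :: real assume g: "g \<in> L2 \<mu>" and r: "r > 0"
  obtain f where "same_coeffs \<mu> E' E g f" using same_coeffs_exists[OF E'(1) E(1) g] .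
  then have fg: "same_coeffs \<mu> E E' f g" using same_coeffs_sym by blast
  then have "f \<in> L2 \<mu>" by (simp add: same_coeffs_def)
  then obtain J a where J: "finite J" "J \<subseteq> I" "L2_norm \<mu> (\<lambda>x. f x - (\<Sum>i\<in>J. a i * e i x)) < r"
    using basis r unfolding L2_orthonormal_basis_def by blast
  have "same_coeffs \<mu> E E' (\<lambda>x. \<Sum>i\<in>J. a i * e i x) (\<lambda>x. \<Sum>i\<in>J. a i * e' i x)"
    using J e by (intro same_coeffs_sum E E') auto
  from same_coeffs_norm[OF E E' same_coeffs_diff[OF E(1) E'(1) fg this]] J
  show "\<exists>J a. finite J \<and> J \<subseteq> I \<and> L2_norm \<mu> (\<lambda>x. g x - (\<Sum>i\<in>J. a i * e' i x)) < r"
    by (intro exI[of _ J] exI[of _ a]) simp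
qed (use e in \<open>auto simp: same_coeffs_def\<close>)

lemma same_coeffs_limit:
  assumes E: "L2_orthonormal \<mu> UNIV E" and E': "L2_orthonormal \<mu> UNIV E'"
    and F: "\<And>n. same_coeffs \<mu> E E' (F n) (G n)" "L2_tendsto \<mu> F f" "L2_tendsto \<mu> G g"
  shows "same_coeffs \<mu> E E' f g"
proof -
  have "L2_inner \<mu> f (E i) = L2_inner \<mu> g (E' i)" for i
    using L2_tendsto_inner[OF F(2) orthonormal_L2[OF E, of i]]
      L2_tendsto_inner[OF F(3) orthonormal_L2[OF E', of i]] F(1)
    by (intro LIMSEQ_unique) (auto simp: same_coeffs_def)
  then show ?thesis using F by (simp add: same_coeffs_def L2_tendsto_def)
qed

lemma same_coeffs_cong_AE:
  assumes "same_coeffs \<mu> E E' f g" "L2_orthonormal \<mu> UNIV E'" "h \<in> borel_measurable \<mu>" "AE x in \<mu>. g x = h x"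
  shows "same_coeffs \<mu> E E' f h"
proof -
  have "g \<in> L2 \<mu>" using assms(1) by (simp add: same_coeffs_def)
  then have "L2_inner \<mu> g (E' i) = L2_inner \<mu> h (E' i)" for i
    using assms orthonormal_L2[OF assms(2), of i] by (intro L2_inner_cong) (auto dest: L2_measurable)
  then show ?thesis
    using assms L2_cong_AE[OF \<open>g \<in> L2 \<mu>\<close> assms(3,4)] by (simp add: same_coeffs_def)
qed

section \<open>Vanishing set integrals and measurable partitions\<close>

lemma integrable_mult_bounded:
  assumes "integrable M f" "g \<in> borel_measurable M" "\<And>x. cmod (g x) \<le> 1"
  shows "integrable M (\<lambda>x. f x * g x :: complex)"
  by (rule Bochner_Integration.integrable_bound[OF assms(1)])
    (use assms in \<open>auto simp: norm_mult mult_left_le\<close>)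

lemma AE_eq_0_if_set_integrals_0:
  fixes F :: "'a \<Rightarrow> complex"
  assumes F: "integrable M F" and z: "\<And>A. A \<in> sets M \<Longrightarrow> (LINT x:A|M. F x) = 0"
  shows "AE x in M. F x = 0"
proof -
  have Re: "AE x in M. Re (F x) = 0"
  proof (rule density_unique_real)
    fix A assume A: "A \<in> sets M"
    have "integrable M (\<lambda>x. indicat_real A x *\<^sub>R F x)"
      using F A by (rule integrable_mult_indicator[rotated])
    from integral_Re[OF this] show "(LINT x:A|M. Re (F x)) = (LINT x:A|M. 0)"
      using z[OF A] by (simp add: set_lebesgue_integral_def)
  qed (use F in auto)
  have Im: "AE x in M. Im (F x) = 0"
  proof (rule density_unique_real)
    fix A assume A: "A \<in> sets M"
    have "integrable M (\<lambda>x. indicat_real A x *\<^sub>R F x)"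
      using F A by (rule integrable_mult_indicator[rotated])
    from integral_Im[OF this] show "(LINT x:A|M. Im (F x)) = (LINT x:A|M. 0)"
      using z[OF A] by (simp add: set_lebesgue_integral_def)
  qed (use F in auto)
  from Re Im show ?thesis by eventually_elim (simp add: complex_eq_iff)
qed

text \<open>
Used with \<open>P l\<close> saying that the translate of index \<open>l\<close> covers a given point: the count of such
translates is a series, which can be exchanged with a nonnegative integral.
\<close>

lemma suminf_unique_index:
  assumes "\<exists>!l::nat. P l"
  shows "(\<Sum>l. if P l then (c::ennreal) else 0) = c"
proof -
  obtain k where k: "\<And>l. P l \<longleftrightarrow> l = k" using assms by metis
  have "(\<lambda>l. if l = k then c else 0) sums c" by (rule sums_single)
  then show ?thesis unfolding k by (simp add: sums_iff)
qed

text \<open>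
Countably many null sets, one for each pair of indices and one for the complement of the union,
combine into a single null set.
\<close>

lemma measurable_partition_UNIV_iff:
  fixes A :: "'i::countable \<Rightarrow> 'a set"
  assumes A: "\<And>i. A i \<in> sets M" and sp: "space M = UNIV"
  shows "measurable_partition M UNIV A UNIV \<longleftrightarrow> (AE x in M. \<exists>!i. x \<in> A i)"
proof -
  have U: "UNIV - (\<Union>i. A i) \<in> sets M"
    using A sp by (metis sets.countable_UN sets.compl_sets countableI_type image_subsetI)
  have "measurable_partition M UNIV A UNIV \<longleftrightarrow>
     (\<forall>i j. i \<noteq> j \<longrightarrow> A i \<inter> A j \<in> null_sets M) \<and> UNIV - (\<Union>i. A i) \<in> null_sets M"
    using A by (simp add: measurable_partition_def)
  also have "\<dots> \<longleftrightarrow> (\<forall>i j. i \<noteq> j \<longrightarrow> (AE x in M. x \<notin> A i \<inter> A j)) \<and>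
      (AE x in M. x \<notin> UNIV - (\<Union>i. A i))"
    using A U AE_iff_null_sets[of _ M] by (simp add: sets.Int)
  also have "\<dots> \<longleftrightarrow> (\<forall>p::'i \<times> 'i. AE x in M. fst p \<noteq> snd p \<longrightarrow> x \<notin> A (fst p) \<inter> A (snd p)) \<and>
      (AE x in M. x \<in> (\<Union>i. A i))"
    by simp
  also have "\<dots> \<longleftrightarrow> (AE x in M. (\<forall>p::'i \<times> 'i. fst p \<noteq> snd p \<longrightarrow> x \<notin> A (fst p) \<inter> A (snd p)) \<and> x \<in> (\<Union>i. A i))"
    unfolding AE_all_countable[symmetric] by (simp only: AE_conj_iff)
  also have "\<dots> \<longleftrightarrow> (AE x in M. \<exists>!i. x \<in> A i)"
    by (rule arg_cong[where f="almost_everywhere M"]) (auto simp: fun_eq_iff)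
  finally show ?thesis .
qed

section \<open>Digits of natural numbers\<close>

lemma nat_digits_exist:
  assumes "p > 0" "\<And>i. i < c \<Longrightarrow> d i < p"
  shows "\<exists>b<p ^ c. \<forall>i<c. b div p ^ i mod p = (d i :: nat)"
  using assms(2)
proof (induction c arbitrary: d)
  case (Suc c)
  obtain b where b: "b < p ^ c" "\<And>i. i < c \<Longrightarrow> b div p ^ i mod p = d (Suc i)"
    using Suc.IH[of "\<lambda>i. d (Suc i)"] Suc.prems by auto
  have d0: "d 0 < p" using Suc.prems by simp
  have "d 0 + p * b < p * Suc b" using d0 by simp
  also have "\<dots> \<le> p * p ^ c" using b(1) by (intro mult_le_mono2) simp
  finally have "d 0 + p * b < p ^ Suc c" by simp
  moreover have "(d 0 + p * b) div p ^ i mod p = d i" if "i < Suc c" for i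
  proof (cases i)
    case 0
    then show ?thesis using d0 by simp
  next
    case (Suc k)
    have "(d 0 + p * b) div p ^ i = (d 0 + p * b) div p div p ^ k"
      unfolding Suc by (simp add: div_mult2_eq)
    also have "(d 0 + p * b) div p = b" using d0 assms(1) by simp
    finally show ?thesis using b(2)[of k] that Suc by simp
  qed
  ultimately show ?case by blast
qed simp

lemma nat_digits_inj:
  assumes "b < p ^ c" "b' < p ^ c" "\<And>i. i < c \<Longrightarrow> b div p ^ i mod p = b' div p ^ i mod (p::nat)"
  shows "b = b'"
  using assms
proof (induction c arbitrary: b b')
  case (Suc c)
  have "b div p = b' div p"
  proof (rule Suc.IH)
    show "b div p < p ^ c" "b' div p < p ^ c"
      using Suc.prems(1,2) by (auto simp: less_mult_imp_div_less mult.commute)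
    show "b div p div p ^ i mod p = b' div p div p ^ i mod p" if "i < c" for i
      using Suc.prems(3)[of "Suc i"] that by (simp add: div_mult2_eq)
  qed
  moreover have "b mod p = b' mod p" using Suc.prems(3)[of 0] by simp
  ultimately show ?case by (metis div_mult_mod_eq)
qed simp

section \<open>Absolute value\<close>

context local_field_setup
begin

definition q :: nat where "q = residue_card TYPE('a) c"
abbreviation uu :: "nat \<Rightarrow> 'a" where "uu \<equiv> u \<pi> c \<epsilon>"

lemma absv_0 [simp]: "absv (0::'a) = 0"
  by (simp add: absv_def)

lemma absv_nonneg [simp]: "absv (x::'a) \<ge> 0"
  by (simp add: absv_def)

lemma absv_eq_0_iff [simp]: "absv (x::'a) = 0 \<longleftrightarrow> x = 0"
  by (simp add: absv_def)

lemma absv_1 [simp]: "absv (1::'a) = 1"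
  using absv_mult[of 1 1] by (metis absv_eq_0_iff mult_cancel_left1 mult_1 one_neq_zero)

lemma absv_minus [simp]: "absv (- x :: 'a) = absv x"
proof -
  have "absv (-1::'a) * absv (-1::'a) = 1" using absv_mult[of "-1" "-1"] by simp
  then have "absv (-1::'a) = 1"
    using absv_nonneg[of "-1"] by (metis abs_of_nonneg mult_cancel_right1 abs_mult_self_eq real_sqrt_mult_self real_sqrt_one real_sqrt_abs2)
  then show ?thesis using absv_mult[of "-1" x] by simp
qed

lemma absv_add_le: "absv (x::'a) \<le> r \<Longrightarrow> absv y \<le> r \<Longrightarrow> absv (x + y) \<le> r"
  using absv_ultrametric[of x y] by simp

lemma absv_diff_le: "absv (x::'a) \<le> r \<Longrightarrow> absv y \<le> r \<Longrightarrow> absv (x - y) \<le> r"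
  using absv_add_le[of x r "- y"] by simp

lemma absv_inverse: "absv (inverse x :: 'a) = inverse (absv x)"
proof (cases "x = 0")
  case False
  then have "absv (inverse x) * absv x = 1" by (simp flip: absv_mult)
  then show ?thesis by (metis inverse_unique inverse_inverse_eq)
qed simp

lemma absv_power: "absv (x ^ n :: 'a) = absv x ^ n"
  by (induction n) (simp_all add: absv_mult)

lemma absv_power_int: "absv (x powi n :: 'a) = absv x powi n"
  by (simp add: power_int_def absv_power absv_inverse)

lemma CHAR_ge_2: "CHAR('a) \<ge> 2"
  using positive_char CHAR_not_1[where ?'a='a] by linarith

lemma q_ge_2: "q \<ge> 2"
proof -
  have "CHAR('a) ^ 1 \<le> CHAR('a) ^ c"
    using CHAR_ge_2 degree_pos by (intro power_increasing) auto
  then show ?thesis using CHAR_ge_2 by (simp add: q_def residue_card_def)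
qed

lemma q_pos: "q > 0" using q_ge_2 by simp

lemma absv_pi: "absv \<pi> = inverse (real q)"
  using absv_prime by (simp add: q_def inverse_eq_divide)

lemma pi_nonzero: "\<pi> \<noteq> 0"
  using absv_pi q_pos absv_0 by fastforce

lemma absv_pi_pos: "absv \<pi> > 0"
  using absv_pi q_pos by simp

lemma absv_pi_less_1: "absv \<pi> < 1"
  using absv_pi q_ge_2 by (simp add: inverse_less_1_iff)

lemma absv_less_1D:
  assumes "absv (x::'a) < 1"
  shows "absv (inverse \<pi> * x) \<le> 1"
proof -
  have "x \<in> max_ideal" using assms by (simp add: max_ideal_def)
  then obtain y where "x = \<pi> * y" "absv y \<le> 1"
    unfolding prime_element by (auto simp: integer_ring_def)
  then show ?thesis using pi_nonzero by (simp flip: mult.assoc)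
qed

section \<open>The coset representatives of the integers\<close>

text \<open>
The element of the ring of integers whose coordinates with respect to the \<open>\<epsilon> k\<close> are the digits of
\<open>b\<close> in base \<open>CHAR('a)\<close>.
\<close>

definition digit_rep :: "nat \<Rightarrow> 'a" where
  "digit_rep b = (\<Sum>k<c. of_nat (b div CHAR('a) ^ k mod CHAR('a)) * \<epsilon> k)"

lemma u_digit_eq: "u_digit \<pi> c \<epsilon> b = digit_rep b * inverse \<pi>"
  by (simp add: u_digit_def digit_rep_def)

lemma digit_rep_0: "digit_rep 0 = 0"
  by (simp add: digit_rep_def)

lemma absv_of_nat: "absv (of_nat n :: 'a) \<le> 1"
  by (induction n) (auto intro: absv_add_le)

lemma absv_sum_le: "(\<And>i. i \<in> A \<Longrightarrow> absv (f i :: 'a) \<le> r) \<Longrightarrow> r \<ge> 0 \<Longrightarrow> absv (sum f A) \<le> r"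
  by (induction A rule: infinite_finite_induct) (auto intro: absv_add_le)

lemma absv_digit_rep: "absv (digit_rep b) \<le> 1"
  unfolding digit_rep_def
proof (rule absv_sum_le)
  fix k assume "k \<in> {..<c}"
  then have "absv (\<epsilon> k) \<le> 1" using eps_unit[of k] by (simp add: integer_ring_def)
  then show "absv (of_nat (b div CHAR('a) ^ k mod CHAR('a)) * \<epsilon> k) \<le> 1"
    unfolding absv_mult by (intro mult_le_one absv_of_nat) auto
qed simp

lemma of_int_mod_CHAR: "of_nat (nat (a mod int CHAR('a))) = (of_int a :: 'a)"
proof -
  have "a = int CHAR('a) * (a div int CHAR('a)) + a mod int CHAR('a)" by simp
  then have "(of_int a :: 'a) = of_int (int CHAR('a) * (a div int CHAR('a)) + a mod int CHAR('a))"
    by presburger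
  also have "\<dots> = of_int (a mod int CHAR('a))"
    by (simp only: of_int_add of_int_mult of_int_of_nat_eq of_nat_CHAR) simp
  also have "\<dots> = of_nat (nat (a mod int CHAR('a)))"
    using positive_char by (subst of_nat_nat) auto
  finally show ?thesis ..
qed

text \<open>
Integer coordinates only matter modulo the characteristic, so they can be replaced by digits.
\<close>

lemma digit_rep_exists: "\<exists>b<q. digit_rep b = (\<Sum>i<c. of_int (a i) * \<epsilon> i)"
proof -
  obtain b where b: "b < CHAR('a) ^ c"
    "\<forall>i<c. b div CHAR('a) ^ i mod CHAR('a) = nat (a i mod int CHAR('a))"
    using nat_digits_exist[of "CHAR('a)" c "\<lambda>i. nat (a i mod int CHAR('a))"] positive_char
    by (auto simp: nat_less_iff)
  then have "digit_rep b = (\<Sum>i<c. of_int (a i) * \<epsilon> i)"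
    unfolding digit_rep_def by (intro sum.cong refl) (simp add: of_int_mod_CHAR)
  then show ?thesis using b by (auto simp: q_def residue_card_def)
qed

lemma digit_rep_diff: "\<exists>b<q. digit_rep b = digit_rep b1 - digit_rep b2"
proof -
  have "digit_rep b1 - digit_rep b2 =
    (\<Sum>i<c. of_int (int (b1 div CHAR('a) ^ i mod CHAR('a)) - int (b2 div CHAR('a) ^ i mod CHAR('a))) * \<epsilon> i)"
    unfolding digit_rep_def by (simp add: sum_subtractf algebra_simps)
  then show ?thesis by (simp only: digit_rep_exists)
qed

lemma digit_rep_inj:
  assumes "b1 < q" "b2 < q" "absv (digit_rep b1 - digit_rep b2) < 1"
  shows "b1 = b2"
proof (rule nat_digits_inj)
  show "b1 < CHAR('a) ^ c" "b2 < CHAR('a) ^ c" using assms by (auto simp: q_def residue_card_def)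
  define a where "a i = int (b1 div CHAR('a) ^ i mod CHAR('a)) - int (b2 div CHAR('a) ^ i mod CHAR('a))" for i
  have "digit_rep b1 - digit_rep b2 = (\<Sum>i<c. of_int (a i) * \<epsilon> i)"
    unfolding digit_rep_def a_def by (simp add: sum_subtractf algebra_simps)
  then have m: "(\<Sum>i<c. of_int (a i) * \<epsilon> i) \<in> max_ideal" using assms by (simp add: max_ideal_def)
  fix i assume "i < c"
  then have "int CHAR('a) dvd a i" using eps_independent[OF m] by simp
  moreover have "\<bar>a i\<bar> < int CHAR('a)"
    using mod_less_divisor[OF positive_char, of "b1 div CHAR('a) ^ i"]
      mod_less_divisor[OF positive_char, of "b2 div CHAR('a) ^ i"] unfolding a_def by linarith
  ultimately have "a i = 0" using dvd_imp_le_int[of "a i" "int CHAR('a)"] by linarith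
  then show "b1 div CHAR('a) ^ i mod CHAR('a) = b2 div CHAR('a) ^ i mod CHAR('a)"
    by (simp add: a_def)
qed

lemma u_extend:
  assumes "N > n"
  shows "uu n = (\<Sum>k<N. digit_rep (n div q ^ k mod q) * inverse \<pi> * inverse \<pi> ^ k)"
proof -
  have "uu n = (\<Sum>k\<le>n. digit_rep (n div q ^ k mod q) * inverse \<pi> * inverse \<pi> ^ k)"
    by (simp add: u_def Let_def u_digit_eq q_def)
  also have "\<dots> = (\<Sum>k<N. digit_rep (n div q ^ k mod q) * inverse \<pi> * inverse \<pi> ^ k)"
  proof (rule sum.mono_neutral_left)
    show "\<forall>k\<in>{..<N} - {..n}. digit_rep (n div q ^ k mod q) * inverse \<pi> * inverse \<pi> ^ k = 0"
    proof
      fix k assume "k \<in> {..<N} - {..n}"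
      then have "n < k" by simp
      also have "k < 2 ^ k" by simp
      also have "(2::nat) ^ k \<le> q ^ k" using q_ge_2 by (intro power_mono) auto
      finally show "digit_rep (n div q ^ k mod q) * inverse \<pi> * inverse \<pi> ^ k = 0"
        by (simp add: digit_rep_0)
    qed
  qed (use assms in auto)
  finally show ?thesis .
qed

text \<open>
Splitting off the lowest digit in base \<open>q\<close>. All facts about the representatives follow from this
recursion by induction on \<open>n\<close>.
\<close>

lemma u_rec:
  assumes "b < q"
  shows "uu (b + q * n) = inverse \<pi> * (digit_rep b + uu n)"
proof -
  define N where "N = b + q * n + n + 1"
  have "uu (b + q * n) =
      (\<Sum>k<Suc N. digit_rep ((b + q * n) div q ^ k mod q) * inverse \<pi> * inverse \<pi> ^ k)"
    by (rule u_extend) (simp add: N_def)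
  also have "\<dots> = digit_rep b * inverse \<pi> +
      (\<Sum>k<N. digit_rep (n div q ^ k mod q) * inverse \<pi> * inverse \<pi> ^ Suc k)"
    unfolding sum.lessThan_Suc_shift using assms
    by (simp add: div_mult2_eq)
  also have "(\<Sum>k<N. digit_rep (n div q ^ k mod q) * inverse \<pi> * inverse \<pi> ^ Suc k) = inverse \<pi> * uu n"
  proof -
    have "N > n" by (simp add: N_def)
    show ?thesis unfolding u_extend[OF \<open>N > n\<close>] by (simp add: sum_distrib_left mult_ac)
  qed
  finally show ?thesis by (simp add: algebra_simps)
qed

lemma u_rec': "uu n = inverse \<pi> * (digit_rep (n mod q) + uu (n div q))"
  using u_rec[of "n mod q" "n div q"] q_pos by simp

lemma u_0 [simp]: "uu 0 = 0"
  by (simp add: u_extend[of 0 1] digit_rep_0)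

lemma u_diff_rec:
  "uu n - uu m = inverse \<pi> * ((digit_rep (n mod q) - digit_rep (m mod q)) + (uu (n div q) - uu (m div q)))"
  by (subst u_rec'[of n], subst u_rec'[of m]) (simp add: algebra_simps)

lemma div_q_less: "n + m > 0 \<Longrightarrow> n div q + m div q < n + m"
proof -
  assume "n + m > 0"
  moreover have "k div q \<le> k" "k > 0 \<Longrightarrow> k div q < k" for k
    using q_ge_2 by (auto intro: div_less_dividend)
  ultimately show ?thesis by (metis add_gr_0 add_le_less_mono add_less_le_mono)
qed

text \<open>
The difference times \<open>\<pi>\<close> lies in the maximal ideal. Its part coming from the higher digits is
therefore integral, which by induction makes the higher digits equal, and what remains is a
difference of lowest digits in the maximal ideal.
\<close>

lemma u_distinct:
  assumes "absv (uu n - uu m) \<le> 1"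
  shows "n = m"
  using assms
proof (induction "n + m" arbitrary: n m rule: less_induct)
  case less
  show ?case
  proof (cases "n + m > 0")
    case True
    let ?d = "digit_rep (n mod q) - digit_rep (m mod q)" and ?u = "uu (n div q) - uu (m div q)"
    have "?d + ?u = \<pi> * (uu n - uu m)"
      unfolding u_diff_rec[of n m] using pi_nonzero by (simp add: field_simps)
    then have du: "absv (?d + ?u) < 1"
      using less.prems absv_pi_less_1 absv_pi_pos
      by (metis absv_mult absv_nonneg mult_le_cancel_left1 mult.commute mult_left_le order_le_less_trans)
    moreover have d: "absv ?d \<le> 1" by (intro absv_diff_le absv_digit_rep)
    ultimately have "absv ((?d + ?u) - ?d) \<le> 1" by (intro absv_diff_le[of "?d + ?u"]) simp_all
    then have "absv ?u \<le> 1" by (simp only: add_diff_cancel_left')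
    then have eq: "n div q = m div q" using less.hyps[OF div_q_less[OF True]] by simp
    then have "absv ?d < 1" using du by simp
    then have "n mod q = m mod q" using digit_rep_inj q_pos by simp
    with eq show ?thesis by (metis div_mult_mod_eq)
  qed simp
qed

text \<open>
In characteristic \<open>p\<close> subtraction of coordinates has no borrows, so the representatives form a
subgroup.
\<close>

lemma u_minus: "\<exists>k. uu k = uu n - uu m"
proof (induction "n + m" arbitrary: n m rule: less_induct)
  case less
  show ?case
  proof (cases "n + m > 0")
    case True
    obtain k where k: "uu k = uu (n div q) - uu (m div q)"
      using less.hyps[OF div_q_less[OF True]] by blast
    obtain b where b: "b < q" "digit_rep b = digit_rep (n mod q) - digit_rep (m mod q)"
      using digit_rep_diff by blast
    have "uu (b + q * k) = uu n - uu m"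
      unfolding u_rec[OF b(1)] u_diff_rec[of n m] b k ..
    then show ?thesis by blast
  qed (auto intro: exI[of _ 0])
qed

lemma u_neg: "\<exists>k. uu k = - uu n"
  using u_minus[of 0 n] by simp

lemma u_plus: "\<exists>k. uu k = uu n + uu m"
proof -
  obtain l where "uu l = - uu m" using u_neg by blast
  then show ?thesis using u_minus[of n l] by simp
qed

lemma u_inj: "uu n = uu m \<longleftrightarrow> n = m"
  using u_distinct[of n m] by auto

text \<open>
Multiplication by \<open>\<pi>\<close> shrinks the absolute value by the factor \<open>q\<close>. If \<open>\<pi> * x\<close> is congruent
to \<open>uu n\<close> modulo the integers, the residue class of the remainder supplies the lowest digit of the
representative of \<open>x\<close>.
\<close>

lemma u_cover: "\<exists>k. absv (x - uu k) \<le> 1"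
proof -
  have step: "\<exists>k. absv (x - uu k) \<le> 1" if "absv x \<le> real q ^ N" for N and x :: 'a
    using that
  proof (induction N arbitrary: x)
    case 0
    then show ?case by (auto intro: exI[of _ 0])
  next
    case (Suc N)
    have "absv (\<pi> * x) \<le> real q ^ N"
      using Suc.prems q_pos by (simp add: absv_mult absv_pi field_simps)
    then obtain n where n: "absv (\<pi> * x - uu n) \<le> 1" using Suc.IH by blast
    then obtain a where "\<pi> * x - uu n - (\<Sum>i<c. of_int (a i) * \<epsilon> i) \<in> max_ideal"
      using eps_spanning[of "\<pi> * x - uu n"] by (auto simp: integer_ring_def)
    then obtain b where b: "b < q" "absv (\<pi> * x - uu n - digit_rep b) < 1"
      using digit_rep_exists[of a] by (auto simp: max_ideal_def)
    have "inverse \<pi> * (\<pi> * x - uu n - digit_rep b) = x - uu (b + q * n)"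
      unfolding u_rec[OF b(1)] using pi_nonzero by (simp add: algebra_simps)
    then show ?case using absv_less_1D[OF b(2)] by metis
  qed
  obtain N where "absv x < real q ^ N"
    using real_arch_pow[of "real q" "absv x"] q_ge_2 by auto
  then show ?thesis using step[of x N] by simp
qed

text \<open>
The representatives with index below \<open>q ^ N\<close> are those of \<open>\<pi>^(-N) O / O\<close>, so this quotient has
\<open>q ^ N\<close> elements.
\<close>

lemma absv_u_le_iff: "absv (uu k) \<le> real q ^ N \<longleftrightarrow> k < q ^ N"
proof (induction N arbitrary: k)
  case 0
  then show ?case using u_distinct[of k 0] by auto
next
  case (Suc N)
  have "absv (uu k) \<le> real q ^ Suc N \<longleftrightarrow> absv (digit_rep (k mod q) + uu (k div q)) \<le> real q ^ N"
    by (subst u_rec') (use q_pos in \<open>simp add: absv_mult absv_inverse absv_pi mult.commute\<close>)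
  also have "\<dots> \<longleftrightarrow> absv (uu (k div q)) \<le> real q ^ N"
  proof -
    have "1 \<le> real q ^ N" using q_pos by simp
    then have d: "absv (digit_rep (k mod q)) \<le> real q ^ N" using absv_digit_rep order_trans by blast
    show ?thesis
      using absv_add_le[OF d, of "uu (k div q)"]
        absv_diff_le[OF _ d, of "digit_rep (k mod q) + uu (k div q)"] by auto
  qed
  also have "\<dots> \<longleftrightarrow> k < q ^ Suc N"
    unfolding Suc.IH using q_pos by (simp add: div_less_iff_less_mult mult.commute)
  finally show ?case .
qed

section \<open>Topology and Borel sets\<close>

lemma dist_absv: "dist (x::'a) y = absv (x - y)"
  by (rule dist_eq_absv_diff)

lemma continuous_absv: "continuous_on UNIV (absv :: 'a \<Rightarrow> real)"
  unfolding absv_def by (intro continuous_intros)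

lemma continuous_translation: "continuous_on UNIV (\<lambda>x::'a. x + y)"
  unfolding continuous_on_iff by (auto simp: dist_absv)

lemma continuous_mult_left: "continuous_on UNIV (\<lambda>x::'a. a * x)"
proof (cases "a = 0")
  case False
  then have "absv a > 0" using absv_nonneg[of a] by (simp add: less_le)
  show ?thesis unfolding continuous_on_iff
  proof (intro ballI allI impI)
    fix x :: 'a and e :: real assume "e > 0"
    show "\<exists>d>0. \<forall>x'\<in>UNIV. dist x' x < d \<longrightarrow> dist (a * x') (a * x) < e"
    proof (intro exI[of _ "e / absv a"] conjI ballI impI)
      fix x' assume "dist x' x < e / absv a"
      then have "absv a * absv (x' - x) < e"
        using \<open>absv a > 0\<close> by (simp add: dist_absv pos_less_divide_eq mult.commute)
      then show "dist (a * x') (a * x) < e"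
        unfolding dist_absv right_diff_distrib[symmetric] absv_mult .
    qed (use \<open>e > 0\<close> \<open>absv a > 0\<close> in auto)
  qed
qed simp

text \<open>
The coset \<open>a + \<pi>^n O\<close>. The exponent is an integer, since dilations move balls through all radii.
\<close>

definition pball :: "'a \<Rightarrow> int \<Rightarrow> 'a set" where
  "pball a n = {x. absv (x - a) \<le> absv \<pi> powi n}"

lemma integer_ring_pball: "integer_ring = pball 0 0"
  by (simp add: integer_ring_def pball_def)

lemma pball_borel [measurable]: "pball a n \<in> sets borel"
proof -
  have "continuous_on UNIV (\<lambda>x. absv (x - a))"
    using continuous_on_compose2[OF continuous_absv continuous_translation[of "- a"]] by simp
  then have "closed (pball a n)"
    unfolding pball_def by (intro closed_Collect_le continuous_on_const)
  then show ?thesis by simp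
qed

lemma pball_self: "a \<in> pball a n"
  using absv_pi_pos by (simp add: pball_def)

text \<open>
Two balls that meet are nested, by the ultrametric inequality.
\<close>

lemma pball_mono:
  assumes "x \<in> pball a n" "x \<in> pball b m" "n \<le> m"
  shows "pball b m \<subseteq> pball a n"
proof
  fix y assume "y \<in> pball b m"
  have le: "absv \<pi> powi m \<le> absv \<pi> powi n"
    using assms(3) absv_pi_pos absv_pi_less_1 by (intro power_int_decreasing) auto
  have "absv (y - b) \<le> absv \<pi> powi n" "absv (x - b) \<le> absv \<pi> powi n" "absv (x - a) \<le> absv \<pi> powi n"
    using assms(1,2) \<open>y \<in> pball b m\<close> le by (auto simp: pball_def)
  then have "absv ((y - b) - (x - b) + (x - a)) \<le> absv \<pi> powi n"
    using absv_add_le[OF absv_diff_le[of "y - b" _ "x - b"]] by blast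
  then show "y \<in> pball a n" by (simp add: pball_def)
qed

lemma pball_image_translation: "(\<lambda>x. x + y) ` pball a n = pball (a + y) n"
proof (intro set_eqI iffI)
  fix z assume "z \<in> pball (a + y) n"
  then have "z - y \<in> pball a n" by (simp add: pball_def algebra_simps)
  then show "z \<in> (\<lambda>x. x + y) ` pball a n" by force
qed (auto simp: pball_def)

lemma pball_vimage_scale: "(\<lambda>x. \<pi> powi j * x) -` pball a n = pball (\<pi> powi (- j) * a) (n - j)"
proof -
  have "absv (\<pi> powi j * x - a) = absv \<pi> powi j * absv (x - \<pi> powi (- j) * a)" for x
  proof -
    have "\<pi> powi j * x - a = \<pi> powi j * (x - \<pi> powi (- j) * a)"
      using pi_nonzero by (simp add: right_diff_distrib power_int_minus)
    then show ?thesis by (simp only: absv_mult absv_power_int)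
  qed
  moreover have "absv \<pi> powi n = absv \<pi> powi j * absv \<pi> powi (n - j)"
    using pi_nonzero by (simp add: power_int_diff)
  moreover have "absv \<pi> powi j > 0" using absv_pi_pos by simp
  ultimately show ?thesis by (auto simp: pball_def mult_le_cancel_left_pos)
qed

lemma pball_cover: "\<exists>k. x \<in> pball (\<pi> powi n * uu k) n"
proof -
  obtain k where "absv (\<pi> powi (- n) * x - uu k) \<le> 1" using u_cover by blast
  then have "x \<in> (\<lambda>x. \<pi> powi (-n) * x) -` pball (uu k) 0" by (simp add: pball_def)
  then show ?thesis unfolding pball_vimage_scale by auto
qed

text \<open>
Balls of radius at most 1, together with the empty set to make the family closed under
intersection. The restriction on the radius matters: the indicators of these balls, made periodic
under the representatives, are trigonometric polynomials.
\<close>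

definition balls :: "'a set set" where
  "balls = insert {} (range (\<lambda>(a, n). pball a (int n)))"

lemma Int_stable_balls: "Int_stable balls"
proof (rule Int_stableI)
  have *: "pball a (int n) \<inter> pball b (int m) \<in> balls" if "n \<le> m" for a b n m
  proof (cases "pball a (int n) \<inter> pball b (int m) = {}")
    case False
    then obtain x where "x \<in> pball a (int n)" "x \<in> pball b (int m)" by blast
    then have "pball b (int m) \<subseteq> pball a (int n)" by (rule pball_mono) (use that in simp)
    then have "pball a (int n) \<inter> pball b (int m) = pball b (int m)" by blast
    then show ?thesis by (auto simp: balls_def)
  qed (simp add: balls_def)
  fix A B assume AB: "A \<in> balls" "B \<in> balls"
  show "A \<inter> B \<in> balls"
  proof (cases "A = {} \<or> B = {}")
    case True
    then show ?thesis by (auto simp: balls_def)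
  next
    case False
    then obtain a n b m where "A = pball a (int n)" "B = pball b (int m)"
      using AB by (auto simp: balls_def)
    then show ?thesis using *[of n m a b] *[of m n b a] by (cases "n \<le> m") (simp_all add: Int_commute)
  qed
qed

text \<open>
The centres \<open>\<pi>^n * u k\<close> suffice, so countably many balls form a base of the topology, and the
balls generate the Borel sets.
\<close>

lemma small_ball:
  assumes "open S" "x \<in> S"
  shows "\<exists>n::nat. \<exists>k. x \<in> pball (\<pi> powi (int n) * uu k) (int n) \<and> pball (\<pi> powi (int n) * uu k) (int n) \<subseteq> S"
proof -
  obtain e where e: "e > 0" "\<And>y. dist y x < e \<Longrightarrow> y \<in> S"
    using assms unfolding open_dist by blast
  obtain n where n: "absv \<pi> ^ n < e"
    using real_arch_pow_inv[OF e(1) absv_pi_less_1] by blast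
  obtain k where k: "x \<in> pball (\<pi> powi (int n) * uu k) (int n)" using pball_cover by blast
  then have "pball (\<pi> powi (int n) * uu k) (int n) \<subseteq> pball x (int n)"
    using pball_mono[OF pball_self[of x] k] by simp
  also have "\<dots> \<subseteq> S" using n e(2) by (auto simp: pball_def dist_absv)
  finally show ?thesis using k by blast
qed

lemma borel_balls: "sets borel = sigma_sets UNIV balls"
proof -
  have "sets borel = sigma_sets UNIV {S::'a set. open S}"
    by (simp add: borel_def)
  also have "\<dots> = sigma_sets UNIV balls"
  proof (rule sigma_sets_eqI)
    fix S :: "'a set" assume "S \<in> {S. open S}"
    define I where "I = {(n::nat, k). pball (\<pi> powi (int n) * uu k) (int n) \<subseteq> S}"
    have "S = (\<Union>((\<lambda>(n, k). pball (\<pi> powi (int n) * uu k) (int n)) ` I))"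
      using small_ball \<open>S \<in> {S. open S}\<close> unfolding I_def by fastforce
    also have "\<dots> \<in> sigma_sets UNIV balls"
    proof (rule sigma_sets_UNION)
      show "b \<in> sigma_sets UNIV balls" if "b \<in> (\<lambda>(n, k). pball (\<pi> powi (int n) * uu k) (int n)) ` I" for b
        using that by (auto simp: balls_def intro!: sigma_sets.Basic)
    qed auto
    finally show "S \<in> sigma_sets UNIV balls" .
  next
    fix b assume "b \<in> balls"
    then have "b \<in> sets borel" by (auto simp: balls_def)
    then show "b \<in> sigma_sets UNIV {S. open S}" by (simp add: borel_def)
  qed
  finally show ?thesis .
qed

section \<open>Measure of balls\<close>

lemma space_haar [simp]: "space haar = UNIV"
  using sets_eq_imp_space_eq[OF sets_haar] by simp

lemma pball_split: "pball 0 n = (\<Union>b<q. pball (\<pi> powi (n + 1) * uu b) (n + 1))"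
proof (intro set_eqI iffI)
  fix x assume x: "x \<in> pball 0 n"
  obtain k where k: "x \<in> pball (\<pi> powi (n + 1) * uu k) (n + 1)" using pball_cover by blast
  then have "\<pi> powi (n + 1) * uu k \<in> pball 0 n"
    using pball_mono[OF x k] pball_self by auto
  then have "uu k \<in> (\<lambda>x. \<pi> powi (n + 1) * x) -` pball 0 n" by simp
  then have "absv (uu k) \<le> absv \<pi> powi (- 1)" unfolding pball_vimage_scale by (simp add: pball_def)
  then have "k < q" using absv_u_le_iff[of k 1] by (simp add: power_int_minus absv_pi)
  then show "x \<in> (\<Union>b<q. pball (\<pi> powi (n + 1) * uu b) (n + 1))" using k by blast
next
  fix x assume "x \<in> (\<Union>b<q. pball (\<pi> powi (n + 1) * uu b) (n + 1))"
  then obtain b where b: "b < q" "x \<in> pball (\<pi> powi (n + 1) * uu b) (n + 1)" by blast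
  have "absv (uu b) \<le> absv \<pi> powi (- 1)"
    using absv_u_le_iff[of b 1] b(1) by (simp add: power_int_minus absv_pi)
  then have "uu b \<in> (\<lambda>x. \<pi> powi (n + 1) * x) -` pball 0 n" unfolding pball_vimage_scale by (simp add: pball_def)
  then have "\<pi> powi (n + 1) * uu b \<in> pball 0 n" by simp
  from pball_mono[OF this pball_self, of "n + 1"] b(2) show "x \<in> pball 0 n" by auto
qed

lemma pball_disjoint:
  assumes "k \<noteq> l"
  shows "pball (\<pi> powi n * uu k) n \<inter> pball (\<pi> powi n * uu l) n = {}"
proof (rule ccontr)
  assume "pball (\<pi> powi n * uu k) n \<inter> pball (\<pi> powi n * uu l) n \<noteq> {}"
  then have "\<pi> powi n * uu l \<in> pball (\<pi> powi n * uu k) n"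
    using pball_mono pball_self by (meson disjoint_iff order_refl subset_iff)
  then have "uu l \<in> (\<lambda>x. \<pi> powi n * x) -` pball (\<pi> powi n * uu k) n" by simp
  then have "uu l \<in> pball (uu k) 0"
    unfolding pball_vimage_scale using pi_nonzero by (simp add: power_int_minus flip: mult.assoc)
  then show False using u_distinct[of l k] assms by (simp add: pball_def)
qed

lemma emeasure_pball_translate: "emeasure haar (pball a n) = emeasure haar (pball 0 n)"
  using haar_translate[of "pball 0 n" a] pball_image_translation[of a 0 n] by (simp add: pball_borel)

text \<open>
A ball is the disjoint union of \<open>q\<close> balls of the next smaller radius.
\<close>

lemma emeasure_pball_step: "emeasure haar (pball 0 n) = ennreal (real q) * emeasure haar (pball 0 (n + 1))"
proof -
  have "emeasure haar (pball 0 n) = (\<Sum>b<q. emeasure haar (pball (\<pi> powi (n + 1) * uu b) (n + 1)))"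
    unfolding pball_split[of n]
    by (rule sum_emeasure[symmetric]) (auto simp: sets_haar pball_borel disjoint_family_on_def pball_disjoint)
  also have "\<dots> = ennreal (real q) * emeasure haar (pball 0 (n + 1))"
    by (subst emeasure_pball_translate) (simp add: ennreal_of_nat_eq_real_of_nat)
  finally show ?thesis .
qed

lemma emeasure_pball: "emeasure haar (pball a n) = ennreal (absv \<pi> powi n)"
proof -
  have q: "0 < real q" using q_pos by simp
  have "emeasure haar (pball 0 n) = ennreal (absv \<pi> powi n)"
  proof (induction n rule: int_induct[where k=0])
    case base
    then show ?case using haar_integer_ring by (simp add: integer_ring_pball)
  next
    case (step1 n)
    have "emeasure haar (pball 0 (n + 1)) = ennreal (inverse (real q)) * (ennreal (real q) * emeasure haar (pball 0 (n + 1)))"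
      using q by (simp add: mult.assoc[symmetric] ennreal_mult[symmetric])
    also have "\<dots> = ennreal (inverse (real q)) * ennreal (absv \<pi> powi n)"
      using step1 emeasure_pball_step[of n] by simp
    also have "\<dots> = ennreal (absv \<pi> powi (n + 1))"
      using absv_pi_pos by (simp add: absv_pi power_int_add ennreal_mult[symmetric] mult.commute)
    finally show ?case .
  next
    case (step2 n)
    have "emeasure haar (pball 0 (n - 1)) = ennreal (real q) * ennreal (absv \<pi> powi n)"
      using step2 emeasure_pball_step[of "n - 1"] by simp
    also have "\<dots> = ennreal (absv \<pi> powi (n - 1))"
      using q by (simp add: absv_pi power_int_diff ennreal_mult[symmetric] divide_inverse mult.commute)
    finally show ?case .
  qed
  then show ?thesis using emeasure_pball_translate[of a n] by (simp only:)
qed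

section \<open>Translations and dilations on the completed measure\<close>

abbreviation L :: "'a measure" where "L \<equiv> completion haar"

lemma borel_measurable_L [measurable (raw)]: "f \<in> borel_measurable borel \<Longrightarrow> f \<in> borel_measurable L"
  using sets_haar by (intro measurable_completion) (simp cong: measurable_cong_sets)

lemma sets_borel_L: "A \<in> sets borel \<Longrightarrow> A \<in> sets L"
  using sets_haar by auto

lemma translation_haar: "(\<lambda>x. x + y) \<in> haar \<rightarrow>\<^sub>M haar"
  using borel_measurable_continuous_onI[OF continuous_translation]
  by (simp cong: measurable_cong_sets add: sets_haar)

lemma scale_haar: "(\<lambda>x. a * x) \<in> haar \<rightarrow>\<^sub>M haar"
  using borel_measurable_continuous_onI[OF continuous_mult_left]
  by (simp cong: measurable_cong_sets add: sets_haar)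

lemma vimage_translation: "(\<lambda>x::'a. x + y) -` A = (\<lambda>x. x - y) ` A"
  by (force simp: image_iff)

lemma distr_translation_haar: "distr haar haar (\<lambda>x. x + y) = haar"
proof (rule measure_eqI)
  fix A assume A: "A \<in> sets (distr haar haar (\<lambda>x. x + y))"
  then have "emeasure (distr haar haar (\<lambda>x. x + y)) A = emeasure haar ((\<lambda>x. x + y) -` A)"
    by (subst emeasure_distr[OF translation_haar]) auto
  also have "\<dots> = emeasure haar A"
    using haar_translate[of A "- y"] A unfolding vimage_translation by (simp add: sets_haar)
  finally show "emeasure (distr haar haar (\<lambda>x. x + y)) A = emeasure haar A" .
qed simp

text \<open>
A dilation multiplies the measure of each ball by the same constant, and balls determine the
measure.
\<close>

lemma distr_scale_haar:
  "distr haar haar (\<lambda>x. \<pi> powi j * x) = density haar (\<lambda>_. ennreal (absv \<pi> powi (- j)))"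
proof (rule measure_eqI_generator_eq[OF Int_stable_balls, of UNIV])
  show "sets (distr haar haar (\<lambda>x. \<pi> powi j * x)) = sigma_sets UNIV balls"
    "sets (density haar (\<lambda>_. ennreal (absv \<pi> powi (- j)))) = sigma_sets UNIV balls"
    by (simp_all add: sets_haar borel_balls)
  fix X assume "X \<in> balls"
  moreover have "emeasure (distr haar haar (\<lambda>x. \<pi> powi j * x)) (pball a n) =
     emeasure (density haar (\<lambda>_. ennreal (absv \<pi> powi (- j)))) (pball a n)" for a n
  proof -
    have "emeasure (distr haar haar (\<lambda>x. \<pi> powi j * x)) (pball a n) = ennreal (absv \<pi> powi (n - j))"
      by (subst emeasure_distr[OF scale_haar]) (simp_all add: sets_haar pball_borel pball_vimage_scale emeasure_pball)
    also have "\<dots> = ennreal (absv \<pi> powi (- j)) * ennreal (absv \<pi> powi n)"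
      using absv_pi_pos pi_nonzero
      by (simp add: ennreal_mult[symmetric] power_int_diff power_int_minus field_simps)
    also have "\<dots> = emeasure (density haar (\<lambda>_. ennreal (absv \<pi> powi (- j)))) (pball a n)"
      by (simp add: emeasure_density_const sets_haar pball_borel emeasure_pball)
    finally show ?thesis .
  qed
  ultimately show "emeasure (distr haar haar (\<lambda>x. \<pi> powi j * x)) X =
     emeasure (density haar (\<lambda>_. ennreal (absv \<pi> powi (- j)))) X"
    by (auto simp: balls_def)
next
  show "range (\<lambda>k. pball (uu k) 0) \<subseteq> balls" by (auto simp: balls_def intro!: image_eqI[where x="(_, 0)"])
  show "(\<Union>k. pball (uu k) 0) = UNIV" using u_cover by (auto simp: pball_def)
  show "emeasure (distr haar haar (\<lambda>x. \<pi> powi j * x)) (pball (uu k) 0) \<noteq> \<infinity>" for k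
    by (subst emeasure_distr[OF scale_haar]) (simp_all add: sets_haar pball_borel pball_vimage_scale emeasure_pball)
qed auto

lemma complete_L: "complete_measure L"
  by (rule complete_measure.intro) (auto simp: null_sets_completion_iff2 intro: null_sets_completion)

text \<open>
A measurable map under which preimages of null sets are null remains measurable for the
completions.
\<close>

lemma translation_L [measurable]: "(\<lambda>x. x + y) \<in> L \<rightarrow>\<^sub>M L"
  by (rule complete_measure.measurable_completion2[OF complete_L measurable_completion[OF translation_haar]])
    (simp add: distr_completion translation_haar distr_translation_haar)

lemma distr_translation_L: "distr L L (\<lambda>x. x + y) = L"
  using complete_measure.completion_distr_eq[OF complete_L measurable_completion[OF translation_haar], of y]
  by (simp add: distr_completion translation_haar distr_translation_haar)

lemma null_sets_density_haar:
  "null_sets (density haar (\<lambda>_. ennreal (absv \<pi> powi j))) = null_sets haar"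
proof -
  have "ennreal (absv \<pi> powi j) \<noteq> 0" using absv_pi_pos by (simp add: ennreal_eq_0_iff not_le)
  then show ?thesis by (auto simp: null_sets_def emeasure_density_const)
qed

lemma scale_L [measurable]: "(\<lambda>x. \<pi> powi j * x) \<in> L \<rightarrow>\<^sub>M L"
  by (rule complete_measure.measurable_completion2[OF complete_L measurable_completion[OF scale_haar]])
    (simp add: distr_completion scale_haar distr_scale_haar null_sets_density_haar)

lemma distr_scale_L:
  "distr L L (\<lambda>x. \<pi> powi j * x) = density L (\<lambda>_. ennreal (absv \<pi> powi (- j)))"
  using complete_measure.completion_distr_eq[OF complete_L measurable_completion[OF scale_haar], of "\<pi> powi j"]
    absv_pi_pos
  by (simp add: distr_completion scale_haar distr_scale_haar null_sets_density_haar completion_density_eq)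

lemma integral_translation:
  fixes f :: "'a \<Rightarrow> 'b::{banach, second_countable_topology}"
  assumes "f \<in> borel_measurable L"
  shows "(\<integral>x. f (x + y) \<partial>L) = (\<integral>x. f x \<partial>L)"
  using integral_distr[OF translation_L assms, of y] by (simp add: distr_translation_L)

lemma integrable_translation:
  fixes f :: "'a \<Rightarrow> 'b::{banach, second_countable_topology}"
  assumes "integrable L f"
  shows "integrable L (\<lambda>x. f (x + y))"
  using integrable_distr[OF translation_L, of y f] assms by (simp add: distr_translation_L)

lemma integral_scale:
  fixes f :: "'a \<Rightarrow> 'b::{banach, second_countable_topology}"
  assumes [measurable]: "f \<in> borel_measurable L"
  shows "(\<integral>x. f (\<pi> powi j * x) \<partial>L) = (absv \<pi> powi (- j)) *\<^sub>R (\<integral>x. f x \<partial>L)"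
  using integral_distr[OF scale_L assms, of j] absv_pi_pos
  by (simp add: distr_scale_L integral_density)

lemma integrable_scale:
  fixes f :: "'a \<Rightarrow> 'b::{banach, second_countable_topology}"
  assumes "integrable L f"
  shows "integrable L (\<lambda>x. f (\<pi> powi j * x))"
proof -
  have "integrable (distr L L (\<lambda>x. \<pi> powi j * x)) f"
    unfolding distr_scale_L using assms absv_pi_pos
    by (subst integrable_density) auto
  then show ?thesis by (rule integrable_distr[OF scale_L])
qed

lemma AE_translation:
  assumes "AE x in L. P x"
  shows "AE x in L. P (x + y)"
proof (rule AE_distrD[OF translation_L])
  show "AE x in distr L L (\<lambda>x. x + y). P x"
    unfolding distr_translation_L by (rule assms)
qed

lemma AE_scale:
  assumes "AE x in L. P x"
  shows "AE x in L. P (\<pi> powi j * x)"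
proof (rule AE_distrD[OF scale_L])
  show "AE x in distr L L (\<lambda>x. \<pi> powi j * x). P x"
    unfolding distr_scale_L by (subst AE_density) (use assms in auto)
qed

section \<open>The character\<close>

lemma chi_0 [simp]: "chi 0 = 1"
  by (rule chi_trivial) (simp add: integer_ring_def)

lemma chi_O: "absv x \<le> 1 \<Longrightarrow> chi x = 1"
  by (rule chi_trivial) (simp add: integer_ring_def)

lemma chi_minus: "chi (- x) = cnj (chi x)"
proof -
  have "chi x * chi (- x) = 1" using chi_add[of x "- x"] by simp
  moreover have "chi x * cnj (chi x) = 1"
    using chi_norm[of x] complex_norm_square[of "chi x"] by simp
  moreover have "chi x \<noteq> 0" using chi_norm[of x] by auto
  ultimately show ?thesis by (metis mult_left_cancel)
qed

lemma chi_diff: "chi (x - y) = chi x * cnj (chi y)"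
  using chi_add[of x "- y"] by (simp add: chi_minus)

lemma chi_measurable_borel [measurable]: "(\<lambda>x. chi (y * x)) \<in> borel_measurable borel"
  by (rule borel_measurable_continuous_onI)
    (rule continuous_on_compose2[OF chi_continuous continuous_mult_left], simp)

lemma chi_measurable [measurable]: "(\<lambda>x. chi (y * x)) \<in> borel_measurable L"
  by (rule borel_measurable_L) simp

lemma chi_u_periodic: "chi (uu k * (x + uu l)) = chi (uu k * x)"
  by (simp add: distrib_left chi_add chi_u)

lemma chi_u_periodic': "chi (uu k * (x - uu l)) = chi (uu k * x)"
  by (simp add: right_diff_distrib chi_diff chi_u)

text \<open>
The integers are their own annihilator: if \<open>y\<close> is not an integer then \<open>y O\<close> contains
\<open>\<pi>^(-1) O\<close>, on which the character is nontrivial.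
\<close>

lemma annihilator:
  assumes "absv y > 1"
  shows "\<exists>x. absv x \<le> 1 \<and> chi (y * x) \<noteq> 1"
proof -
  obtain z where z: "absv z \<le> 1" "chi (inverse \<pi> * z) \<noteq> 1"
    using chi_nontrivial by (auto simp: integer_ring_def)
  have y: "y \<noteq> 0" using assms by auto
  have "absv (inverse y) < 1" using assms by (simp add: absv_inverse inverse_less_1_iff)
  then have "absv (inverse \<pi> * inverse y) \<le> 1" by (rule absv_less_1D)
  then have "absv (inverse \<pi> * inverse y * z) \<le> 1"
    unfolding absv_mult[of _ z] using z(1) by (intro mult_le_one) auto
  moreover have "y * (inverse \<pi> * inverse y * z) = inverse \<pi> * z" using y by simp
  ultimately show ?thesis using z(2) by metis
qed

lemma absv_mult_le_1: "absv (x::'a) \<le> r \<Longrightarrow> absv y \<le> inverse r \<Longrightarrow> r > 0 \<Longrightarrow> absv (x * y) \<le> 1"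
  unfolding absv_mult using mult_mono[of "absv x" r "absv y" "inverse r"] by simp

text \<open>
Orthogonality of characters on the finite group \<open>\<pi>^(-n) O / O\<close>: the sum vanishes unless \<open>y\<close>
annihilates this group.
\<close>

lemma character_sum:
  assumes y: "absv y \<le> 1"
  shows "(\<Sum>k<q ^ n. chi (uu k * y)) = (if absv y \<le> absv \<pi> ^ n then of_nat (q ^ n) else 0)"
proof (cases "absv y \<le> absv \<pi> ^ n")
  case True
  have "chi (uu k * y) = 1" if "k < q ^ n" for k
  proof (rule chi_O, rule absv_mult_le_1[where r="real q ^ n"])
    show "absv (uu k) \<le> real q ^ n" using that absv_u_le_iff by blast
    show "absv y \<le> inverse (real q ^ n)" using True by (simp add: absv_pi power_inverse)
  qed (use q_pos in simp)
  then show ?thesis using True by simp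
next
  case False
  let ?y = "\<pi> powi (- int n) * y"
  have "absv ?y > 1"
    unfolding absv_mult absv_power_int using False absv_pi_pos
    by (simp add: power_int_minus field_simps)
  then obtain x where x: "absv x \<le> 1" "chi (?y * x) \<noteq> 1" using annihilator by blast
  obtain k where k: "absv (\<pi> powi (- int n) * x - uu k) \<le> 1" using u_cover by blast
  have q1: "1 \<le> real q ^ n" using q_pos by simp
  have "absv (\<pi> powi (- int n) * x) \<le> real q ^ n"
    unfolding absv_mult absv_power_int
    using x(1) q_pos by (simp add: power_int_minus absv_pi power_inverse mult_left_le)
  then have "absv (\<pi> powi (- int n) * x - (\<pi> powi (- int n) * x - uu k)) \<le> real q ^ n"
    by (rule absv_diff_le) (use k q1 in linarith)
  then have kn: "absv (uu k) \<le> real q ^ n" by simp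
  \<comment> \<open>The test point \<open>x\<close> may be replaced by a representative, because \<open>y\<close> is an integer.\<close>
  have "absv ((\<pi> powi (- int n) * x - uu k) * y) \<le> 1"
    unfolding absv_mult using k y by (intro mult_le_one) auto
  then have "chi ((\<pi> powi (- int n) * x - uu k) * y) = 1" by (rule chi_O)
  then have "chi (?y * x) = chi (uu k * y)"
    using chi_add[of "(\<pi> powi (- int n) * x - uu k) * y" "uu k * y"] by (simp add: algebra_simps)
  then have ne: "chi (uu k * y) \<noteq> 1" using x(2) by simp
  define U where "U = uu ` {..<q ^ n}"
  have U: "U = {z. (\<exists>l. z = uu l) \<and> absv z \<le> real q ^ n}"
    unfolding U_def using absv_u_le_iff[of _ n] by auto
  have sumU: "(\<Sum>k<q ^ n. chi (uu k * y)) = (\<Sum>z\<in>U. chi (z * y))"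
    unfolding U_def by (subst sum.reindex) (auto simp: inj_on_def u_inj)
  have shift: "z - uu k \<in> U" "z + uu k \<in> U" if z: "z \<in> U" for z
  proof -
    obtain l where l: "z = uu l" "absv z \<le> real q ^ n" using z unfolding U by blast
    have "\<exists>m. z - uu k = uu m" "\<exists>m. z + uu k = uu m"
      using u_minus[of l k] u_plus[of l k] unfolding l(1) by (auto dest: sym)
    then show "z - uu k \<in> U" "z + uu k \<in> U"
      unfolding U using absv_diff_le[OF l(2) kn] absv_add_le[OF l(2) kn] by blast+
  qed
  \<comment> \<open>Translation by the group element \<open>uu k\<close> permutes \<open>U\<close> but multiplies the sum by a number other than 1.\<close>
  have "(\<Sum>z\<in>U. chi (z * y)) = (\<Sum>z\<in>U. chi ((z + uu k) * y))"
    by (rule sum.reindex_bij_witness[of U "\<lambda>z. z + uu k" "\<lambda>z. z - uu k" U]) (simp_all add: shift)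
  also have "\<dots> = (\<Sum>z\<in>U. chi (z * y)) * chi (uu k * y)"
    by (simp add: distrib_right chi_add sum_distrib_right)
  finally have "(\<Sum>z\<in>U. chi (z * y)) = 0" using ne by (metis mult_cancel_left2)
  then show ?thesis using False sumU by simp
qed

section \<open>Reduction modulo the integers\<close>

text \<open>
The choice is unambiguous, because distinct representatives lie in distinct cosets of the
integers.
\<close>

definition coset_index :: "'a \<Rightarrow> nat" where "coset_index x = (SOME k. absv (x - uu k) \<le> 1)"

definition reduce :: "'a \<Rightarrow> 'a" where "reduce x = x - uu (coset_index x)"

lemma absv_reduce: "absv (reduce x) \<le> 1"
  unfolding reduce_def coset_index_def by (rule someI_ex[OF u_cover])

lemma cosets_unique:
  assumes "absv (x - uu k) \<le> 1" "absv (x - uu l) \<le> 1"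
  shows "k = l"
  using absv_diff_le[OF assms(2,1)] by (intro u_distinct) simp

lemma coset_index_eq: "absv (x - uu k) \<le> 1 \<Longrightarrow> coset_index x = k"
  using cosets_unique absv_reduce unfolding reduce_def by blast

lemma coset_index_iff: "coset_index x = k \<longleftrightarrow> x \<in> pball (uu k) 0"
proof
  assume "coset_index x = k"
  then show "x \<in> pball (uu k) 0" using absv_reduce[of x] by (simp add: pball_def reduce_def)
qed (simp add: pball_def coset_index_eq)

lemma chi_u_reduce: "chi (uu k * reduce x) = chi (uu k * x)"
  by (simp add: reduce_def chi_u_periodic')

lemma reduce_vimage: "reduce -` A = (\<Union>k. pball (uu k) 0 \<inter> (\<lambda>x. x + (- uu k)) -` A)"
  by (simp add: set_eq_iff reduce_def coset_index_iff[symmetric])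

lemma vimage_translation_sets: "E \<in> sets L \<Longrightarrow> (\<lambda>x. x + y) -` E \<in> sets L"
  using measurable_sets[OF translation_L, of E y] by simp

lemma reduce_vimage_sets: "A \<in> sets L \<Longrightarrow> reduce -` A \<in> sets L"
  unfolding reduce_vimage
  by (intro sets.countable_UN image_subsetI, rule sets.Int)
    (rule sets_borel_L[OF pball_borel], rule vimage_translation_sets)

lemma AE_reduce:
  assumes "AE x in L. P x"
  shows "AE x in L. P (reduce x)"
proof -
  have "AE x in L. \<forall>k. P (x + (- uu k))"
    unfolding AE_all_countable using AE_translation[OF assms] by blast
  then show ?thesis by eventually_elim (simp add: reduce_def)
qed

text \<open>
By \<open>character_sum\<close> the indicator of a small ball, made periodic, is a linear combination of
finitely many \<open>chi (uu k * x)\<close>. The general case follows since the sets for which the claim holds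
form a Dynkin system.
\<close>

lemma set_integral_reduce_vimage_eq_0:
  assumes F: "integrable L F" and z: "\<And>k. (\<integral>x. F x * chi (uu k * x) \<partial>L) = 0"
    and A: "A \<in> sets borel"
  shows "(LINT x:reduce -` A|L. F x) = 0"
proof -
  have *: "A \<in> sigma_sets UNIV balls" using A borel_balls by simp
  have meas: "reduce -` B \<in> sets L" if "B \<in> sigma_sets UNIV balls" for B
    using that borel_balls sets_borel_L reduce_vimage_sets by metis
  have F0: "(\<integral>x. F x \<partial>L) = 0" using z[of 0] by simp
  have Pow: "balls \<subseteq> Pow UNIV" by simp
  show ?thesis
    using *
  proof (induction rule: sigma_sets_induct_disjoint[OF Int_stable_balls Pow,
        consumes 1, case_names basic empty compl union])
    case (basic A)
    show ?case
    proof (cases "reduce -` A = {}")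
      case False
      then obtain a n x where An: "A = pball a (int n)" and x: "reduce x \<in> A"
        using basic by (auto simp: balls_def)
      have "absv \<pi> ^ n \<le> 1" using absv_pi_less_1 by (intro power_le_one) auto
      then have "absv (reduce x - a) \<le> 1" using x by (simp add: An pball_def)
      from absv_diff_le[OF absv_reduce[of x] this] have a: "absv a \<le> 1" by simp
      have ind: "indicat_real (reduce -` A) x *\<^sub>R F x =
         inverse (of_nat (q ^ n)) * (\<Sum>k<q ^ n. cnj (chi (uu k * a)) * (F x * chi (uu k * x)))" for x
      proof -
        have "(\<Sum>k<q ^ n. chi (uu k * (reduce x - a))) = (\<Sum>k<q ^ n. cnj (chi (uu k * a)) * chi (uu k * x))"
          by (intro sum.cong refl, simp only: right_diff_distrib chi_diff chi_u_reduce, rule mult.commute)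
        moreover have "(\<Sum>k<q ^ n. chi (uu k * (reduce x - a))) = of_nat (q ^ n) * of_real (indicat_real (reduce -` A) x)"
          using character_sum[OF absv_diff_le[OF absv_reduce[of x] a], where n=n]
          by (simp add: An pball_def indicator_def)
        ultimately have "of_real (indicat_real (reduce -` A) x) =
          inverse (of_nat (q ^ n)) * (\<Sum>k<q ^ n. cnj (chi (uu k * a)) * chi (uu k * x))"
          using q_pos by (simp add: field_simps)
        then show ?thesis by (simp add: scaleR_conv_of_real sum_distrib_left sum_distrib_right mult_ac)
      qed
      have int: "integrable L (\<lambda>x. F x * chi (uu k * x))" for k
        by (rule Bochner_Integration.integrable_bound[OF F])
          (use F in \<open>auto simp: norm_mult chi_norm\<close>)
      show ?thesis
        unfolding set_lebesgue_integral_def ind using int z by (simp add: integral_sum)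
    qed (simp add: set_lebesgue_integral_def)
  next
    case empty
    then show ?case by (simp add: set_lebesgue_integral_def)
  next
    case (compl A)
    have "reduce -` (UNIV - A) = space L - reduce -` A" by auto
    moreover have "(LINT x:space L - reduce -` A|L. F x) = (\<integral>x. F x \<partial>L) - (LINT x:reduce -` A|L. F x)"
    proof -
      have "indicat_real (space L - reduce -` A) x *\<^sub>R F x = F x - indicat_real (reduce -` A) x *\<^sub>R F x" for x
        by (simp add: indicator_def)
      then show ?thesis
        unfolding set_lebesgue_integral_def
        using Bochner_Integration.integral_diff[OF F integrable_mult_indicator[OF meas[OF compl(1)] F]]
        by (simp only:)
    qed
    ultimately show ?case using compl F0 by simp
  next
    case (union A)
    have "(LINT x:(\<Union>i. reduce -` A i)|L. F x) = (\<Sum>i. (LINT x:reduce -` A i|L. F x))"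
    proof (rule lebesgue_integral_countable_add)
      show mA: "reduce -` A i \<in> sets L" for i using union(2) meas by blast
      show "reduce -` A i \<inter> reduce -` A j = {}" if "i \<noteq> j" for i j
        using union(1) that by (auto simp: disjoint_family_on_def)
      have "(\<Union>i. reduce -` A i) \<in> sets L" using mA by blast
      then show "set_integrable L (\<Union>i. reduce -` A i) F"
        unfolding set_integrable_def using F by (rule integrable_mult_indicator)
    qed
    then show ?case using union(3) by (simp add: vimage_UN)
  qed
qed

text \<open>
Uniqueness of Fourier coefficients for functions on the quotient by the representatives. The set
\<open>A\<close> may be merely Haar measurable because \<open>reduce\<close> pulls null sets back to null sets.
\<close>

lemma set_integral_periodic_eq_0:
  assumes F: "integrable L F" and z: "\<And>k. (\<integral>x. F x * chi (uu k * x) \<partial>L) = 0"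
    and A: "A \<in> sets L" and per: "reduce -` A = A"
  shows "(LINT x:A|L. F x) = 0"
proof -
  define B where "B = main_part haar A"
  have B: "B \<in> sets borel" unfolding B_def using main_part_sets[OF A] sets_haar by simp
  have "AE x in L. x \<in> B \<longleftrightarrow> x \<in> A"
    unfolding B_def by (intro AE_completion AE_in_main_part A)
  then have "AE x in L. reduce x \<in> B \<longleftrightarrow> reduce x \<in> A" by (rule AE_reduce)
  moreover have "reduce x \<in> A \<longleftrightarrow> x \<in> A" for x using per by blast
  ultimately have ae: "AE x in L. x \<in> reduce -` B \<longleftrightarrow> x \<in> A" by simp
  have "(LINT x:A|L. F x) = (LINT x:reduce -` B|L. F x)"
    unfolding set_lebesgue_integral_def
  proof (rule integral_cong_AE)
    show "AE x in L. indicat_real A x *\<^sub>R F x = indicat_real (reduce -` B) x *\<^sub>R F x"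
      using ae by eventually_elim (simp add: indicator_def)
    have [measurable]: "F \<in> borel_measurable L" using F by simp
    have [measurable]: "reduce -` B \<in> sets L" "A \<in> sets L"
      using reduce_vimage_sets[OF sets_borel_L[OF B]] A by auto
    show "(\<lambda>x. indicat_real A x *\<^sub>R F x) \<in> borel_measurable L"
      "(\<lambda>x. indicat_real (reduce -` B) x *\<^sub>R F x) \<in> borel_measurable L" by measurable
  qed
  then show ?thesis using set_integral_reduce_vimage_eq_0[OF F z B] by simp
qed

section \<open>Tilings by translation\<close>

text \<open>
The condition that the translates of \<open>W\<close> by the representatives partition the field, stated
pointwise.
\<close>

definition tile :: "'a set \<Rightarrow> bool" where
  "tile W \<longleftrightarrow> W \<in> sets L \<and> (AE x in L. \<exists>!k. x - uu k \<in> W)"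

definition orbit :: "'a set \<Rightarrow> 'a set" where
  "orbit E = {x. \<exists>k. x - uu k \<in> E}"

lemma orbit_alt: "orbit E = (\<Union>k. (\<lambda>x. x + (- uu k)) -` E)"
  by (auto simp: orbit_def)

lemma vimage_scale_sets: "E \<in> sets L \<Longrightarrow> (\<lambda>x. \<pi> powi j * x) -` E \<in> sets L"
  using measurable_sets[OF scale_L, of E j] by simp

lemma orbit_sets: "E \<in> sets L \<Longrightarrow> orbit E \<in> sets L"
  unfolding orbit_alt by (intro sets.countable_UN image_subsetI vimage_translation_sets)

lemma reduce_orbit: "reduce -` orbit E = orbit E"
proof -
  have "(\<exists>k. reduce x - uu k \<in> E) \<longleftrightarrow> (\<exists>k. x - uu k \<in> E)" for x
  proof
    assume "\<exists>k. reduce x - uu k \<in> E"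
    then obtain k where k: "x - uu (coset_index x) - uu k \<in> E" by (auto simp: reduce_def)
    obtain l where "uu l = uu (coset_index x) + uu k" using u_plus by blast
    then show "\<exists>k. x - uu k \<in> E" using k by (metis diff_diff_eq)
  next
    assume "\<exists>k. x - uu k \<in> E"
    then obtain k where k: "x - uu k \<in> E" by auto
    obtain l where "uu l = uu k - uu (coset_index x)" using u_minus by blast
    then have "reduce x - uu l = x - uu k" by (simp add: reduce_def)
    then show "\<exists>k. reduce x - uu k \<in> E" using k by metis
  qed
  then show ?thesis by (auto simp: orbit_def)
qed

text \<open>
Every measurable subset of a tile is, up to a null set, the intersection of the tile with a
periodic set, namely its orbit under translation.
\<close>

lemma tile_total:
  assumes W: "tile W" and F: "integrable L F" and off: "AE x in L. x \<notin> W \<longrightarrow> F x = 0"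
    and z: "\<And>k. (\<integral>x. F x * chi (uu k * x) \<partial>L) = 0"
  shows "AE x in L. F x = 0"
proof (rule AE_eq_0_if_set_integrals_0[OF F])
  fix E assume E: "E \<in> sets L"
  have WL: "W \<in> sets L" using W by (simp add: tile_def)
  let ?A = "orbit (E \<inter> W)"
  have A: "?A \<in> sets L" using E WL by (intro orbit_sets sets.Int)
  have "(LINT x:E|L. F x) = (LINT x:?A|L. F x)"
    unfolding set_lebesgue_integral_def
  proof (rule integral_cong_AE)
    have "AE x in L. \<exists>!k. x - uu k \<in> W" using W by (simp add: tile_def)
    with off show "AE x in L. indicat_real E x *\<^sub>R F x = indicat_real ?A x *\<^sub>R F x"
    proof eventually_elim
      case (elim x)
      show ?case
      proof (cases "x \<in> W")
        case True
        then have "x - uu 0 \<in> W" by simp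
        then have "x - uu k \<in> W \<longleftrightarrow> k = 0" for k using elim(2) by metis
        then have "x \<in> ?A \<longleftrightarrow> x \<in> E" using True by (auto simp: orbit_def)
        then show ?thesis by (simp add: indicator_def)
      qed (use elim in simp)
    qed
    have [measurable]: "F \<in> borel_measurable L" using F by simp
    note [measurable] = A E
    show "(\<lambda>x. indicat_real E x *\<^sub>R F x) \<in> borel_measurable L"
      "(\<lambda>x. indicat_real ?A x *\<^sub>R F x) \<in> borel_measurable L" by measurable
  qed
  also have "\<dots> = 0" using F z A reduce_orbit by (rule set_integral_periodic_eq_0)
  finally show "(LINT x:E|L. F x) = 0" .
qed

lemma pball_sets [measurable]: "pball a n \<in> sets L"
  by (rule sets_borel_L) simp

lemma emeasure_L_pball: "emeasure L (pball a n) = ennreal (absv \<pi> powi n)"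
  using emeasure_pball[of a n] by (simp add: sets_haar)

lemma tile_cosets: "tile (pball (uu l) 0)"
proof -
  have "\<exists>!k. x - uu k \<in> pball (uu l) 0" for x
  proof -
    obtain k where k: "uu k = uu (coset_index x) - uu l" using u_minus by blast
    show ?thesis
    proof (rule ex1I)
      show "x - uu k \<in> pball (uu l) 0" using absv_reduce[of x] by (simp add: pball_def k reduce_def)
      fix m assume "x - uu m \<in> pball (uu l) 0"
      then have m: "absv (x - uu m - uu l) \<le> 1" by (simp add: pball_def)
      obtain r where r: "uu r = uu m + uu l" using u_plus by blast
      have "coset_index x = r" by (rule coset_index_eq) (use m r in \<open>simp add: diff_diff_eq\<close>)
      then have "uu m = uu k" using r k by simp
      then show "m = k" by (simp add: u_inj)
    qed
  qed
  then show ?thesis by (simp add: tile_def)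
qed

lemma nn_integral_translation:
  assumes "f \<in> borel_measurable L"
  shows "(\<integral>\<^sup>+x. f (x + y) \<partial>L) = (\<integral>\<^sup>+x. f x \<partial>L)"
  using nn_integral_distr[OF translation_L, of f y] assms by (simp add: distr_translation_L)

text \<open>
All tiles are fundamental domains of the same group, so a periodic function has the same integral
over each of them. The proof cuts \<open>W\<close> along the cosets of the integers and moves the pieces into
the integers.
\<close>

lemma tile_nn_integral:
  assumes W: "tile W" and f [measurable]: "f \<in> borel_measurable L" and per: "\<And>x l. f (x + uu l) = f x"
  shows "(\<integral>\<^sup>+x. f x * indicator W x \<partial>L) = (\<integral>\<^sup>+x. f x * indicator (pball 0 0) x \<partial>L)"
proof -
  have [measurable]: "W \<in> sets L" using W by (simp add: tile_def)
  have [measurable]: "(\<lambda>x. g (x + y)) \<in> borel_measurable L" if "g \<in> borel_measurable L" for g :: "'a \<Rightarrow> ennreal" and y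
    using measurable_compose[OF translation_L that] .
  have one: "(\<Sum>l. indicator (pball (uu l) 0) x * (c::ennreal)) = c" for x c
  proof -
    have "(\<Sum>l. indicator (pball (uu l) 0) x * c) = (\<Sum>l. if l = coset_index x then c else 0)"
      by (intro suminf_cong) (auto simp: indicator_def coset_index_iff[symmetric])
    also have "\<dots> = c" by (rule suminf_unique_index) auto
    finally show ?thesis .
  qed
  have "(\<integral>\<^sup>+x. f x * indicator W x \<partial>L) =
      (\<integral>\<^sup>+x. (\<Sum>l. indicator (pball (uu l) 0) x * (f x * indicator W x)) \<partial>L)"
    by (simp only: one)
  also have "\<dots> = (\<Sum>l. \<integral>\<^sup>+x. indicator (pball (uu l) 0) x * (f x * indicator W x) \<partial>L)"
    by (rule nn_integral_suminf) measurable
  also have "\<dots> = (\<Sum>l. \<integral>\<^sup>+x. indicator W (x + uu l) * (f x * indicator (pball 0 0) x) \<partial>L)"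
  proof (rule suminf_cong)
    fix l
    have "(\<integral>\<^sup>+x. indicator (pball (uu l) 0) x * (f x * indicator W x) \<partial>L) =
        (\<integral>\<^sup>+x. indicator (pball (uu l) 0) (x + uu l) * (f (x + uu l) * indicator W (x + uu l)) \<partial>L)"
      by (rule nn_integral_translation[symmetric]) measurable
    also have "\<dots> = (\<integral>\<^sup>+x. indicator W (x + uu l) * (f x * indicator (pball 0 0) x) \<partial>L)"
      by (intro nn_integral_cong) (simp add: per pball_def indicator_def)
    finally show "(\<integral>\<^sup>+x. indicator (pball (uu l) 0) x * (f x * indicator W x) \<partial>L) =
       (\<integral>\<^sup>+x. indicator W (x + uu l) * (f x * indicator (pball 0 0) x) \<partial>L)" .
  qed
  also have "\<dots> = (\<integral>\<^sup>+x. (\<Sum>l. indicator W (x + uu l) * (f x * indicator (pball 0 0) x)) \<partial>L)"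
    by (rule nn_integral_suminf[symmetric]) measurable
  also have "\<dots> = (\<integral>\<^sup>+x. f x * indicator (pball 0 0) x \<partial>L)"
  proof (rule nn_integral_cong_AE)
    have "AE x in L. \<exists>!k. x - uu k \<in> W" using W by (simp add: tile_def)
    then show "AE x in L. (\<Sum>l. indicator W (x + uu l) * (f x * indicator (pball 0 0) x)) =
        f x * indicator (pball 0 0) x"
    proof eventually_elim
      case (elim x)
      have "\<exists>!l. x + uu l \<in> W"
      proof -
        obtain k where k: "x - uu k \<in> W" "\<And>l. x - uu l \<in> W \<Longrightarrow> l = k" using elim by metis
        obtain k' where k': "uu k' = - uu k" using u_neg by blast
        show ?thesis
        proof (rule ex1I[of _ k'])
          show "x + uu k' \<in> W" using k(1) k' by simp
          fix l assume l: "x + uu l \<in> W"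
          obtain l' where l': "uu l' = - uu l" using u_neg by blast
          have "l' = k" using k(2)[of l'] l l' by simp
          then show "l = k'" using l' k' by (metis minus_minus u_inj)
        qed
      qed
      from suminf_unique_index[OF this, of "f x * indicator (pball 0 0) x"]
      show ?case by (subst suminf_cong[where g="\<lambda>l. if x + uu l \<in> W then f x * indicator (pball 0 0) x else 0"])
          (auto simp: indicator_def)
    qed
  qed
  finally show ?thesis .
qed

lemma tile_emeasure:
  assumes "tile W"
  shows "emeasure L W = 1"
proof -
  have [measurable]: "W \<in> sets L" using assms by (simp add: tile_def)
  have "emeasure L W = emeasure L (pball 0 0)"
    using tile_nn_integral[OF assms, of "\<lambda>_. 1"] by (simp only: mult_1 nn_integral_indicator pball_sets \<open>W \<in> sets L\<close>) simp
  then show ?thesis using emeasure_L_pball[of 0 0] by simp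
qed

text \<open>
Adding 1 makes the integrand nonnegative, and tiles have measure 1.
\<close>

lemma tile_integral_real:
  fixes g :: "'a \<Rightarrow> real"
  assumes W: "tile W" and [measurable]: "g \<in> borel_measurable L" and per: "\<And>x l. g (x + uu l) = g x"
    and b: "\<And>x. \<bar>g x\<bar> \<le> 1"
  shows "(LINT x:W|L. g x) = (LINT x:pball 0 0|L. g x)"
proof -
  have *: "(LINT x:V|L. g x) = enn2real (\<integral>\<^sup>+x. ennreal (1 + g x) * indicator V x \<partial>L) - 1"
    if V: "tile V" for V
  proof -
    have [measurable]: "V \<in> sets L" using V by (simp add: tile_def)
    have fin: "emeasure L V = 1" using tile_emeasure V .
    have ind: "integrable L (indicat_real V)" using fin by (simp add: integrable_indicator_iff)
    have gi: "integrable L (\<lambda>x. indicat_real V x *\<^sub>R g x)"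
      by (rule Bochner_Integration.integrable_bound[OF ind]) (use b in \<open>auto simp: indicator_def\<close>)
    have "(\<integral>x. indicat_real V x + indicat_real V x *\<^sub>R g x \<partial>L) =
        enn2real (\<integral>\<^sup>+x. ennreal (indicat_real V x + indicat_real V x *\<^sub>R g x) \<partial>L)"
      by (rule integral_eq_nn_integral)
         (auto simp: indicator_def abs_le_iff intro!: AE_I2, use b in \<open>smt (verit)\<close>)
    also have "(\<integral>\<^sup>+x. ennreal (indicat_real V x + indicat_real V x *\<^sub>R g x) \<partial>L) =
        (\<integral>\<^sup>+x. ennreal (1 + g x) * indicator V x \<partial>L)"
      by (intro nn_integral_cong) (simp add: indicator_def)
    also have "(\<integral>x. indicat_real V x + indicat_real V x *\<^sub>R g x \<partial>L) =
       1 + (LINT x:V|L. g x)"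
      using ind gi fin by (simp add: set_lebesgue_integral_def measure_def)
    finally show ?thesis by simp
  qed
  have "tile (pball 0 0)" using tile_cosets[of 0] by simp
  then show ?thesis
    using *[OF W] *[of "pball 0 0"] tile_nn_integral[OF W, of "\<lambda>x. ennreal (1 + g x)"] per by simp
qed

lemma integrable_tile_bounded:
  assumes V: "tile V" and [measurable]: "g \<in> borel_measurable L" and "\<And>x. cmod (g x) \<le> 1"
  shows "integrable L (\<lambda>x. indicat_real V x *\<^sub>R g x)"
proof -
  have [measurable]: "V \<in> sets L" using V by (simp add: tile_def)
  have "integrable L (indicat_real V)"
    using tile_emeasure[OF V] by (simp add: integrable_indicator_iff)
  then show ?thesis
    by (rule Bochner_Integration.integrable_bound) (use assms(3) in \<open>auto simp: indicator_def\<close>)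
qed

lemma tile_integral:
  fixes g :: "'a \<Rightarrow> complex"
  assumes W: "tile W" and [measurable]: "g \<in> borel_measurable L" and per: "\<And>x l. g (x + uu l) = g x"
    and b: "\<And>x. cmod (g x) \<le> 1"
  shows "(LINT x:W|L. g x) = (LINT x:pball 0 0|L. g x)"
proof -
  have O: "tile (pball 0 0)" using tile_cosets[of 0] by simp
  have r: "Re (LINT x:V|L. g x) = (LINT x:V|L. Re (g x))" "Im (LINT x:V|L. g x) = (LINT x:V|L. Im (g x))"
    if V: "tile V" for V
    using integral_Re[OF integrable_tile_bounded[OF V _ b]] integral_Im[OF integrable_tile_bounded[OF V _ b]]
    by (simp_all add: set_lebesgue_integral_def)
  have "(LINT x:W|L. Re (g x)) = (LINT x:pball 0 0|L. Re (g x))"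
    by (rule tile_integral_real[OF W]) (use b abs_Re_le_cmod in \<open>auto simp: per intro: order_trans\<close>)
  moreover have "(LINT x:W|L. Im (g x)) = (LINT x:pball 0 0|L. Im (g x))"
    by (rule tile_integral_real[OF W]) (use b abs_Im_le_cmod in \<open>auto simp: per intro: order_trans\<close>)
  ultimately show ?thesis using r[OF W] r[OF O] by (simp add: complex_eq_iff)
qed

text \<open>
Translation by an integer \<open>a\<close> with \<open>chi (uu k * a) \<noteq> 1\<close> multiplies the integral by this number
without changing it.
\<close>

lemma integral_chi_integers: "(LINT x:pball 0 0|L. chi (uu k * x)) = (if k = 0 then 1 else 0)"
proof (cases "k = 0")
  case True
  then show ?thesis using emeasure_L_pball[of 0 0]
    by (simp add: set_lebesgue_integral_def measure_def)
next
  case False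
  then have "absv (uu k) > 1" using u_distinct[of k 0] by force
  then obtain a where a: "absv a \<le> 1" "chi (uu k * a) \<noteq> 1" using annihilator by blast
  let ?I = "LINT x:pball 0 0|L. chi (uu k * x)"
  have "?I = (\<integral>x. indicat_real (pball 0 0) (x + a) *\<^sub>R chi (uu k * (x + a)) \<partial>L)"
    unfolding set_lebesgue_integral_def
    by (rule integral_translation[symmetric]) measurable
  also have "\<dots> = (\<integral>x. chi (uu k * a) * (indicat_real (pball 0 0) x *\<^sub>R chi (uu k * x)) \<partial>L)"
  proof (intro Bochner_Integration.integral_cong refl)
    fix x
    have "x + a \<in> pball 0 0 \<longleftrightarrow> x \<in> pball 0 0"
      using absv_add_le[of x 1 a] absv_diff_le[of "x + a" 1 a] a(1) by (auto simp: pball_def)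
    then show "indicat_real (pball 0 0) (x + a) *\<^sub>R chi (uu k * (x + a)) =
        chi (uu k * a) * (indicat_real (pball 0 0) x *\<^sub>R chi (uu k * x))"
      by (simp add: indicator_def distrib_left chi_add)
  qed
  also have "\<dots> = chi (uu k * a) * ?I"
    unfolding set_lebesgue_integral_def by (rule integral_mult_right_zero)
  finally have "?I = 0" using a(2) by (metis mult_cancel_right1)
  then show ?thesis using False by simp
qed

lemma tile_integral_chi:
  assumes "tile W"
  shows "(LINT x:W|L. chi (uu k * x)) = (if k = 0 then 1 else 0)"
  using tile_integral[OF assms, of "\<lambda>x. chi (uu k * x)"] integral_chi_integers[of k]
  by (simp add: chi_u_periodic chi_norm)

text \<open>
The difference of the indicators of \<open>W\<close> and of the integers has vanishing coefficients, so \<open>W\<close>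
and the integers occupy the same measure in every periodic set. Points missed by all translates of
\<open>W\<close> form a periodic set disjoint from \<open>W\<close>, and the orbit of a set of points covered twice meets
\<open>W\<close> in at least twice the measure in which it meets the integers.
\<close>

lemma tile_if_integral_chi:
  assumes W: "W \<in> sets L" and fin: "emeasure L W < \<infinity>"
    and chi: "\<And>k. (LINT x:W|L. chi (uu k * x)) = (if k = 0 then 1 else 0)"
  shows "tile W"
proof -
  note [measurable] = W
  let ?O = "pball 0 0"
  have finO: "emeasure L ?O < \<infinity>" using emeasure_L_pball[of 0 0] by simp
  define F where "F x = complex_of_real (indicat_real W x - indicat_real ?O x)" for x
  have iW: "integrable L (indicat_real W)" "integrable L (indicat_real ?O)"
    using fin finO by (auto simp: integrable_indicator_iff)
  then have F: "integrable L F" unfolding F_def by auto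
  have i: "integrable L (\<lambda>x. indicat_real V x *\<^sub>R chi (uu k * x))"
    if "integrable L (indicat_real V)" "V \<in> sets L" for k V
    by (rule Bochner_Integration.integrable_bound[OF that(1)])
      (use that(2) in \<open>auto simp: chi_norm\<close>)
  have Fchi: "(\<integral>x. F x * chi (uu k * x) \<partial>L) = 0" for k
  proof -
    have "(\<integral>x. F x * chi (uu k * x) \<partial>L) =
       (\<integral>x. indicat_real W x *\<^sub>R chi (uu k * x) - indicat_real ?O x *\<^sub>R chi (uu k * x) \<partial>L)"
      by (intro Bochner_Integration.integral_cong) (auto simp: F_def scaleR_conv_of_real algebra_simps)
    also have "\<dots> = (LINT x:W|L. chi (uu k * x)) - (LINT x:?O|L. chi (uu k * x))"
      unfolding set_lebesgue_integral_def using i iW W pball_sets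
      by (intro Bochner_Integration.integral_diff) auto
    finally show ?thesis using chi integral_chi_integers by simp
  qed
  have eq: "emeasure L (W \<inter> A) = emeasure L (?O \<inter> A)" if A: "A \<in> sets L" "reduce -` A = A" for A
  proof -
    have [measurable]: "A \<in> sets L" by fact
    have "(LINT x:A|L. F x) = 0" using F Fchi A by (rule set_integral_periodic_eq_0)
    moreover have "(LINT x:A|L. F x) =
        (\<integral>x. complex_of_real (indicat_real (W \<inter> A) x - indicat_real (?O \<inter> A) x) \<partial>L)"
      unfolding set_lebesgue_integral_def F_def
      by (intro Bochner_Integration.integral_cong) (auto simp: indicator_def)
    moreover have f: "emeasure L (W \<inter> A) < \<infinity>" "emeasure L (?O \<inter> A) < \<infinity>"
      using emeasure_mono[of "W \<inter> A" W L] emeasure_mono[of "?O \<inter> A" ?O L] fin finO A by (auto intro: le_less_trans)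
    moreover have "integrable L (indicat_real (W \<inter> A))" "integrable L (indicat_real (?O \<inter> A))"
      using f A by (auto simp: integrable_indicator_iff)
    ultimately have "measure L (W \<inter> A) = measure L (?O \<inter> A)"
      unfolding integral_complex_of_real by simp
    then show ?thesis using f by (simp add: emeasure_eq_ennreal_measure top.not_eq_extremum)
  qed
  have cover: "AE x in L. x \<in> orbit W"
  proof -
    let ?C = "space L - orbit W"
    have C: "?C \<in> sets L" using orbit_sets[OF W] by (rule sets.compl_sets)
    have "W \<inter> ?C = {}" by (auto simp: orbit_def intro: exI[of _ 0])
    moreover have "reduce -` ?C = ?C" using reduce_orbit[of W] by auto
    ultimately have "emeasure L (?O \<inter> ?C) = 0" using eq[OF C] by simp
    then have "?O \<inter> ?C \<in> null_sets L" using C by (intro null_setsI) auto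
    then have "AE x in L. reduce x \<notin> ?O \<inter> ?C" by (intro AE_reduce AE_not_in)
    then show ?thesis
    proof eventually_elim
      case (elim x)
      have "reduce x \<in> ?O" using absv_reduce by (simp add: pball_def)
      then have "reduce x \<in> orbit W" using elim by simp
      then show ?case using reduce_orbit[of W] by blast
    qed
  qed
  have disj: "AE x in L. \<not> (x \<in> W \<and> x - uu l \<in> W)" if "l \<noteq> 0" for l
  proof -
    have null: "AE x in L. \<not> (x \<in> W \<and> x - uu l \<in> W \<and> x \<in> pball (uu r) 0)" for r
    proof -
      \<comment> \<open>Restricting to one coset of the integers makes \<open>E\<close> disjoint from its translate by \<open>- uu l\<close>,
        and the orbit of \<open>E\<close> meets the integers in exactly one translate of \<open>E\<close>.\<close>
      define E where "E = W \<inter> (\<lambda>x. x + (- uu l)) -` W \<inter> pball (uu r) 0"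
      have E: "E \<in> sets L"
        unfolding E_def using W vimage_translation_sets[OF W, of "- uu l"] by simp
      let ?E' = "(\<lambda>x. x + uu l) -` E"
      have E': "?E' \<in> sets L" using vimage_translation_sets[OF E] .
      have em: "emeasure L ((\<lambda>x. x + y) -` E) = emeasure L E" for y
        using emeasure_distr[OF translation_L E, of y] by (simp add: distr_translation_L)
      have "?O \<inter> orbit E = (\<lambda>x. x + uu r) -` E"
      proof (intro set_eqI iffI)
        fix x assume "x \<in> ?O \<inter> orbit E"
        then obtain k where k: "absv x \<le> 1" "x - uu k \<in> E" by (auto simp: pball_def orbit_def)
        obtain m where m: "uu m = - uu k" using u_neg by blast
        from k(2) have "absv (x - uu k - uu r) \<le> 1" by (simp add: E_def pball_def)
        then have "m = r"
          using k(1) by (intro cosets_unique[of "x - uu k"]) (simp_all add: m)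
        then show "x \<in> (\<lambda>x. x + uu r) -` E" using k(2) m by simp
      next
        fix x assume x: "x \<in> (\<lambda>x. x + uu r) -` E"
        obtain m where m: "uu m = - uu r" using u_neg by blast
        from x have "absv x \<le> 1" by (simp add: E_def pball_def)
        moreover have "x - uu m \<in> E" using x m by simp
        ultimately show "x \<in> ?O \<inter> orbit E" by (auto simp: pball_def orbit_def)
      qed
      then have O: "emeasure L (?O \<inter> orbit E) = emeasure L E" using em by simp
      have "E \<inter> ?E' = {}"
      proof (rule ccontr)
        assume "E \<inter> ?E' \<noteq> {}"
        then obtain x where "x \<in> E" "x + uu l \<in> E" by auto
        then have "absv (x - uu r) \<le> 1" "absv (x + uu l - uu r) \<le> 1" by (auto simp: E_def pball_def)
        from absv_diff_le[OF this(2,1)] have "absv (uu l - uu 0) \<le> 1" by simp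
        then show False using u_distinct that by blast
      qed
      then have "emeasure L E + emeasure L E = emeasure L (E \<union> ?E')"
        using plus_emeasure[OF E E'] em by simp
      also have "\<dots> \<le> emeasure L (W \<inter> orbit E)"
      proof (rule emeasure_mono)
        obtain m where m: "uu m = - uu l" using u_neg by blast
        have "x \<in> orbit E" if "x + uu l \<in> E" for x
          using that m unfolding orbit_def by (intro CollectI exI[of _ m]) simp
        moreover have "x \<in> orbit E" if "x \<in> E" for x
          using that unfolding orbit_def by (intro CollectI exI[of _ 0]) simp
        ultimately show "E \<union> ?E' \<subseteq> W \<inter> orbit E" by (auto simp: E_def)
        show "W \<inter> orbit E \<in> sets L" using W orbit_sets[OF E] by simp
      qed
      also have "\<dots> = emeasure L E"
        using eq[OF orbit_sets[OF E] reduce_orbit] O by simp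
      finally have le: "emeasure L E + emeasure L E \<le> emeasure L E" .
      have "emeasure L E < \<infinity>"
        using emeasure_mono[of E W L] W fin by (auto simp: E_def intro: le_less_trans)
      then have "emeasure L E = 0"
        using le by (cases "emeasure L E") (auto simp: ennreal_plus[symmetric] ennreal_eq_0_iff simp del: ennreal_plus)
      then have "E \<in> null_sets L" using E by (intro null_setsI) auto
      then have "AE x in L. x \<notin> E" by (rule AE_not_in)
      then show ?thesis by eventually_elim (simp add: E_def)
    qed
    have "AE x in L. \<forall>r. \<not> (x \<in> W \<and> x - uu l \<in> W \<and> x \<in> pball (uu r) 0)"
      unfolding AE_all_countable using null by blast
    then show ?thesis by eventually_elim (use coset_index_iff in blast)
  qed
  have "AE x in L. \<forall>l m. l \<noteq> 0 \<longrightarrow> \<not> (x - uu m \<in> W \<and> x - uu m - uu l \<in> W)"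
    unfolding AE_all_countable
  proof (intro allI)
    fix l m
    show "AE x in L. l \<noteq> 0 \<longrightarrow> \<not> (x - uu m \<in> W \<and> x - uu m - uu l \<in> W)"
    proof (cases "l = 0")
      case False
      then show ?thesis using AE_translation[OF disj[OF False], of "- uu m"] by simp
    qed simp
  qed
  with cover have "AE x in L. \<exists>!k. x - uu k \<in> W"
  proof eventually_elim
    case (elim x)
    obtain k where k: "x - uu k \<in> W" using elim(1) by (auto simp: orbit_def)
    show ?case
    proof (rule ex1I[of _ k])
      show "x - uu k \<in> W" by fact
      fix m assume m: "x - uu m \<in> W"
      obtain l where l: "uu l = uu m - uu k" using u_minus by blast
      have "x - uu k - uu l \<in> W" using m by (simp add: l)
      then have "l = 0" using elim(2) k by blast
      then show "m = k" using l by (simp add: u_inj)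
    qed
  qed
  then show ?thesis using W by (simp add: tile_def)
qed

text \<open>
The conjugate character satisfies the same axioms, so that every result about \<open>chi\<close> is available
for it; this yields the basis on the Fourier side.
\<close>

lemma conj_setup: "local_field_setup \<pi> c \<epsilon> haar (\<lambda>x. cnj (chi x))"
  using local_field_setup_axioms
  unfolding local_field_setup_def local_field_setup_axioms_def
  by (auto intro: continuous_on_cnj)

section \<open>The orthonormal basis of coset characters\<close>

text \<open>
The pair holds the frequency and the coset: the character of frequency \<open>uu (fst p)\<close> cut off to the
coset of \<open>uu (snd p)\<close>.
\<close>

definition coset_char :: "nat \<times> nat \<Rightarrow> 'a \<Rightarrow> complex" where
  "coset_char p x = indicat_real (pball (uu (snd p)) 0) x *\<^sub>R chi (uu (fst p) * x)"

lemma coset_char_L2: "coset_char p \<in> L2 L"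
proof -
  have "(\<lambda>x. complex_of_real (indicat_real (pball (uu (snd p)) 0) x)) \<in> L2 L"
    using emeasure_L_pball[of "uu (snd p)" 0] by (intro indicator_L2) auto
  then show ?thesis
    by (rule L2_bound) (auto simp: coset_char_def[abs_def] indicator_def chi_norm)
qed

lemma coset_char_inner:
  "L2_inner L (coset_char p) (coset_char r) = (if p = r then 1 else 0)"
proof (cases "snd p = snd r")
  case False
  then have "coset_char p x * cnj (coset_char r x) = 0" for x
    using cosets_unique[of x "snd p" "snd r"] by (auto simp: coset_char_def indicator_def pball_def)
  then have "L2_inner L (coset_char p) (coset_char r) = (\<integral>x. 0 \<partial>L)"
    unfolding L2_inner_def by (simp only:)
  then show ?thesis using False by auto
next
  case True
  obtain k where k: "uu k = uu (fst p) - uu (fst r)" using u_minus by blast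
  have "coset_char p x * cnj (coset_char r x) = indicat_real (pball (uu (snd p)) 0) x *\<^sub>R chi (uu k * x)" for x
    using True by (simp add: coset_char_def indicator_def k left_diff_distrib chi_diff)
  then have "L2_inner L (coset_char p) (coset_char r) = (LINT x:pball (uu (snd p)) 0|L. chi (uu k * x))"
    by (simp add: L2_inner_def set_lebesgue_integral_def)
  also have "\<dots> = (if k = 0 then 1 else 0)" by (rule tile_integral_chi[OF tile_cosets])
  also have "k = 0 \<longleftrightarrow> p = r"
  proof -
    have "k = 0 \<longleftrightarrow> uu k = uu 0" by (simp add: u_inj del: u_0)
    also have "\<dots> \<longleftrightarrow> fst p = fst r" by (simp add: k u_inj)
    finally show ?thesis using True by (simp add: prod_eq_iff)
  qed
  finally show ?thesis .
qed

lemma coset_char_orthonormal: "L2_orthonormal L UNIV coset_char"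
  by (simp add: L2_orthonormal_def coset_char_L2 coset_char_inner)

lemma L2_coset_integrable:
  assumes "f \<in> L2 L"
  shows "integrable L (\<lambda>x. indicat_real (pball (uu l) 0) x *\<^sub>R f x)"
  using L2_mult_integrable[OF assms coset_char_L2, of "(0, l)"]
  by (simp add: coset_char_def scaleR_conv_of_real mult.commute)

text \<open>
Conjugation only permutes the characters, since the representatives are closed under negation.
\<close>

lemma tile_total_cnj:
  assumes W: "tile W" and F: "integrable L F" and off: "AE x in L. x \<notin> W \<longrightarrow> F x = 0"
    and z: "\<And>k. (\<integral>x. F x * cnj (chi (uu k * x)) \<partial>L) = 0"
  shows "AE x in L. F x = 0"
proof (rule tile_total[OF W F off])
  fix k
  obtain l where l: "uu l = - uu k" using u_neg by blast
  have "chi (uu k * x) = cnj (chi (uu l * x))" for x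
    using chi_minus[of "uu l * x"] by (simp add: l)
  then show "(\<integral>x. F x * chi (uu k * x) \<partial>L) = 0" using z[of l] by simp
qed

text \<open>
On each coset this is \<open>tile_total\<close>, every coset of the integers being a tile.
\<close>

lemma coset_char_total: "L2_total L UNIV coset_char"
  unfolding L2_total_def
proof (intro ballI impI)
  fix f assume f: "f \<in> L2 L" and z: "\<forall>i\<in>UNIV. L2_inner L f (coset_char i) = 0"
  have "AE x in L. indicat_real (pball (uu l) 0) x *\<^sub>R f x = 0" for l
  proof (rule tile_total_cnj[OF tile_cosets[of l] L2_coset_integrable[OF f]])
    fix k
    have "(\<integral>x. indicat_real (pball (uu l) 0) x *\<^sub>R f x * cnj (chi (uu k * x)) \<partial>L) =
        L2_inner L f (coset_char (k, l))"
      unfolding L2_inner_def coset_char_def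
      by (intro Bochner_Integration.integral_cong) (auto simp: scaleR_conv_of_real)
    then show "(\<integral>x. indicat_real (pball (uu l) 0) x *\<^sub>R f x * cnj (chi (uu k * x)) \<partial>L) = 0"
      using z by simp
  qed simp
  then have "AE x in L. \<forall>l. indicat_real (pball (uu l) 0) x *\<^sub>R f x = 0"
    unfolding AE_all_countable by blast
  then show "AE x in L. f x = 0"
  proof eventually_elim
    case (elim x)
    have "x \<in> pball (uu (coset_index x)) 0" using coset_index_iff by blast
    then show ?case using elim[rule_format, of "coset_index x"] by simp
  qed
qed

text \<open>
The Fourier transform of \<open>coset_char p\<close>: frequency and coset change places.
\<close>

definition dual_char :: "nat \<times> nat \<Rightarrow> 'a \<Rightarrow> complex" where
  "dual_char p x = indicat_real (pball (uu (fst p)) 0) x *\<^sub>R cnj (chi (uu (snd p) * x))"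

lemma dual_char_eq: "dual_char p = local_field_setup.coset_char \<pi> c \<epsilon> (\<lambda>x. cnj (chi x)) (prod.swap p)"
  using local_field_setup.coset_char_def[OF conj_setup]
  by (auto simp: fun_eq_iff dual_char_def)

lemma dual_char_orthonormal: "L2_orthonormal L UNIV dual_char"
  using local_field_setup.coset_char_orthonormal[OF conj_setup]
  unfolding L2_orthonormal_def dual_char_eq by auto

lemma dual_char_total: "L2_total L UNIV dual_char"
proof -
  have "(\<forall>i. P i) \<longleftrightarrow> (\<forall>i. P (prod.swap i))" for P :: "nat \<times> nat \<Rightarrow> bool"
    by auto
  then show ?thesis
    using local_field_setup.coset_char_total[OF conj_setup]
    unfolding L2_total_def dual_char_eq by auto
qed

section \<open>The Fourier transform of an integrable function\<close>

text \<open>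
The product \<open>(\<xi> - uu k) * (x - uu l)\<close> is an integer, and \<open>chi (uu k * uu l) = 1\<close>.
\<close>

lemma kernel_factor:
  assumes "x \<in> pball (uu l) 0" "\<xi> \<in> pball (uu k) 0"
  shows "chi (\<xi> * x) = chi (uu k * x) * chi (uu l * \<xi>)"
proof -
  have "absv ((\<xi> - uu k) * (x - uu l)) \<le> 1"
    unfolding absv_mult using assms by (intro mult_le_one) (auto simp: pball_def)
  then have "chi ((\<xi> - uu k) * (x - uu l)) = 1" by (rule chi_O)
  moreover have "\<xi> * x = (\<xi> - uu k) * (x - uu l) + (uu k * x + uu l * \<xi>) - uu k * uu l"
    by (simp add: algebra_simps)
  ultimately show ?thesis by (simp add: chi_add chi_diff chi_u)
qed

definition coset_coeff :: "('a \<Rightarrow> complex) \<Rightarrow> nat \<Rightarrow> nat \<Rightarrow> complex" where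
  "coset_coeff f k l = (LINT x:pball (uu l) 0|L. f x * cnj (chi (uu k * x)))"

lemma coset_coeff_eq_inner: "coset_coeff f k l = L2_inner L f (coset_char (k, l))"
  unfolding coset_coeff_def L2_inner_def coset_char_def set_lebesgue_integral_def
  by (intro Bochner_Integration.integral_cong) (auto simp: scaleR_conv_of_real)

lemma integrable_chi: "integrable L f \<Longrightarrow> integrable L (\<lambda>x. f x * chi (y * x))"
  "integrable L f \<Longrightarrow> integrable L (\<lambda>x. f x * cnj (chi (y * x)))"
  by (rule integrable_mult_bounded; simp add: chi_norm)+

lemma cosets_disjoint: "i \<noteq> j \<Longrightarrow> pball (uu i) 0 \<inter> pball (uu j) 0 = {}"
  using cosets_unique by (auto simp: pball_def)

lemma cosets_cover: "(\<Union>i. pball (uu i) 0) = UNIV"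
  using coset_index_iff by blast

text \<open>
Summing over the cosets in \<open>x\<close> turns the Fourier integral, on each coset in \<open>\<xi>\<close>, into a Fourier
series whose coefficients are inner products of \<open>f\<close> with \<open>coset_char\<close>.
\<close>

lemma fourier_series:
  assumes f: "integrable L f"
  shows "fourier_L1 L chi f \<xi> = (\<Sum>l. cnj (chi (uu l * \<xi>)) * coset_coeff f (coset_index \<xi>) l)"
proof -
  have i: "integrable L (\<lambda>x. f x * cnj (chi (\<xi> * x)))" using integrable_chi(2)[OF f] .
  have "fourier_L1 L chi f \<xi> = (LINT x:(\<Union>l. pball (uu l) 0)|L. f x * cnj (chi (\<xi> * x)))"
    unfolding cosets_cover by (simp add: fourier_L1_def set_lebesgue_integral_def)
  also have "\<dots> = (\<Sum>l. (LINT x:pball (uu l) 0|L. f x * cnj (chi (\<xi> * x))))"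
    by (rule lebesgue_integral_countable_add)
      (use i in \<open>auto simp: cosets_disjoint cosets_cover set_integrable_def\<close>)
  also have "\<dots> = (\<Sum>l. cnj (chi (uu l * \<xi>)) * coset_coeff f (coset_index \<xi>) l)"
  proof (rule suminf_cong)
    fix l
    have "\<xi> \<in> pball (uu (coset_index \<xi>)) 0" using coset_index_iff by blast
    then have "indicat_real (pball (uu l) 0) x *\<^sub>R (f x * cnj (chi (\<xi> * x))) =
      cnj (chi (uu l * \<xi>)) * (indicat_real (pball (uu l) 0) x *\<^sub>R (f x * cnj (chi (uu (coset_index \<xi>) * x))))" for x
      by (cases "x \<in> pball (uu l) 0") (simp_all add: kernel_factor[of x l \<xi> "coset_index \<xi>"])
    then show "(LINT x:pball (uu l) 0|L. f x * cnj (chi (\<xi> * x))) = cnj (chi (uu l * \<xi>)) * coset_coeff f (coset_index \<xi>) l"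
      unfolding coset_coeff_def set_lebesgue_integral_def
      by (simp only: integral_mult_right_zero)
  qed
  finally show ?thesis .
qed

lemma summable_coset_coeff:
  assumes f: "integrable L f"
  shows "summable (\<lambda>l. cmod (coset_coeff f k l))"
proof (rule summableI_nonneg_bounded)
  fix n
  have i: "integrable L (\<lambda>x. indicat_real (pball (uu l) 0) x *\<^sub>R cmod (f x))" for l
    using f by (intro integrable_mult_indicator) auto
  have "(\<Sum>l<n. cmod (coset_coeff f k l)) \<le> (\<Sum>l<n. \<integral>x. indicat_real (pball (uu l) 0) x *\<^sub>R cmod (f x) \<partial>L)"
  proof (rule sum_mono)
    fix l
    have "cmod (coset_coeff f k l) \<le> (\<integral>x. cmod (indicat_real (pball (uu l) 0) x *\<^sub>R (f x * cnj (chi (uu k * x)))) \<partial>L)"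
      unfolding coset_coeff_def set_lebesgue_integral_def by (rule integral_norm_bound)
    then show "cmod (coset_coeff f k l) \<le> (\<integral>x. indicat_real (pball (uu l) 0) x *\<^sub>R cmod (f x) \<partial>L)"
      by (simp add: norm_mult chi_norm)
  qed
  also have "\<dots> = (\<integral>x. (\<Sum>l<n. indicat_real (pball (uu l) 0) x *\<^sub>R cmod (f x)) \<partial>L)"
    by (rule Bochner_Integration.integral_sum[symmetric]) (rule i)
  also have "\<dots> \<le> (\<integral>x. cmod (f x) \<partial>L)"
  proof (rule integral_mono)
    show "integrable L (\<lambda>x. \<Sum>l<n. indicat_real (pball (uu l) 0) x *\<^sub>R cmod (f x))"
      by (intro Bochner_Integration.integrable_sum i)
    fix x
    have "(\<Sum>l<n. indicat_real (pball (uu l) 0) x *\<^sub>R cmod (f x)) =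
        (\<Sum>l<n. if l = coset_index x then cmod (f x) else 0)"
      by (intro sum.cong) (auto simp: indicator_def coset_index_iff[symmetric])
    then show "(\<Sum>l<n. indicat_real (pball (uu l) 0) x *\<^sub>R cmod (f x)) \<le> cmod (f x)" by simp
  qed (use f in auto)
  finally show "(\<Sum>l<n. cmod (coset_coeff f k l)) \<le> (\<integral>x. cmod (f x) \<partial>L)" .
qed simp

lemma coset_index_measurable: "coset_index \<in> L \<rightarrow>\<^sub>M count_space UNIV"
proof -
  have v: "coset_index -` {a} \<inter> space L = pball (uu a) 0" for a
    by (simp add: set_eq_iff coset_index_iff)
  show ?thesis
    by (subst measurable_count_space_eq2_countable) (simp_all add: v del: space_completion)
qed

lemma fourier_L1_measurable:
  assumes f: "integrable L f"
  shows "fourier_L1 L chi f \<in> borel_measurable L"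
proof -
  have "(\<lambda>\<xi>. \<Sum>l. cnj (chi (uu l * \<xi>)) * coset_coeff f (coset_index \<xi>) l) \<in> borel_measurable L"
  proof (rule borel_measurable_suminf)
    fix l
    show "(\<lambda>\<xi>. cnj (chi (uu l * \<xi>)) * coset_coeff f (coset_index \<xi>) l) \<in> borel_measurable L"
      using coset_index_measurable
      by (rule measurable_compose_countable[rotated]) measurable
  qed
  then show ?thesis using fourier_series[OF f] by (simp cong: measurable_cong)
qed

lemma fourier_L1_bounded: "cmod (fourier_L1 L chi f \<xi>) \<le> (\<integral>x. cmod (f x) \<partial>L)"
proof -
  have "cmod (fourier_L1 L chi f \<xi>) \<le> (\<integral>x. cmod (f x * cnj (chi (\<xi> * x))) \<partial>L)"
    unfolding fourier_L1_def by (rule integral_norm_bound)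
  then show ?thesis by (simp add: norm_mult chi_norm)
qed

lemma fourier_L1_coset_integrable:
  assumes f: "integrable L f"
  shows "integrable L (\<lambda>\<xi>. indicat_real (pball (uu k) 0) \<xi> *\<^sub>R fourier_L1 L chi f \<xi>)"
proof (rule Bochner_Integration.integrable_bound)
  note [measurable] = fourier_L1_measurable[OF f]
  show "integrable L (\<lambda>\<xi>. (\<integral>x. cmod (f x) \<partial>L) * indicat_real (pball (uu k) 0) \<xi>)"
    using emeasure_L_pball[of "uu k" 0] by (intro integrable_mult_right) (simp add: integrable_indicator_iff)
  show "(\<lambda>\<xi>. indicat_real (pball (uu k) 0) \<xi> *\<^sub>R fourier_L1 L chi f \<xi>) \<in> borel_measurable L"
    by measurable
qed (use fourier_L1_bounded[of f] in \<open>auto simp: indicator_def intro: order_trans\<close>)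

text \<open>
The series converges absolutely and uniformly, so its coefficients are obtained by termwise
integration.
\<close>

lemma fourier_L1_coeff:
  assumes f: "integrable L f"
  shows "(LINT \<xi>:pball (uu k) 0|L. fourier_L1 L chi f \<xi> * chi (uu m * \<xi>)) = coset_coeff f k m"
proof -
  let ?I = "\<lambda>\<xi>. indicat_real (pball (uu k) 0) \<xi>"
  let ?g = "\<lambda>l \<xi>. ?I \<xi> *\<^sub>R (cnj (chi (uu l * \<xi>)) * chi (uu m * \<xi>)) * coset_coeff f k l"
  have sc: "summable (\<lambda>l. cmod (coset_coeff f k l))" using summable_coset_coeff[OF f] .
  have indI: "integrable L ?I" using emeasure_L_pball[of "uu k" 0] by (simp add: integrable_indicator_iff)
  have ii: "integrable L (\<lambda>\<xi>. ?I \<xi> *\<^sub>R (cnj (chi (uu l * \<xi>)) * chi (uu m * \<xi>)))" for l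
    by (rule Bochner_Integration.integrable_bound[OF indI]) (auto simp: norm_mult chi_norm)
  have val: "(\<integral>\<xi>. ?g l \<xi> \<partial>L) = (if l = m then coset_coeff f k m else 0)" for l
  proof -
    obtain r where r: "uu r = uu m - uu l" using u_minus by blast
    have "cnj (chi (uu l * \<xi>)) * chi (uu m * \<xi>) = chi (uu r * \<xi>)" for \<xi>
      by (simp add: r left_diff_distrib chi_diff)
    then have "(\<integral>\<xi>. ?g l \<xi> \<partial>L) = (\<integral>\<xi>. ?I \<xi> *\<^sub>R chi (uu r * \<xi>) * coset_coeff f k l \<partial>L)"
      by (simp only:)
    also have "\<dots> = (LINT \<xi>:pball (uu k) 0|L. chi (uu r * \<xi>)) * coset_coeff f k l"
      unfolding set_lebesgue_integral_def by (rule integral_mult_left_zero)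
    also have "\<dots> = (if r = 0 then coset_coeff f k l else 0)"
      by (simp add: tile_integral_chi[OF tile_cosets])
    also have "r = 0 \<longleftrightarrow> l = m"
    proof -
      have "r = 0 \<longleftrightarrow> uu r = uu 0" by (simp add: u_inj del: u_0)
      then show ?thesis by (auto simp: r u_inj)
    qed
    finally show ?thesis by auto
  qed
  have bnd: "norm (?g l \<xi>) \<le> cmod (coset_coeff f k l)" for l \<xi>
    by (simp add: norm_mult chi_norm indicator_def)
  have inorm: "(\<integral>\<xi>. norm (?g l \<xi>) \<partial>L) = cmod (coset_coeff f k l)" for l
  proof -
    have "(\<integral>\<xi>. norm (?g l \<xi>) \<partial>L) = (\<integral>\<xi>. ?I \<xi> * cmod (coset_coeff f k l) \<partial>L)"
      by (intro Bochner_Integration.integral_cong) (auto simp: norm_mult chi_norm indicator_def)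
    also have "\<dots> = cmod (coset_coeff f k l)"
      using emeasure_L_pball[of "uu k" 0] by (simp add: measure_def)
    finally show ?thesis .
  qed
  have "?I \<xi> *\<^sub>R (fourier_L1 L chi f \<xi> * chi (uu m * \<xi>)) = (\<Sum>l. ?g l \<xi>)" for \<xi>
  proof (cases "\<xi> \<in> pball (uu k) 0")
    case True
    then have id: "coset_index \<xi> = k" using coset_index_iff by simp
    have "summable (\<lambda>l. cnj (chi (uu l * \<xi>)) * coset_coeff f k l)"
      by (rule summable_norm_cancel) (use sc in \<open>simp add: norm_mult chi_norm\<close>)
    from suminf_mult2[OF this, of "chi (uu m * \<xi>)"] show ?thesis
      using True by (simp add: fourier_series[OF f] id mult_ac)
  qed simp
  then have "(LINT \<xi>:pball (uu k) 0|L. fourier_L1 L chi f \<xi> * chi (uu m * \<xi>)) = (\<integral>\<xi>. (\<Sum>l. ?g l \<xi>) \<partial>L)"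
    by (simp add: set_lebesgue_integral_def)
  also have "\<dots> = (\<Sum>l. \<integral>\<xi>. ?g l \<xi> \<partial>L)"
  proof (rule integral_suminf)
    show "integrable L (?g l)" for l using ii by (rule integrable_mult_left)
    show "AE \<xi> in L. summable (\<lambda>l. norm (?g l \<xi>))"
      by (intro AE_I2 summable_comparison_test'[OF sc]) (simp only: real_norm_def abs_norm_cancel bnd)
    show "summable (\<lambda>l. \<integral>\<xi>. norm (?g l \<xi>) \<partial>L)" unfolding inorm by (rule sc)
  qed
  also have "\<dots> = (\<Sum>l. if l = m then coset_coeff f k m else 0)" unfolding val ..
  also have "\<dots> = coset_coeff f k m"
    using sums_single[of m "\<lambda>_. coset_coeff f k m"] by (simp add: sums_iff)
  finally show ?thesis .
qed

section \<open>The Fourier transform on square-integrable functions\<close>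

text \<open>
The graph of the Fourier transform on \<open>L2\<close>, described through coefficients.
\<close>

abbreviation fourier_pair :: "('a \<Rightarrow> complex) \<Rightarrow> ('a \<Rightarrow> complex) \<Rightarrow> bool" where
  "fourier_pair \<equiv> same_coeffs L coset_char dual_char"

text \<open>
The function with the prescribed coefficients exists by completeness. The Fourier integral is
bounded, hence integrable on each coset, and has the same coefficients there; uniqueness on the
coset identifies the two.
\<close>

lemma fourier_pair_L1:
  assumes f: "integrable L f" "f \<in> L2 L"
  shows "fourier_pair f (fourier_L1 L chi f)"
proof -
  obtain g where g: "fourier_pair f g"
    using same_coeffs_exists[OF coset_char_orthonormal dual_char_orthonormal f(2)] .
  then have gL2: "g \<in> L2 L" by (simp add: same_coeffs_def)
  let ?h = "fourier_L1 L chi f"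
  have "AE \<xi> in L. indicat_real (pball (uu k) 0) \<xi> *\<^sub>R g \<xi> - indicat_real (pball (uu k) 0) \<xi> *\<^sub>R ?h \<xi> = 0" for k
  proof (rule tile_total[OF tile_cosets[of k]])
    note i = L2_coset_integrable[OF gL2, of k] fourier_L1_coset_integrable[OF f(1), of k]
    then show "integrable L (\<lambda>\<xi>. indicat_real (pball (uu k) 0) \<xi> *\<^sub>R g \<xi> - indicat_real (pball (uu k) 0) \<xi> *\<^sub>R ?h \<xi>)"
      by (rule Bochner_Integration.integrable_diff)
    fix m
    have "(\<integral>\<xi>. indicat_real (pball (uu k) 0) \<xi> *\<^sub>R g \<xi> * chi (uu m * \<xi>) \<partial>L) = L2_inner L g (dual_char (k, m))"
      unfolding L2_inner_def dual_char_def
      by (intro Bochner_Integration.integral_cong) (auto simp: scaleR_conv_of_real)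
    also have "\<dots> = coset_coeff f k m"
      using g by (simp add: same_coeffs_def coset_coeff_eq_inner)
    also have "\<dots> = (\<integral>\<xi>. indicat_real (pball (uu k) 0) \<xi> *\<^sub>R ?h \<xi> * chi (uu m * \<xi>) \<partial>L)"
      unfolding fourier_L1_coeff[OF f(1), symmetric] set_lebesgue_integral_def
      by (simp add: scaleR_conv_of_real mult.assoc)
    finally show "(\<integral>\<xi>. (indicat_real (pball (uu k) 0) \<xi> *\<^sub>R g \<xi> - indicat_real (pball (uu k) 0) \<xi> *\<^sub>R ?h \<xi>) *
        chi (uu m * \<xi>) \<partial>L) = 0"
      using integrable_chi(1)[OF i(1)] integrable_chi(1)[OF i(2)] by (simp add: left_diff_distrib)
  qed simp
  then have "AE \<xi> in L. \<forall>k. indicat_real (pball (uu k) 0) \<xi> *\<^sub>R g \<xi> - indicat_real (pball (uu k) 0) \<xi> *\<^sub>R ?h \<xi> = 0"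
    unfolding AE_all_countable by blast
  then have "AE \<xi> in L. g \<xi> = ?h \<xi>"
  proof eventually_elim
    case (elim x)
    have "x \<in> pball (uu (coset_index x)) 0" using coset_index_iff by blast
    then show ?case using elim[rule_format, of "coset_index x"] by simp
  qed
  then show ?thesis
    by (rule same_coeffs_cong_AE[OF g dual_char_orthonormal fourier_L1_measurable[OF f(1)]])
qed

lemma fourier_pair_norm: "fourier_pair f g \<Longrightarrow> L2_norm L f = L2_norm L g"
  by (rule same_coeffs_norm[OF coset_char_orthonormal coset_char_total dual_char_orthonormal dual_char_total])

lemma fourier_pair_tendsto:
  assumes "fourier_pair f g" "\<And>n. fourier_pair (F n) (G n)" "L2_tendsto L F f"
  shows "L2_tendsto L G g"
proof -
  have "L2_norm L (\<lambda>x. F n x - f x) = L2_norm L (\<lambda>x. G n x - g x)" for n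
    by (intro fourier_pair_norm same_coeffs_diff coset_char_orthonormal dual_char_orthonormal assms)
  then show ?thesis using assms by (simp add: L2_tendsto_def same_coeffs_def)
qed

definition truncate :: "('a \<Rightarrow> complex) \<Rightarrow> nat \<Rightarrow> 'a \<Rightarrow> complex" where
  "truncate f n x = indicat_real (pball 0 (- int n)) x *\<^sub>R f x"

lemma truncate_L2:
  assumes "f \<in> L2 L"
  shows "truncate f n \<in> L2 L"
proof -
  have [measurable]: "f \<in> borel_measurable L" using assms by (rule L2_measurable)
  show ?thesis
    by (rule L2_bound[OF assms]) (auto simp: truncate_def[abs_def] indicator_def)
qed

lemma truncate_integrable:
  assumes "f \<in> L2 L"
  shows "integrable L (truncate f n)"
proof -
  have "(\<lambda>x. complex_of_real (indicat_real (pball 0 (- int n)) x)) \<in> L2 L"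
    using emeasure_L_pball[of 0 "- int n"] by (intro indicator_L2) auto
  from L2_mult_integrable[OF assms this] show ?thesis
    by (simp add: truncate_def[abs_def] scaleR_conv_of_real mult.commute)
qed

lemma truncate_tendsto:
  assumes f: "f \<in> L2 L"
  shows "L2_tendsto L (truncate f) f"
proof -
  have [measurable]: "f \<in> borel_measurable L" using f by (rule L2_measurable)
  have "(\<lambda>n. \<integral>x. (cmod (truncate f n x - f x))\<^sup>2 \<partial>L) \<longlonglongrightarrow> (\<integral>x. 0 \<partial>L)"
  proof (rule integral_dominated_convergence)
    show "integrable L (\<lambda>x. (cmod (f x))\<^sup>2)" using f by (rule L2_integrable_sq)
    show "AE x in L. (\<lambda>n. (cmod (truncate f n x - f x))\<^sup>2) \<longlonglongrightarrow> 0"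
    proof (rule AE_I2)
      fix x :: 'a
      obtain N where N: "absv x < real q ^ N"
        using real_arch_pow[of "real q" "absv x"] q_ge_2 by auto
      have "\<forall>\<^sub>F n in sequentially. (cmod (truncate f n x - f x))\<^sup>2 = 0"
        using eventually_ge_at_top[of N]
      proof eventually_elim
        case (elim n)
        have "real q ^ N \<le> real q ^ n" using elim q_pos by (intro power_increasing) auto
        then have "x \<in> pball 0 (- int n)"
          using N by (simp add: pball_def power_int_minus absv_pi power_inverse)
        then show ?case by (simp add: truncate_def)
      qed
      then show "(\<lambda>n. (cmod (truncate f n x - f x))\<^sup>2) \<longlonglongrightarrow> 0" by (rule tendsto_eventually)
    qed
    show "AE x in L. norm ((cmod (truncate f n x - f x))\<^sup>2) \<le> (cmod (f x))\<^sup>2" for n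
      by (intro AE_I2) (simp add: truncate_def indicator_def)
    show "(\<lambda>x. (cmod (truncate f n x - f x))\<^sup>2) \<in> borel_measurable L" for n
      unfolding truncate_def by measurable
  qed auto
  then have "(\<lambda>n. sqrt (\<integral>x. (cmod (truncate f n x - f x))\<^sup>2 \<partial>L)) \<longlonglongrightarrow> sqrt 0"
    by (intro tendsto_real_sqrt) simp
  then show ?thesis
    using f truncate_L2[OF f] by (simp add: L2_tendsto_def L2_norm_def)
qed

text \<open>
The unitary map given by \<open>fourier_pair\<close> satisfies the condition that characterizes
\<open>fourier_L2\<close>. A function satisfying it is the limit of the transforms of the truncations of \<open>f\<close>,
which determines its coefficients.
\<close>

theorem fourier_pair_L2:
  assumes f: "f \<in> L2 L"
  shows "fourier_pair f (fourier_L2 L chi f)"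
proof -
  obtain g where g: "fourier_pair f g"
    using same_coeffs_exists[OF coset_char_orthonormal dual_char_orthonormal f] .
  let ?P = "\<lambda>g. g \<in> L2 L \<and> (\<forall>F. (\<forall>n. integrable L (F n)) \<and> L2_tendsto L F f \<longrightarrow>
        L2_tendsto L (\<lambda>n. fourier_L1 L chi (F n)) g)"
  have "?P g"
  proof (intro conjI allI impI)
    show "g \<in> L2 L" using g by (simp add: same_coeffs_def)
    fix F assume F: "(\<forall>n. integrable L (F n)) \<and> L2_tendsto L F f"
    then have "fourier_pair (F n) (fourier_L1 L chi (F n))" for n
      by (intro fourier_pair_L1) (auto simp: L2_tendsto_def)
    then show "L2_tendsto L (\<lambda>n. fourier_L1 L chi (F n)) g"
      by (rule fourier_pair_tendsto[OF g _ conjunct2[OF F]])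
  qed
  then have P: "?P (fourier_L2 L chi f)" unfolding fourier_L2_def by (rule someI[where P="?P"])
  have "L2_tendsto L (\<lambda>n. fourier_L1 L chi (truncate f n)) (fourier_L2 L chi f)"
    using P truncate_tendsto[OF f] truncate_integrable[OF f] by blast
  then show ?thesis
    by (rule same_coeffs_limit[OF coset_char_orthonormal dual_char_orthonormal
          fourier_pair_L1[OF truncate_integrable[OF f] truncate_L2[OF f]] truncate_tendsto[OF f]])
qed

lemma space_L_UNIV: "space L = UNIV"
  by simp

lemma pi_powi_cancel:
  "\<pi> powi (- j) * (\<pi> powi j * x) = x" "\<pi> powi j * (\<pi> powi (- j) * x) = x"
  using pi_nonzero by (simp_all add: power_int_minus flip: mult.assoc)

lemma absv_pi_powi_powr: "absv \<pi> powi j = real q powr (- real_of_int j)"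
proof -
  have "real q powr real_of_int (- j) = real q powi (- j)"
    using q_pos by (intro powr_real_of_int') auto
  then show ?thesis by (simp add: absv_pi power_int_minus power_int_inverse)
qed

lemma measurable_translate [measurable (raw)]:
  "f \<in> borel_measurable L \<Longrightarrow> (\<lambda>x. f (x + y)) \<in> borel_measurable L"
  by (rule measurable_compose[OF translation_L])

lemma measurable_scale [measurable (raw)]:
  "f \<in> borel_measurable L \<Longrightarrow> (\<lambda>x. f (\<pi> powi j * x)) \<in> borel_measurable L"
  by (rule measurable_compose[OF scale_L])

lemma L2_translate:
  assumes "f \<in> L2 L"
  shows "(\<lambda>x. f (x + y)) \<in> L2 L" "L2_norm L (\<lambda>x. f (x + y)) = L2_norm L f"
proof -
  have m: "f \<in> borel_measurable L" using assms by (rule L2_measurable)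
  then have "(\<lambda>x. (cmod (f x))\<^sup>2) \<in> borel_measurable L" by simp
  from integral_translation[OF this, of y]
  show "L2_norm L (\<lambda>x. f (x + y)) = L2_norm L f" by (simp add: L2_norm_def)
  show "(\<lambda>x. f (x + y)) \<in> L2 L"
    using measurable_translate[OF m] integrable_translation[OF L2_integrable_sq[OF assms]]
    by (simp add: L2_def)
qed

lemma L2_dilate:
  assumes "f \<in> L2 L"
  shows "(\<lambda>x. f (\<pi> powi j * x)) \<in> L2 L"
    "L2_norm L (\<lambda>x. f (\<pi> powi j * x)) = sqrt (absv \<pi> powi (- j)) * L2_norm L f"
proof -
  have m: "f \<in> borel_measurable L" using assms by (rule L2_measurable)
  then have "(\<lambda>x. (cmod (f x))\<^sup>2) \<in> borel_measurable L" by simp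
  from integral_scale[OF this, of j]
  show "L2_norm L (\<lambda>x. f (\<pi> powi j * x)) = sqrt (absv \<pi> powi (- j)) * L2_norm L f"
    by (simp only: L2_norm_def real_scaleR_def real_sqrt_mult)
  show "(\<lambda>x. f (\<pi> powi j * x)) \<in> L2 L"
    using measurable_scale[OF m] integrable_scale[OF L2_integrable_sq[OF assms]]
    by (simp add: L2_def)
qed

section \<open>Dilation, translation and the Fourier transform\<close>

abbreviation wavelet :: "int \<Rightarrow> nat \<Rightarrow> ('a \<Rightarrow> complex) \<Rightarrow> 'a \<Rightarrow> complex" where
  "wavelet j k f \<equiv> dilation \<pi> c j (translation \<pi> c \<epsilon> k f)"

lemma wavelet_eq:
  "wavelet j k f x = of_real (real q powr (j / 2)) * f (\<pi> powi (- j) * x + (- uu k))"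
  by (simp add: dilation_def translation_def q_def)

text \<open>
The Fourier transform of \<open>wavelet j k f\<close> when \<open>g\<close> is the Fourier transform of \<open>f\<close>.
\<close>

definition dual_wavelet :: "int \<Rightarrow> nat \<Rightarrow> ('a \<Rightarrow> complex) \<Rightarrow> 'a \<Rightarrow> complex" where
  "dual_wavelet j k g \<xi> =
     of_real (real q powr (- j / 2)) * (cnj (chi (uu k * (\<pi> powi j * \<xi>))) * g (\<pi> powi j * \<xi>))"

lemma wavelet_L2:
  assumes "f \<in> L2 L"
  shows "wavelet j k f \<in> L2 L"
    "L2_norm L (wavelet j k f) = real q powr (j / 2) * sqrt (absv \<pi> powi j) * L2_norm L f"
  unfolding wavelet_eq[abs_def]
  using L2_scale[OF L2_dilate(1)[OF L2_translate(1)[OF assms, of "- uu k"], of "- j"]]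
    L2_norm_scale[of L "of_real (real q powr (j / 2))" "\<lambda>x. f (\<pi> powi (- j) * x + (- uu k))"]
    L2_dilate(2)[OF L2_translate(1)[OF assms, of "- uu k"], of "- j"]
    L2_translate(2)[OF assms, of "- uu k"]
  by simp_all

lemma L2_modulate:
  assumes "g \<in> L2 L"
  shows "(\<lambda>\<xi>. cnj (chi (y * \<xi>)) * g \<xi>) \<in> L2 L" "L2_norm L (\<lambda>\<xi>. cnj (chi (y * \<xi>)) * g \<xi>) = L2_norm L g"
proof -
  have [measurable]: "g \<in> borel_measurable L" using assms by (rule L2_measurable)
  show "(\<lambda>\<xi>. cnj (chi (y * \<xi>)) * g \<xi>) \<in> L2 L"
    by (rule L2_bound[OF assms]) (auto simp: norm_mult chi_norm)
  show "L2_norm L (\<lambda>\<xi>. cnj (chi (y * \<xi>)) * g \<xi>) = L2_norm L g"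
    by (simp add: L2_norm_def norm_mult chi_norm)
qed

lemma dual_wavelet_L2:
  assumes "g \<in> L2 L"
  shows "dual_wavelet j k g \<in> L2 L"
    "L2_norm L (dual_wavelet j k g) = real q powr (- j / 2) * sqrt (absv \<pi> powi (- j)) * L2_norm L g"
  unfolding dual_wavelet_def[abs_def]
  using L2_scale[OF L2_dilate(1)[OF L2_modulate(1)[OF assms, of "uu k"], of j]]
    L2_norm_scale[of L "of_real (real q powr (- j / 2))"
      "\<lambda>\<xi>. cnj (chi (uu k * (\<pi> powi j * \<xi>))) * g (\<pi> powi j * \<xi>)"]
    L2_dilate(2)[OF L2_modulate(1)[OF assms, of "uu k"], of j]
    L2_modulate(2)[OF assms, of "uu k"]
  by simp_all

lemma wavelet_integrable:
  assumes "integrable L f"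
  shows "integrable L (wavelet j k f)"
  unfolding wavelet_eq[abs_def]
  by (rule integrable_mult_right)
    (rule integrable_scale[of "\<lambda>x. f (x + (- uu k))"], rule integrable_translation[OF assms])

lemma fourier_wavelet:
  assumes f: "integrable L f"
  shows "fourier_L1 L chi (wavelet j k f) = dual_wavelet j k (fourier_L1 L chi f)"
proof
  fix \<xi>
  have [measurable]: "f \<in> borel_measurable L" using f by simp
  define y where "y = \<pi> powi j * \<xi>"
  have pp: "\<pi> powi j * \<pi> powi (- j) = 1" using pi_nonzero by (simp add: power_int_minus)
  define G where "G x = f (x + (- uu k)) * cnj (chi (y * x))" for x
  have [measurable]: "G \<in> borel_measurable L" unfolding G_def by measurable
  have "fourier_L1 L chi (wavelet j k f) \<xi> =
      (\<integral>x. of_real (real q powr (j / 2)) * G (\<pi> powi (- j) * x) \<partial>L)"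
    unfolding fourier_L1_def
  proof (intro Bochner_Integration.integral_cong refl)
    fix x
    have "y * (\<pi> powi (- j) * x) = (\<pi> powi j * \<pi> powi (- j)) * (\<xi> * x)"
      unfolding y_def by (simp only: mult_ac)
    then have "y * (\<pi> powi (- j) * x) = \<xi> * x" unfolding pp by simp
    then show "wavelet j k f x * cnj (chi (\<xi> * x)) = of_real (real q powr (j / 2)) * G (\<pi> powi (- j) * x)"
      by (simp only: wavelet_eq G_def mult.assoc)
  qed
  also have "\<dots> = of_real (real q powr (j / 2)) * (absv \<pi> powi j *\<^sub>R (\<integral>x. G x \<partial>L))"
    using integral_scale[of G "- j"] by simp
  also have "(\<integral>x. G x \<partial>L) = (\<integral>x. G (x + uu k) \<partial>L)"
    by (rule integral_translation[symmetric]) simp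
  also have "\<dots> = (\<integral>x. cnj (chi (y * uu k)) * (f x * cnj (chi (y * x))) \<partial>L)"
    by (intro Bochner_Integration.integral_cong refl) (simp add: G_def distrib_left chi_add)
  also have "\<dots> = cnj (chi (y * uu k)) * fourier_L1 L chi f y"
    unfolding fourier_L1_def by (rule integral_mult_right_zero)
  also have "of_real (real q powr (j / 2)) * (absv \<pi> powi j *\<^sub>R (cnj (chi (y * uu k)) * fourier_L1 L chi f y)) =
      of_real (real q powr (j / 2) * absv \<pi> powi j) * (cnj (chi (y * uu k)) * fourier_L1 L chi f y)"
    by (simp add: scaleR_conv_of_real)
  also have "real q powr (j / 2) * absv \<pi> powi j = real q powr (- j / 2)"
    unfolding absv_pi_powi_powr powr_add[symmetric] by simp
  finally show "fourier_L1 L chi (wavelet j k f) \<xi> = dual_wavelet j k (fourier_L1 L chi f) \<xi>"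
    unfolding dual_wavelet_def y_def[symmetric] mult.commute[of "uu k" y] by simp
qed

text \<open>
For integrable functions this is a change of variables. The truncations are integrable, and both
operations are multiples of isometries, so the relation passes to the limit.
\<close>

lemma fourier_pair_wavelet:
  assumes fg: "fourier_pair f g"
  shows "fourier_pair (wavelet j k f) (dual_wavelet j k g)"
proof -
  have f: "f \<in> L2 L" and g: "g \<in> L2 L" using fg by (auto simp: same_coeffs_def)
  note tr = truncate_integrable[OF f] truncate_L2[OF f]
  have 1: "fourier_pair (wavelet j k (truncate f n)) (dual_wavelet j k (fourier_L1 L chi (truncate f n)))" for n
    using fourier_pair_L1[OF wavelet_integrable[OF tr(1)] wavelet_L2(1)[OF tr(2)]]
    unfolding fourier_wavelet[OF tr(1)] .
  have 2: "L2_tendsto L (\<lambda>n. wavelet j k (truncate f n)) (wavelet j k f)"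
    by (rule L2_tendsto_map[OF truncate_tendsto[OF f] wavelet_L2])
      (auto simp: wavelet_eq fun_eq_iff right_diff_distrib)
  have "L2_tendsto L (\<lambda>n. fourier_L1 L chi (truncate f n)) g"
    using fg fourier_pair_L1[OF tr] truncate_tendsto[OF f] by (rule fourier_pair_tendsto)
  then have 3: "L2_tendsto L (\<lambda>n. dual_wavelet j k (fourier_L1 L chi (truncate f n))) (dual_wavelet j k g)"
    by (rule L2_tendsto_map[OF _ dual_wavelet_L2])
      (auto simp: dual_wavelet_def fun_eq_iff right_diff_distrib)
  show ?thesis
    by (rule same_coeffs_limit[OF coset_char_orthonormal dual_char_orthonormal 1 2 3])
qed

lemma multiwavelet_iff_dual:
  assumes "\<And>m. m \<in> {1..M} \<Longrightarrow> fourier_pair (\<psi> m) (g m)"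
  shows "multiwavelet L \<pi> c \<epsilon> M \<psi> \<longleftrightarrow>
    L2_orthonormal_basis L ({1..M} \<times> UNIV \<times> UNIV) (\<lambda>(m, j, k). dual_wavelet j k (g m))"
proof -
  have p: "fourier_pair ((\<lambda>(m, j, k). wavelet j k (\<psi> m)) i) ((\<lambda>(m, j, k). dual_wavelet j k (g m)) i)"
    if "i \<in> {1..M} \<times> UNIV \<times> UNIV" for i
    using that fourier_pair_wavelet[OF assms] by auto
  note C = coset_char_orthonormal coset_char_total
  note D = dual_char_orthonormal dual_char_total
  show ?thesis unfolding multiwavelet_def
    by (intro iffI, erule same_coeffs_basis[OF C D p, rotated],
        assumption, erule same_coeffs_basis[OF D C same_coeffs_sym[THEN iffD1, OF p], rotated])
qed

section \<open>The Fourier transforms of the wavelets\<close>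

text \<open>
Undoing the dilation reduces inner products at every scale to integrals against
\<open>chi (uu k * \<xi>)\<close>.
\<close>

lemma dual_wavelet_inner:
  assumes f: "f \<in> L2 L" and g: "g \<in> L2 L"
  shows "L2_inner L f (dual_wavelet j k g) =
    of_real (real q powr (j / 2)) * (\<integral>\<xi>. f (\<pi> powi (- j) * \<xi>) * cnj (g \<xi>) * chi (uu k * \<xi>) \<partial>L)"
proof -
  have [measurable]: "f \<in> borel_measurable L" "g \<in> borel_measurable L"
    using f g L2_measurable by auto
  define G where "G \<xi> = f (\<pi> powi (- j) * \<xi>) * cnj (g \<xi>) * chi (uu k * \<xi>)" for \<xi>
  have [measurable]: "G \<in> borel_measurable L" unfolding G_def by measurable
  have "f \<xi> * cnj (dual_wavelet j k g \<xi>) = of_real (real q powr (- j / 2)) * G (\<pi> powi j * \<xi>)" for \<xi>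
    unfolding dual_wavelet_def G_def pi_powi_cancel by (simp add: mult_ac)
  then have "L2_inner L f (dual_wavelet j k g) = of_real (real q powr (- j / 2)) * (\<integral>\<xi>. G (\<pi> powi j * \<xi>) \<partial>L)"
    unfolding L2_inner_def by simp
  also have "\<dots> = of_real (real q powr (- j / 2) * absv \<pi> powi (- j)) * (\<integral>\<xi>. G \<xi> \<partial>L)"
    using integral_scale[of G j] by (simp add: scaleR_conv_of_real)
  also have "real q powr (- j / 2) * absv \<pi> powi (- j) = real q powr (j / 2)"
    unfolding absv_pi_powi_powr powr_add[symmetric] by simp
  finally show ?thesis by (simp add: G_def)
qed

lemma dual_wavelet_nonzero:
  assumes "AE \<xi> in L. cmod (g \<xi>) = indicat_real W \<xi>"
  shows "AE \<xi> in L. dual_wavelet j k g \<xi> \<noteq> 0 \<longleftrightarrow> \<pi> powi j * \<xi> \<in> W"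
  using AE_scale[OF assms, of j]
proof eventually_elim
  case (elim \<xi>)
  have "chi y \<noteq> 0" for y using chi_norm[of y] by auto
  moreover have "g (\<pi> powi j * \<xi>) \<noteq> 0 \<longleftrightarrow> \<pi> powi j * \<xi> \<in> W"
    using elim by (cases "\<pi> powi j * \<xi> \<in> W") auto
  ultimately show ?case using q_pos by (simp add: dual_wavelet_def)
qed

lemma dual_wavelet_self_inner:
  assumes g: "g \<in> L2 L" and W: "W \<in> sets L" and gW: "AE \<xi> in L. cmod (g \<xi>) = indicat_real W \<xi>"
    and r: "uu r = uu l - uu k"
  shows "L2_inner L (dual_wavelet j k g) (dual_wavelet j l g) = (LINT \<xi>:W|L. chi (uu r * \<xi>))"
proof -
  have [measurable]: "g \<in> borel_measurable L" "W \<in> sets L"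
    using g L2_measurable W by auto
  have "dual_wavelet j k g (\<pi> powi (- j) * \<xi>) * cnj (g \<xi>) * chi (uu l * \<xi>) =
      of_real (real q powr (- j / 2)) * (of_real ((cmod (g \<xi>))\<^sup>2) * chi (uu r * \<xi>))" for \<xi>
  proof -
    have chi_r: "chi (uu r * \<xi>) = chi (uu l * \<xi>) * cnj (chi (uu k * \<xi>))"
      unfolding r left_diff_distrib chi_diff ..
    show ?thesis
      unfolding complex_norm_square dual_wavelet_def pi_powi_cancel chi_r by (simp add: mult_ac)
  qed
  then have "L2_inner L (dual_wavelet j k g) (dual_wavelet j l g) =
     of_real (real q powr (j / 2)) * (of_real (real q powr (- j / 2)) *
       (\<integral>\<xi>. of_real ((cmod (g \<xi>))\<^sup>2) * chi (uu r * \<xi>) \<partial>L))"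
    unfolding dual_wavelet_inner[OF dual_wavelet_L2(1)[OF g] g] by simp
  also have "\<dots> = of_real (real q powr (j / 2) * real q powr (- j / 2)) *
       (\<integral>\<xi>. of_real ((cmod (g \<xi>))\<^sup>2) * chi (uu r * \<xi>) \<partial>L)"
    by simp
  also have "real q powr (j / 2) * real q powr (- j / 2) = 1"
    unfolding powr_add[symmetric] using q_pos by simp
  also have "(\<integral>\<xi>. of_real ((cmod (g \<xi>))\<^sup>2) * chi (uu r * \<xi>) \<partial>L) = (LINT \<xi>:W|L. chi (uu r * \<xi>))"
    unfolding set_lebesgue_integral_def
  proof (rule integral_cong_AE)
    show "AE \<xi> in L. of_real ((cmod (g \<xi>))\<^sup>2) * chi (uu r * \<xi>) = indicat_real W \<xi> *\<^sub>R chi (uu r * \<xi>)"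
      using gW by eventually_elim (simp add: indicator_def)
  qed measurable
  finally show ?thesis by simp
qed

text \<open>
At each scale the system attached to \<open>W\<close> is complete in \<open>L2\<close> of the dilate of \<open>W\<close>. This serves
twice: it gives totality of the whole system, and, applied to another member of an orthogonal
system, disjointness of the dilates.
\<close>

lemma dual_wavelet_total_on_tile:
  assumes f: "f \<in> L2 L" and g: "g \<in> L2 L" and W: "tile W"
    and gW: "AE \<xi> in L. cmod (g \<xi>) = indicat_real W \<xi>"
    and z: "\<And>k. L2_inner L f (dual_wavelet j k g) = 0"
  shows "AE \<xi> in L. \<pi> powi j * \<xi> \<in> W \<longrightarrow> f \<xi> = 0"
proof -
  have "AE \<xi> in L. f (\<pi> powi (- j) * \<xi>) * cnj (g \<xi>) = 0"
  proof (rule tile_total[OF W])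
    show "integrable L (\<lambda>\<xi>. f (\<pi> powi (- j) * \<xi>) * cnj (g \<xi>))"
      by (rule L2_mult_integrable[OF L2_dilate(1)[OF f] g])
    show "AE \<xi> in L. \<xi> \<notin> W \<longrightarrow> f (\<pi> powi (- j) * \<xi>) * cnj (g \<xi>) = 0"
      using gW by eventually_elim (auto simp: indicator_def)
    show "(\<integral>\<xi>. f (\<pi> powi (- j) * \<xi>) * cnj (g \<xi>) * chi (uu k * \<xi>) \<partial>L) = 0" for k
      using z[of k] q_pos unfolding dual_wavelet_inner[OF f g] by simp
  qed
  with gW have "AE \<xi> in L. \<xi> \<in> W \<longrightarrow> f (\<pi> powi (- j) * \<xi>) = 0"
    by eventually_elim (auto simp: indicator_def)
  from AE_scale[OF this, of j] show ?thesis
  proof eventually_elim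
    case (elim \<xi>)
    then show ?case unfolding pi_powi_cancel .
  qed
qed

lemma tile_iff_partition:
  assumes "W \<in> sets L"
  shows "measurable_partition L UNIV (\<lambda>k. (\<lambda>x. x + uu k) ` W) UNIV \<longleftrightarrow> tile W"
proof -
  have im: "(\<lambda>x. x + uu k) ` W = (\<lambda>x. x + (- uu k)) -` W" for k
    unfolding vimage_translation by simp
  have s: "(\<lambda>x. x + uu k) ` W \<in> sets L" for k
    unfolding im by (rule vimage_translation_sets[OF assms])
  show ?thesis
    unfolding measurable_partition_UNIV_iff[of "\<lambda>k. (\<lambda>x. x + uu k) ` W", OF s space_L_UNIV] tile_def
    unfolding im using assms by simp
qed

lemma dilation_image: "(\<lambda>x. \<pi> powi j * x) ` V = (\<lambda>x. \<pi> powi (- j) * x) -` V"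
proof -
  have pp: "\<pi> powi (- j) * \<pi> powi j = 1" "\<pi> powi j * \<pi> powi (- j) = 1"
    using pi_nonzero by (simp_all add: power_int_minus)
  show ?thesis
  proof (intro set_eqI iffI)
    fix y assume "y \<in> (\<lambda>x. \<pi> powi (- j) * x) -` V"
    moreover have "y = \<pi> powi j * (\<pi> powi (- j) * y)" unfolding mult.assoc[symmetric] pp by simp
    ultimately show "y \<in> (\<lambda>x. \<pi> powi j * x) ` V" by (metis image_eqI vimage_eq)
  next
    fix y assume "y \<in> (\<lambda>x. \<pi> powi j * x) ` V"
    then obtain x where x: "x \<in> V" "y = \<pi> powi j * x" by blast
    have "\<pi> powi (- j) * y = x" unfolding x(2) mult.assoc[symmetric] pp by simp
    then show "y \<in> (\<lambda>x. \<pi> powi (- j) * x) -` V" using x(1) by simp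
  qed
qed

lemma dilation_partition_iff:
  assumes "V \<in> sets L"
  shows "measurable_partition L UNIV (\<lambda>j::int. (\<lambda>x. \<pi> powi j * x) ` V) UNIV \<longleftrightarrow>
    (AE x in L. \<exists>!j. \<pi> powi j * x \<in> V)"
proof -
  have s: "(\<lambda>x. \<pi> powi j * x) ` V \<in> sets L" for j
    unfolding dilation_image by (rule vimage_scale_sets[OF assms])
  have "(\<exists>!j. P (- j)) \<longleftrightarrow> (\<exists>!j. P j)" for P :: "int \<Rightarrow> bool"
    by (metis minus_minus)
  then have "(\<exists>!j. \<pi> powi (- j) * x \<in> V) \<longleftrightarrow> (\<exists>!j. \<pi> powi j * x \<in> V)" for x .
  then show ?thesis
    unfolding measurable_partition_UNIV_iff[of "\<lambda>j. (\<lambda>x. \<pi> powi j * x) ` V", OF s space_L_UNIV]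
    unfolding dilation_image by simp
qed

text \<open>
If the system is an orthonormal basis, orthogonality within one scale makes each \<open>W m\<close> a tile,
orthogonality between scales makes the dilates disjoint, and totality forbids a gap, since the
indicator of a gap would be orthogonal to everything. Conversely tiling gives orthonormality and
completeness within each dilate, and the dilates partition the field.
\<close>

theorem dual_system_basis_iff:
  fixes M :: nat and g :: "nat \<Rightarrow> 'a \<Rightarrow> complex" and W :: "nat \<Rightarrow> 'a set"
  assumes g: "\<And>m. m \<in> {1..M} \<Longrightarrow> g m \<in> L2 L"
    and W: "\<And>m. m \<in> {1..M} \<Longrightarrow> W m \<in> sets L"
    and disj: "disjoint_family_on W {1..M}"
    and gW: "\<And>m. m \<in> {1..M} \<Longrightarrow> AE \<xi> in L. cmod (g m \<xi>) = indicat_real (W m) \<xi>"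
  shows "L2_orthonormal_basis L ({1..M} \<times> UNIV \<times> UNIV) (\<lambda>(m, j, k). dual_wavelet j k (g m)) \<longleftrightarrow>
    (AE \<xi> in L. \<exists>!j. \<pi> powi j * \<xi> \<in> (\<Union>m\<in>{1..M}. W m)) \<and> (\<forall>m\<in>{1..M}. tile (W m))"
    (is "?basis \<longleftrightarrow> ?dil \<and> ?tiles")
proof -
  let ?I = "{1..M} \<times> (UNIV :: int set) \<times> (UNIV :: nat set)"
  let ?e = "\<lambda>(m, j, k). dual_wavelet j k (g m)"
  have eL2: "dual_wavelet j k (g m) \<in> L2 L" if "m \<in> {1..M}" for j k m
    using g[OF that] by (rule dual_wavelet_L2)
  have supp: "AE \<xi> in L. \<forall>m j k. m \<in> {1..M} \<longrightarrow>
      (dual_wavelet j k (g m) \<xi> \<noteq> 0 \<longleftrightarrow> \<pi> powi j * \<xi> \<in> W m)"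
    unfolding AE_all_countable using dual_wavelet_nonzero[OF gW] by simp
  show ?thesis unfolding L2_orthonormal_basis_iff
  proof (intro iffI)
    assume "L2_orthonormal L ?I ?e \<and> L2_total L ?I ?e"
    then have o: "L2_orthonormal L ?I ?e" and t: "L2_total L ?I ?e" by auto
    have inner: "L2_inner L (dual_wavelet j k (g m)) (dual_wavelet i l (g n)) =
        (if (m, j, k) = (n, i, l) then 1 else 0)" if "m \<in> {1..M}" "n \<in> {1..M}" for m n j i k l
    proof -
      have "(m, j, k) \<in> ?I" "(n, i, l) \<in> ?I" using that by auto
      then have "L2_inner L (?e (m, j, k)) (?e (n, i, l)) = (if (m, j, k) = (n, i, l) then 1 else 0)"
        using o unfolding L2_orthonormal_def by blast
      then show ?thesis by simp
    qed
    have tiles: "tile (W m)" if m: "m \<in> {1..M}" for m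
    proof (rule tile_if_integral_chi[OF W[OF m]])
      have [measurable]: "g m \<in> borel_measurable L" "W m \<in> sets L"
        using g[OF m] L2_measurable W[OF m] by auto
      have "integrable L (indicat_real (W m))"
      proof (rule integrable_cong_AE_imp[OF L2_integrable_sq[OF g[OF m]]])
        show "AE \<xi> in L. (cmod (g m \<xi>))\<^sup>2 = indicat_real (W m) \<xi>"
          using gW[OF m] by eventually_elim (simp add: indicator_def)
      qed measurable
      then show "emeasure L (W m) < \<infinity>" using W[OF m] by (simp add: integrable_indicator_iff)
      fix k
      show "(LINT x:W m|L. chi (uu k * x)) = (if k = 0 then 1 else 0)"
        using dual_wavelet_self_inner[OF g[OF m] W[OF m] gW[OF m], of k k 0 0] inner[OF m m, of 0 0 0 k]
        by auto
    qed
    have uniq: "AE \<xi> in L. \<not> (\<pi> powi j * \<xi> \<in> W m \<and> \<pi> powi i * \<xi> \<in> W n)"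
      if m: "m \<in> {1..M}" and n: "n \<in> {1..M}" and ne: "i \<noteq> j" for m n i j
    proof -
      have "AE \<xi> in L. \<pi> powi i * \<xi> \<in> W n \<longrightarrow> dual_wavelet j 0 (g m) \<xi> = 0"
        by (rule dual_wavelet_total_on_tile[OF eL2[OF m] g[OF n] tiles[OF n] gW[OF n]])
          (use inner[OF m n] ne in simp)
      with supp show ?thesis by eventually_elim (use m in blast)
    qed
    have exists: "AE \<xi> in L. \<exists>j. \<pi> powi j * \<xi> \<in> (\<Union>m\<in>{1..M}. W m)"
    proof -
      have U: "(\<Union>m\<in>{1..M}. W m) \<in> sets L" using W by (intro sets.finite_UN) auto
      \<comment> \<open>The gap left by the dilates; it is cut off to balls to obtain functions in \<open>L2\<close>.\<close>
      define A where "A = space L - (\<Union>j. (\<lambda>x. \<pi> powi j * x) -` (\<Union>m\<in>{1..M}. W m))"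
      have A: "A \<in> sets L"
        unfolding A_def by (intro sets.Diff sets.top sets.countable_UN image_subsetI vimage_scale_sets U)
      have "AE \<xi> in L. complex_of_real (indicat_real (A \<inter> pball 0 (- int n)) \<xi>) = 0" for n
      proof -
        let ?f = "\<lambda>\<xi>. complex_of_real (indicat_real (A \<inter> pball 0 (- int n)) \<xi>)"
        have "emeasure L (A \<inter> pball 0 (- int n)) \<le> emeasure L (pball 0 (- int n))"
          by (intro emeasure_mono) auto
        also have "\<dots> < \<infinity>" using emeasure_L_pball[of 0 "- int n"] by simp
        finally have f: "?f \<in> L2 L" using A by (intro indicator_L2) auto
        have "L2_inner L ?f (?e i) = 0" if i: "i \<in> ?I" for i
        proof -
          obtain m j k where mjk: "i = (m, j, k)" "m \<in> {1..M}" using i by auto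
          have "L2_inner L ?f (dual_wavelet j k (g m)) = (\<integral>x. 0 \<partial>L)"
            unfolding L2_inner_def
          proof (rule integral_cong_AE)
            show "(\<lambda>x. ?f x * cnj (dual_wavelet j k (g m) x)) \<in> borel_measurable L"
              using L2_measurable[OF f] L2_measurable[OF eL2[OF mjk(2)]]
              by (intro borel_measurable_times borel_measurable_cnj)
            show "AE x in L. ?f x * cnj (dual_wavelet j k (g m) x) = 0"
              using supp
            proof eventually_elim
              case (elim \<xi>)
              show ?case
              proof (cases "\<xi> \<in> A")
                case True
                then have "\<pi> powi j * \<xi> \<notin> W m" using mjk(2) by (auto simp: A_def)
                then have "dual_wavelet j k (g m) \<xi> = 0" using elim mjk(2) by blast
                then show ?thesis by simp
              qed simp
            qed
          qed simp
          then show ?thesis by (simp add: mjk)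
        qed
        then show ?thesis using t f unfolding L2_total_def by blast
      qed
      then have "AE \<xi> in L. \<forall>n. complex_of_real (indicat_real (A \<inter> pball 0 (- int n)) \<xi>) = 0"
        unfolding AE_all_countable by blast
      then show ?thesis
      proof eventually_elim
        case (elim \<xi>)
        obtain N where "absv \<xi> < real q ^ N"
          using real_arch_pow[of "real q" "absv \<xi>"] q_ge_2 by auto
        then have "\<xi> \<in> pball 0 (- int N)"
          by (simp add: pball_def power_int_minus absv_pi power_inverse)
        moreover have "\<xi> \<notin> A \<inter> pball 0 (- int N)"
          using elim[rule_format, of N] by (simp add: indicator_def split: if_splits)
        ultimately have "\<xi> \<notin> A" by blast
        then show ?case by (simp add: A_def)
      qed
    qed
    have "AE \<xi> in L. \<forall>m n i j. m \<in> {1..M} \<longrightarrow> n \<in> {1..M} \<longrightarrow> i \<noteq> j \<longrightarrow>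
        \<not> (\<pi> powi j * \<xi> \<in> W m \<and> \<pi> powi i * \<xi> \<in> W n)"
      unfolding AE_all_countable using uniq by simp
    with exists have ?dil by eventually_elim (metis UN_E)
    then show "?dil \<and> ?tiles" using tiles by blast
  next
    assume "?dil \<and> ?tiles"
    then have dil: ?dil and tiles: "\<And>m. m \<in> {1..M} \<Longrightarrow> tile (W m)" by auto
    have inner: "L2_inner L (dual_wavelet j k (g m)) (dual_wavelet i l (g n)) =
        (if (m, j, k) = (n, i, l) then 1 else 0)" if m: "m \<in> {1..M}" and n: "n \<in> {1..M}" for m n j i k l
    proof (cases "m = n \<and> j = i")
      case True
      obtain r where r: "uu r = uu l - uu k" using u_minus by blast
      have "r = 0 \<longleftrightarrow> uu r = uu 0" by (simp add: u_inj del: u_0)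
      also have "\<dots> \<longleftrightarrow> k = l" by (auto simp: r u_inj)
      finally show ?thesis
        using True dual_wavelet_self_inner[OF g[OF m] W[OF m] gW[OF m] r, of j]
          tile_integral_chi[OF tiles[OF m], of r] by simp
    next
      case False
      have "L2_inner L (dual_wavelet j k (g m)) (dual_wavelet i l (g n)) = (\<integral>x. 0 \<partial>L)"
        unfolding L2_inner_def
      proof (rule integral_cong_AE)
        show "(\<lambda>x. dual_wavelet j k (g m) x * cnj (dual_wavelet i l (g n) x)) \<in> borel_measurable L"
          using L2_measurable[OF eL2[OF m]] L2_measurable[OF eL2[OF n]]
          by (intro borel_measurable_times borel_measurable_cnj)
        show "AE x in L. dual_wavelet j k (g m) x * cnj (dual_wavelet i l (g n) x) = 0"
          using supp dil
        proof eventually_elim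
          case (elim \<xi>)
          show ?case
          proof (rule ccontr)
            assume "dual_wavelet j k (g m) \<xi> * cnj (dual_wavelet i l (g n) \<xi>) \<noteq> 0"
            then have ne: "dual_wavelet j k (g m) \<xi> \<noteq> 0" "dual_wavelet i l (g n) \<xi> \<noteq> 0" by auto
            have in1: "\<pi> powi j * \<xi> \<in> W m" using elim(1) m ne(1) by blast
            have in2: "\<pi> powi i * \<xi> \<in> W n" using elim(1) n ne(2) by blast
            have "j = i" using elim(2) in1 in2 m n by blast
            moreover have "m = n"
              using disj in1 in2 m n \<open>j = i\<close> unfolding disjoint_family_on_def by blast
            ultimately show False using False by simp
          qed
        qed
      qed simp
      then show ?thesis using False by auto
    qed
    have "L2_orthonormal L ?I ?e"
      unfolding L2_orthonormal_def using eL2 inner by auto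
    moreover have "L2_total L ?I ?e"
      unfolding L2_total_def
    proof (intro ballI impI)
      fix f assume f: "f \<in> L2 L" and z: "\<forall>i\<in>?I. L2_inner L f (?e i) = 0"
      have "AE \<xi> in L. m \<in> {1..M} \<longrightarrow> \<pi> powi j * \<xi> \<in> W m \<longrightarrow> f \<xi> = 0" for m j
      proof (cases "m \<in> {1..M}")
        case True
        have "L2_inner L f (dual_wavelet j k (g m)) = 0" for k
        proof -
          have "(m, j, k) \<in> ?I" using True by simp
          then have "L2_inner L f (?e (m, j, k)) = 0" using z by blast
          then show ?thesis by simp
        qed
        from dual_wavelet_total_on_tile[OF f g[OF True] tiles[OF True] gW[OF True] this]
        show ?thesis by simp
      next
        case False
        then show ?thesis by (intro AE_I2) blast
      qed
      then have "AE \<xi> in L. \<forall>m j. m \<in> {1..M} \<longrightarrow> \<pi> powi j * \<xi> \<in> W m \<longrightarrow> f \<xi> = 0"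
        unfolding AE_all_countable by blast
      with dil show "AE \<xi> in L. f \<xi> = 0" by eventually_elim blast
    qed
    ultimately show "L2_orthonormal L ?I ?e \<and> L2_total L ?I ?e" by blast
  qed
qed

end

section \<open>Characterization of multiwavelets\<close>

theorem corollary3p4:
  fixes \<pi> :: "'a::{field, metric_space}" and c :: nat and \<epsilon> :: "nat \<Rightarrow> 'a"
    and haar :: "'a measure" and chi :: "'a \<Rightarrow> complex"
    and M :: nat and \<psi> :: "nat \<Rightarrow> 'a \<Rightarrow> complex" and W :: "nat \<Rightarrow> 'a set"
  assumes "local_field_setup \<pi> c \<epsilon> haar chi"
    and "\<And>m. m \<in> {1..M} \<Longrightarrow> \<psi> m \<in> L2 (completion haar)"
    and "\<And>m. m \<in> {1..M} \<Longrightarrow> W m \<in> sets (completion haar)"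
    and "disjoint_family_on W {1..M}"
    and "\<And>m. m \<in> {1..M} \<Longrightarrow>
           AE \<xi> in completion haar.
             cmod (fourier_L2 (completion haar) chi (\<psi> m) \<xi>) = indicator (W m) \<xi>"
  shows "multiwavelet (completion haar) \<pi> c \<epsilon> M \<psi> \<longleftrightarrow>
      measurable_partition (completion haar) UNIV
        (\<lambda>j::int. (\<lambda>x. \<pi> powi j * x) ` (\<Union>m\<in>{1..M}. W m)) UNIV \<and>
      (\<forall>m\<in>{1..M}.
        measurable_partition (completion haar) UNIV
          (\<lambda>k::nat. (\<lambda>x. x + u \<pi> c \<epsilon> k) ` W m) UNIV)"
proof -
  interpret local_field_setup \<pi> c \<epsilon> haar chi by fact
  let ?g = "\<lambda>m. fourier_L2 L chi (\<psi> m)"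
  have pair: "fourier_pair (\<psi> m) (?g m)" if "m \<in> {1..M}" for m
    using fourier_pair_L2[OF assms(2)[OF that]] .
  have U: "(\<Union>m\<in>{1..M}. W m) \<in> sets L" using assms(3) by (intro sets.finite_UN) auto
  have "multiwavelet L \<pi> c \<epsilon> M \<psi> \<longleftrightarrow>
      L2_orthonormal_basis L ({1..M} \<times> UNIV \<times> UNIV) (\<lambda>(m, j, k). dual_wavelet j k (?g m))"
    using pair by (rule multiwavelet_iff_dual)
  also have "\<dots> \<longleftrightarrow> (AE \<xi> in L. \<exists>!j. \<pi> powi j * \<xi> \<in> (\<Union>m\<in>{1..M}. W m)) \<and> (\<forall>m\<in>{1..M}. tile (W m))"
    by (rule dual_system_basis_iff) (use pair assms in \<open>auto simp: same_coeffs_def\<close>)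
  finally show ?thesis
    unfolding dilation_partition_iff[OF U] using tile_iff_partition[OF assms(3)] by simp
qed

end
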